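(* Suppose the kernel conditions (K1)–(K3) and the distributional conditions (D1)–(D4) of the context hold with $\alpha(p)=O(1)$. Suppose there are positive constants $L_2,U_2<\infty$ (not depending on $p$) and exponents $0\le\delta_1<1$, $-1\le\delta_2<1$ with $\delta_1\ne\delta_2$ and $\max\{\delta_1,\delta_2\}>0$ such that $L_2\alpha(p)p\le\|\rho\Sigma_X+(1-\rho)\Sigma_Y\|_F^2\le U_2\alpha(p)p$, $$L_2p^{\delta_1}\le|\Delta|^2\le U_2p^{\delta_1}\quad\text{and}\quad L_2p^{(1+\delta_2)/2}\le\big|\mathbb{E}|\tilde X_1|^2-\mathbb{E}|\tilde Y_1|^2\big|\le U_2p^{(1+\delta_2)/2}.$$ Assume that for any $k=k^{(p)}$ in a sequence of $\mathcal{C}$, $\mathbb{E}[k^4(Z_1,Z_2)]<\infty$, and that $n/N=\rho+O(1/N)$ as $n,m\to\infty$ for some $0<\rho<1$, where $N=n+m$. Then for any $C>0$, $\mathbb{P}(T_{n,m,p}^k>C)\to1$ when $n,m,p\to\infty$ as long as $p=o\big(N^{1/(2-2\max\{\delta_1,\delta_2,1/2\})}\big)$.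
   Context: Kernel: a kernel on $\mathbb{R}^p$ is a symmetric function $k:\mathbb{R}^p\times\mathbb{R}^p\to\mathbb{R}$ satisfying either (a) $k\ge0$, $k(x,y)=0$ iff $x=y$, and for all Borel probability measures $P\ne Q$ with $\int k(z,z_0)\,dP(z)<\infty$ and $\int k(z,z_0)\,dQ(z)<\infty$ for some $z_0$, one has $\int k\,d([P-Q]\times[P-Q])<0$; or (b) $-k$ is the reproducing kernel of an RKHS on $\mathbb{R}^p$ and is characteristic (the mean embedding map on Borel probability measures is injective). $\mathcal{C}$ is a set of sequences $(k^{(p)})_{p\ge1}$ of kernels, $k^{(p)}$ on $\mathbb{R}^p$. Write $a_0^k=k(x,x)$ (constant in $x$ here). Sampling: for each $p$, $X=(x_1,\dots,x_p)^\top$, $Y=(y_1,\dots,y_p)^\top$ are random vectors in $\mathbb{R}^p$ with covariance matrices $\Sigma_X,\Sigma_Y$; $X_1,\dots,X_n$ are i.i.d. copies of $X$, $Y_1,\dots,Y_m$ i.i.d. copies of $Y$, the two samples independent. $Z$ equals $X$ with probability $\rho$ and $Y$ with probability $1-\rho$; $Z_1,Z_2,\dots$ are i.i.d. copies of $Z$. $\tilde X=X-\mathbb{E}X$, $\tilde Y=Y-\mathbb{E}Y$, $\Delta=\mathbb{E}X-\mathbb{E}Y$, $|\cdot|$ is the Euclidean norm, $\|\cdot\|_F$ the Frobenius norm. $A=\mathbb{E}|Z_1-Z_2|^2$, $A^X=\mathbb{E}|X_1-X_2|^2$, $A^{XY}=\mathbb{E}|X_1-Y_1|^2$, $A^Y=\mathbb{E}|Y_1-Y_2|^2$;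 $A_0=A^{1/2}$, $A_0^{XY}=(A^{XY})^{1/2}$. Kernel conditions: each $k^{(p)}$ occurring in $\mathcal{C}$ has the form $k^{(p)}(x,y)=f^{(p)}(|x-y|)$; $D$ is the domain of $f^{(p)}$, $D_0\subseteq D$ contains $A_0$ and $A_0^{XY}$; $f_i^{(p)}$ is the $i$-th derivative ($f_0^{(p)}=f^{(p)}$). (K1) For each $f^{(p)}$, all $s\in D$, $s_0\in D_0$: $f^{(p)}(s)=\sum_{i=0}^6\frac{1}{i!}f_i^{(p)}(s_0)(s-s_0)^i+\frac1{7!}f_7^{(p)}(\xi)(s-s_0)^7$ for some $\xi=\xi(s,s_0)$ between $s$ and $s_0$. (K2) There is $\tilde M<\infty$ such that for any $f^{(p)}$ and $s_0\in D_0$: $\max_{1\le i\le7}\sup_{s\in D}|f_i^{(p)}(s)|\cdot|s_0^i|\le\tilde M|f_0^{(p)}(s_0)|$. (K3) There is $\hat M<\infty$ such that for any $f^{(p)}$ and $s_0\in D_0$: $|f_0^{(p)}(s_0)|\le\hat M\min\{|\tfrac12f_1^{(p)}(s_0)s_0|,\ |-\tfrac18f_1^{(p)}(s_0)s_0+\tfrac18f_2^{(p)}(s_0)s_0^2|\}$. Distributional conditions (constants not depending on $p$): (D1) There is an integer $1\le\alpha(p)$ with $\alpha(p)=o(p)$ such that for any $1\le j\le p-\alpha(p)-1$ and $\ell>\alpha(p)$, $\{x_i\}_{i\le j}$ is independent of $\{x_i\}_{i\ge j+\ell}$ and $\{y_i\}_{i\le j}$ is independent of $\{y_i\}_{i\ge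 j+\ell}$. (D2) There is $0<U^*<\infty$ with $\max_{1\le j\le p}\max_{1\le r\le128}\{\mathbb{E}|x_j|^r,\mathbb{E}|y_j|^r\}<U^*$. (D3) There are $0<L_0,U_0<\infty$ with $L_0p\le\min\{A^X,A^{XY},A^Y\}\le\max\{A^X,A^{XY},A^Y\}\le U_0p$. (D4) There are $0<L_0^*,U_0^*<\infty$ with $L_0^*\alpha(p)p\le\min\{\|\Sigma_X\|_F^2,\|\Sigma_Y\|_F^2\}\le\max\{\|\Sigma_X\|_F^2,\|\Sigma_Y\|_F^2\}\le U_0^*\alpha(p)p$. Test statistic: $\mathcal{E}_{n,m}^k(X,Y)=\frac{2}{nm}\sum_{i=1}^n\sum_{j=1}^m k(X_i,Y_j)-\binom n2^{-1}\sum_{1\le i<j\le n}k(X_i,X_j)-\binom m2^{-1}\sum_{1\le i<j\le m}k(Y_i,Y_j)$; $c_{n,m}=\frac{2}{n(n-1)}+\frac{4}{nm}+\frac{2}{m(m-1)}$. Let $W_1,\dots,W_N$ be the pooled sample ($W_s=X_s$ for $s\le n$, $W_s=Y_{s-n}$ for $s>n$), $a_{s,t}=k(W_s,W_t)$ for $1\le s,t\le N$, $\tilde a_{\cdot t}=\frac{1}{N-2}\sum_{i=1}^N a_{i,t}$, $\tilde a_{s\cdot}=\frac1{N-2}\sum_{j=1}^Na_{s,j}$, $\tilde a_{\cdot\cdot}=\frac{1}{(N-1)(N-2)}\sum_{i,j=1}^Na_{i,j}$, $A^*_{s,t}=a_{s,t}-\tilde a_{\cdot t}-\tilde a_{s\cdot}+\tilde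 a_{\cdot\cdot}$, and $\mathcal{V}_{n,m}^{k*}(X,Y)=\frac{1}{N(N-3)}\sum_{s\ne t}(A^*_{s,t})^2-\frac{(a_0^k)^2}{(N-1)(N-3)}$. Finally $T_{n,m,p}^k=\mathcal{E}_{n,m}^k(X,Y)\big/\sqrt{c_{n,m}\mathcal{V}_{n,m}^{k*}(X,Y)}$. *)

theory Defs
  imports "HOL-Probability.Probability" "HOL-Library.Landau_Symbols"
begin

section \<open>Euclidean space of varying dimension\<close>

text \<open>
  The dimension \<open>p\<close> tends to infinity, so a vector of \<open>R^p\<close> is an extensional function on the
  index set \<open>{1..p}\<close>. The product sigma-algebra below is the Borel sigma-algebra of \<open>R^p\<close>.
\<close>

type_synonym rvec = "nat \<Rightarrow> real"

definition rspace :: "nat \<Rightarrow> rvec measure" where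
  "rspace p = Pi\<^sub>M {1..p} (\<lambda>_. borel)"

definition enorm :: "nat \<Rightarrow> rvec \<Rightarrow> real" where
  "enorm p x = L2_set x {1..p}"

definition edist :: "nat \<Rightarrow> rvec \<Rightarrow> rvec \<Rightarrow> real" where
  "edist p x y = enorm p (\<lambda>i. x i - y i)"

definition borel_probs :: "nat \<Rightarrow> rvec measure set" where
  "borel_probs p = {P. prob_space P \<and> sets P = sets (rspace p)}"


section \<open>Kernels\<close>

text \<open>
  The integral of \<open>k\<close> against the signed measure \<open>[P - Q] \<times> [P - Q]\<close> is
  expanded bilinearly. For it to be meaningful, \<open>k\<close> has to be integrable against the four
  product measures; this is made explicit since Isabelle's integral is total.
\<close>

definition strong_negative_type_kernel :: "nat \<Rightarrow> (rvec \<Rightarrow> rvec \<Rightarrow> real) \<Rightarrow> bool" where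
  "strong_negative_type_kernel p k \<longleftrightarrow>
     (\<forall>x\<in>space (rspace p). \<forall>y\<in>space (rspace p). 0 \<le> k x y \<and> (k x y = 0 \<longleftrightarrow> x = y)) \<and>
     (\<forall>P\<in>borel_probs p. \<forall>Q\<in>borel_probs p. P \<noteq> Q \<longrightarrow>
        (\<exists>z0\<in>space (rspace p). integrable P (\<lambda>z. k z z0) \<and> integrable Q (\<lambda>z. k z z0)) \<longrightarrow>
        (\<forall>R\<in>{P, Q}. \<forall>S\<in>{P, Q}. integrable (R \<Otimes>\<^sub>M S) (\<lambda>(x, y). k x y)) \<and>
        (\<integral>(x, y). k x y \<partial>(P \<Otimes>\<^sub>M P)) - (\<integral>(x, y). k x y \<partial>(P \<Otimes>\<^sub>M Q))
          - (\<integral>(x, y). k x y \<partial>(Q \<Otimes>\<^sub>M P)) + (\<integral>(x, y). k x y \<partial>(Q \<Otimes>\<^sub>M Q)) < 0)"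

text \<open>
  A real Hilbert space of functions on \<open>S\<close>: carrier \<open>H\<close> (functions made extensional on \<open>S\<close>)
  with pointwise operations and inner product \<open>ip\<close>.
\<close>

definition function_hilbert_space ::
  "'b set \<Rightarrow> ('b \<Rightarrow> real) set \<Rightarrow> (('b \<Rightarrow> real) \<Rightarrow> ('b \<Rightarrow> real) \<Rightarrow> real) \<Rightarrow> bool" where
  "function_hilbert_space S H ip \<longleftrightarrow>
     H \<subseteq> extensional S \<and>
     (\<lambda>x\<in>S. 0) \<in> H \<and>
     (\<forall>g\<in>H. \<forall>h\<in>H. (\<lambda>x\<in>S. g x + h x) \<in> H) \<and>
     (\<forall>c. \<forall>h\<in>H. (\<lambda>x\<in>S. c * h x) \<in> H) \<and>
     (\<forall>g\<in>H. \<forall>h\<in>H. ip g h = ip h g) \<and>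
     (\<forall>g\<in>H. \<forall>g'\<in>H. \<forall>h\<in>H. ip (\<lambda>x\<in>S. g x + g' x) h = ip g h + ip g' h) \<and>
     (\<forall>c. \<forall>g\<in>H. \<forall>h\<in>H. ip (\<lambda>x\<in>S. c * g x) h = c * ip g h) \<and>
     (\<forall>h\<in>H. 0 \<le> ip h h \<and> (ip h h = 0 \<longleftrightarrow> h = (\<lambda>x\<in>S. 0))) \<and>
     (let d = (\<lambda>g h. sqrt (ip (\<lambda>x\<in>S. g x - h x) (\<lambda>x\<in>S. g x - h x)))
      in \<forall>\<sigma> :: nat \<Rightarrow> 'b \<Rightarrow> real. range \<sigma> \<subseteq> H \<and> (\<forall>e>0. \<exists>N. \<forall>i\<ge>N. \<forall>j\<ge>N. d (\<sigma> i) (\<sigma> j) < e) \<longrightarrow>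
           (\<exists>h\<in>H. (\<lambda>i. d (\<sigma> i) h) \<longlonglongrightarrow> 0))"

definition reproducing_kernel ::
  "'b set \<Rightarrow> ('b \<Rightarrow> 'b \<Rightarrow> real) \<Rightarrow> ('b \<Rightarrow> real) set \<Rightarrow> (('b \<Rightarrow> real) \<Rightarrow> ('b \<Rightarrow> real) \<Rightarrow> real) \<Rightarrow> bool" where
  "reproducing_kernel S K H ip \<longleftrightarrow>
     function_hilbert_space S H ip \<and>
     (\<forall>x\<in>S. (\<lambda>y\<in>S. K y x) \<in> H \<and> (\<forall>h\<in>H. ip h (\<lambda>y\<in>S. K y x) = h x))"

text \<open>
  The mean embedding of \<open>P\<close> is the weak integral of \<open>z \<mapsto> K(\<cdot>, z)\<close>, that is, the (necessarily
  unique) element of \<open>H\<close> representing \<open>h \<mapsto> \<integral>h dP\<close>. It exists for every \<open>P\<close> when \<open>K\<close> is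
  measurable with constant diagonal.
\<close>

definition mean_embedding ::
  "(rvec \<Rightarrow> real) set \<Rightarrow> ((rvec \<Rightarrow> real) \<Rightarrow> (rvec \<Rightarrow> real) \<Rightarrow> real) \<Rightarrow> rvec measure \<Rightarrow> (rvec \<Rightarrow> real) \<Rightarrow> bool" where
  "mean_embedding H ip P \<mu> \<longleftrightarrow>
     \<mu> \<in> H \<and> (\<forall>h\<in>H. integrable P h \<and> ip h \<mu> = (\<integral>z. h z \<partial>P))"

definition characteristic ::
  "nat \<Rightarrow> (rvec \<Rightarrow> real) set \<Rightarrow> ((rvec \<Rightarrow> real) \<Rightarrow> (rvec \<Rightarrow> real) \<Rightarrow> real) \<Rightarrow> bool" where
  "characteristic p H ip \<longleftrightarrow>
     (\<forall>P\<in>borel_probs p. \<exists>\<mu>. mean_embedding H ip P \<mu>) \<and>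
     (\<forall>P\<in>borel_probs p. \<forall>Q\<in>borel_probs p. \<forall>\<mu>.
        mean_embedding H ip P \<mu> \<and> mean_embedding H ip Q \<mu> \<longrightarrow> P = Q)"

definition is_kernel :: "nat \<Rightarrow> (rvec \<Rightarrow> rvec \<Rightarrow> real) \<Rightarrow> bool" where
  "is_kernel p k \<longleftrightarrow>
     (\<forall>x\<in>space (rspace p). \<forall>y\<in>space (rspace p). k x y = k y x) \<and>
     (strong_negative_type_kernel p k \<or>
      (\<exists>H ip. reproducing_kernel (space (rspace p)) (\<lambda>x y. - k x y) H ip \<and> characteristic p H ip))"

type_synonym kernel_seq = "nat \<Rightarrow> rvec \<Rightarrow> rvec \<Rightarrow> real"

text \<open>
  \<open>f\<close> represents \<open>k\<close> as a function of the distance: \<open>f 0\<close> is the profile, with domain \<open>D\<close>, and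
  \<open>f i\<close> its \<open>i\<close>-th derivative, one-sided at an end point of \<open>D\<close>. The domain contains all
  distances, hence \<open>[0, \<infinity>)\<close>.
\<close>

definition radial_representation ::
  "nat \<Rightarrow> (rvec \<Rightarrow> rvec \<Rightarrow> real) \<Rightarrow> real set \<Rightarrow> (nat \<Rightarrow> real \<Rightarrow> real) \<Rightarrow> bool" where
  "radial_representation p k D f \<longleftrightarrow>
     (\<forall>x\<in>space (rspace p). \<forall>y\<in>space (rspace p). k x y = f 0 (edist p x y)) \<and>
     is_interval D \<and> {0..} \<subseteq> D \<and>
     (\<forall>i<7. \<forall>s\<in>D. (f i has_real_derivative f (Suc i) s) (at s within D))"


section \<open>Moments and dependence\<close>

definition mean_vec :: "'a measure \<Rightarrow> ('a \<Rightarrow> rvec) \<Rightarrow> rvec" where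
  "mean_vec M U = (\<lambda>i. \<integral>\<omega>. U \<omega> i \<partial>M)"

definition cov_mat :: "'a measure \<Rightarrow> ('a \<Rightarrow> rvec) \<Rightarrow> nat \<Rightarrow> nat \<Rightarrow> real" where
  "cov_mat M U = (\<lambda>i j. \<integral>\<omega>. (U \<omega> i - mean_vec M U i) * (U \<omega> j - mean_vec M U j) \<partial>M)"

definition frobenius_norm :: "nat \<Rightarrow> (nat \<Rightarrow> nat \<Rightarrow> real) \<Rightarrow> real" where
  "frobenius_norm p S = sqrt (\<Sum>i\<in>{1..p}. \<Sum>j\<in>{1..p}. (S i j)\<^sup>2)"

definition mean_sq_dist :: "nat \<Rightarrow> 'a measure \<Rightarrow> ('a \<Rightarrow> rvec) \<Rightarrow> ('a \<Rightarrow> rvec) \<Rightarrow> real" where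
  "mean_sq_dist p M U V = (\<integral>\<omega>. (edist p (U \<omega>) (V \<omega>))\<^sup>2 \<partial>M)"

definition centered_sq_norm :: "nat \<Rightarrow> 'a measure \<Rightarrow> ('a \<Rightarrow> rvec) \<Rightarrow> real" where
  "centered_sq_norm p M U = (\<integral>\<omega>. (enorm p (\<lambda>i. U \<omega> i - mean_vec M U i))\<^sup>2 \<partial>M)"

definition lag_independent :: "nat \<Rightarrow> 'a measure \<Rightarrow> ('a \<Rightarrow> rvec) \<Rightarrow> nat \<Rightarrow> bool" where
  "lag_independent p M U a \<longleftrightarrow>
     (\<forall>j l. 1 \<le> j \<and> j + a + 1 \<le> p \<and> a < l \<longrightarrow>
        prob_space.indep_var M
          (Pi\<^sub>M {1..j} (\<lambda>_. borel)) (\<lambda>\<omega>. restrict (U \<omega>) {1..j})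
          (Pi\<^sub>M {j + l..p} (\<lambda>_. borel)) (\<lambda>\<omega>. restrict (U \<omega>) {j + l..p}))"


section \<open>Sampling model\<close>

text \<open>
  \<open>X\<close> and \<open>Y\<close> are the generic random vectors, \<open>Xs i\<close>, \<open>Ys i\<close> and \<open>Zs i\<close> (\<open>i \<ge> 1\<close>) are the
  sequences of copies. The copies of \<open>X\<close> and of \<open>Y\<close> are jointly independent. The
  law of \<open>Z\<close> is the \<open>\<rho>\<close>-mixture of the laws of \<open>X\<close> and \<open>Y\<close>.
\<close>

definition sampling_model ::
  "nat \<Rightarrow> 'a measure \<Rightarrow> real \<Rightarrow> ('a \<Rightarrow> rvec) \<Rightarrow> ('a \<Rightarrow> rvec) \<Rightarrow>
   (nat \<Rightarrow> 'a \<Rightarrow> rvec) \<Rightarrow> (nat \<Rightarrow> 'a \<Rightarrow> rvec) \<Rightarrow> (nat \<Rightarrow> 'a \<Rightarrow> rvec) \<Rightarrow> bool" where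
  "sampling_model p M \<rho> X Y Xs Ys Zs \<longleftrightarrow>
     prob_space M \<and>
     X \<in> measurable M (rspace p) \<and> Y \<in> measurable M (rspace p) \<and>
     prob_space.indep_vars M (\<lambda>_. rspace p)
       (\<lambda>s. case s of Inl i \<Rightarrow> Xs i | Inr j \<Rightarrow> Ys j) ({1..} <+> {1..}) \<and>
     (\<forall>i\<ge>1. distr M (rspace p) (Xs i) = distr M (rspace p) X) \<and>
     (\<forall>i\<ge>1. distr M (rspace p) (Ys i) = distr M (rspace p) Y) \<and>
     prob_space.indep_vars M (\<lambda>_. rspace p) Zs {1..} \<and>
     (\<forall>i\<ge>1. \<forall>B\<in>sets (rspace p).
        measure (distr M (rspace p) (Zs i)) B =
          \<rho> * measure (distr M (rspace p) X) B + (1 - \<rho>) * measure (distr M (rspace p) Y) B)"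


section \<open>Test statistic\<close>

definition energy_stat ::
  "(rvec \<Rightarrow> rvec \<Rightarrow> real) \<Rightarrow> nat \<Rightarrow> nat \<Rightarrow> (nat \<Rightarrow> rvec) \<Rightarrow> (nat \<Rightarrow> rvec) \<Rightarrow> real" where
  "energy_stat k n m x y =
     2 / (real n * real m) * (\<Sum>i\<in>{1..n}. \<Sum>j\<in>{1..m}. k (x i) (y j))
     - 1 / real (n choose 2) * (\<Sum>j\<in>{1..n}. \<Sum>i\<in>{1..<j}. k (x i) (x j))
     - 1 / real (m choose 2) * (\<Sum>j\<in>{1..m}. \<Sum>i\<in>{1..<j}. k (y i) (y j))"

definition c_coeff :: "nat \<Rightarrow> nat \<Rightarrow> real" where
  "c_coeff n m =
     2 / (real n * (real n - 1)) + 4 / (real n * real m) + 2 / (real m * (real m - 1))"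

definition pooled :: "nat \<Rightarrow> (nat \<Rightarrow> rvec) \<Rightarrow> (nat \<Rightarrow> rvec) \<Rightarrow> nat \<Rightarrow> rvec" where
  "pooled n x y s = (if s \<le> n then x s else y (s - n))"

definition modified_centering :: "nat \<Rightarrow> (nat \<Rightarrow> nat \<Rightarrow> real) \<Rightarrow> nat \<Rightarrow> nat \<Rightarrow> real" where
  "modified_centering N a s t =
     a s t - (\<Sum>i\<in>{1..N}. a i t) / (real N - 2) - (\<Sum>j\<in>{1..N}. a s j) / (real N - 2)
     + (\<Sum>i\<in>{1..N}. \<Sum>j\<in>{1..N}. a i j) / ((real N - 1) * (real N - 2))"

text \<open>The diagonal value \<open>k x x\<close> does not depend on \<open>x\<close> for the kernels considered; it is
  read off at the origin.\<close>

definition diag_value :: "nat \<Rightarrow> (rvec \<Rightarrow> rvec \<Rightarrow> real) \<Rightarrow> real" where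
  "diag_value p k = k (\<lambda>i\<in>{1..p}. 0) (\<lambda>i\<in>{1..p}. 0)"

definition variance_stat ::
  "nat \<Rightarrow> (rvec \<Rightarrow> rvec \<Rightarrow> real) \<Rightarrow> nat \<Rightarrow> nat \<Rightarrow> (nat \<Rightarrow> rvec) \<Rightarrow> (nat \<Rightarrow> rvec) \<Rightarrow> real" where
  "variance_stat p k n m x y =
     (let N = n + m;
          a = (\<lambda>s t. k (pooled n x y s) (pooled n x y t))
      in (\<Sum>s\<in>{1..N}. \<Sum>t\<in>{1..N} - {s}. (modified_centering N a s t)\<^sup>2)
           / (real N * (real N - 3))
         - (diag_value p k)\<^sup>2 / ((real N - 1) * (real N - 3)))"

text \<open>For \<open>n + m > 3\<close> the variance statistic is nonnegative; if it vanishes, the value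
  below is 0 by the convention \<open>x / 0 = 0\<close>.\<close>

definition test_stat ::
  "nat \<Rightarrow> (rvec \<Rightarrow> rvec \<Rightarrow> real) \<Rightarrow> nat \<Rightarrow> nat \<Rightarrow> (nat \<Rightarrow> rvec) \<Rightarrow> (nat \<Rightarrow> rvec) \<Rightarrow> real" where
  "test_stat p k n m x y =
     energy_stat k n m x y / sqrt (c_coeff n m * variance_stat p k n m x y)"

end

theory Submission
  imports Defs
begin

text \<open>
  Write \<open>A\<close> for the mean of \<open>|X - Y|\<^sup>2\<close>, \<open>F = |f (sqrt A)|\<close> and \<open>u = (|x - y|\<^sup>2 - A) / A\<close> for the
  relative deviation of a squared distance. The Taylor formula (K1) and the derivative bound (K2)
  give \<open>k x y = c0 + c1 u + c2 u\<^sup>2\<close> up to an error of order \<open>F min (u\<^sup>2) (|u|\<^sup>3)\<close>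
  (\<open>radial_expansion\<close>), and by (K3) both \<open>c1\<close> and \<open>c2\<close> are of the exact order \<open>F\<close>.
  Coordinates further apart than \<open>\<alpha> p = O(1)\<close> are independent, so the variance of \<open>|x - y|\<^sup>2\<close> is
  \<open>O(p)\<close> (\<open>sq_dist_variance\<close>) and \<open>u\<close> equals its mean up to an error of order \<open>1/p\<close> in mean
  square.

  Signal. In the energy distance \<open>2 E k(X, Y) - E k(X, X') - E k(Y, Y')\<close> the linear terms leave
  \<open>2 c1 |\<Delta>|\<^sup>2 / A\<close>, of order \<open>F p powr (\<delta>1 - 1)\<close>, and the quadratic terms leave
  \<open>- 2 c2 \<tau>\<^sup>2 / A\<^sup>2\<close> with \<open>\<tau> = E|X - E X|\<^sup>2 - E|Y - E Y|\<^sup>2\<close>, of order \<open>F p powr (\<delta>2 - 1)\<close>;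
  everything else is negligible (\<open>energy_distance_expansion\<close>). As \<open>\<delta>1 \<noteq> \<delta>2\<close>, one of the two terms
  dominates, so the energy distance has modulus at least \<open>\<kappa> F p powr (\<delta> - 1)\<close> with
  \<open>\<delta> = max \<delta>1 \<delta>2\<close> (\<open>signal_lower_bound\<close>). Its sign follows from the
  defining property of a kernel, which makes the energy distance positive
  (\<open>energy_distance_pos\<close>).

  Noise. Let \<open>K\<close> bound the mean of \<open>(k - c0)\<^sup>2\<close> over pairs of independent observations; it is
  \<open>O(F\<^sup>2 p powr (\<delta> - 1))\<close> (\<open>noise_upper_bound\<close>). This single crude quantity controls
  both parts of the test statistic. The energy statistic is a combination of averages over pairs,
  and two pairs are independent unless they share an observation, so its variance is at most
  \<open>12 N c K\<close> where \<open>c\<close> is the coefficient \<open>c_coeff\<close> (\<open>energy_stat_variance\<close>). The variance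
  statistic is a normalised squared norm of a centred kernel matrix. Centring is an orthogonal
  projection that annihilates constants, so its expectation is at most \<open>3 K\<close>
  (\<open>variance_bound_expectation\<close>). Markov's inequality now bounds the probability that the test fails to
  exceed \<open>C\<close> by \<open>O((N + 1) c K)\<close> divided by the squared signal (\<open>test_stat_power\<close>). With
  \<open>c = O(1/N\<^sup>2)\<close> this is \<open>O(p powr (1 - \<delta>) / N)\<close>, which vanishes under the growth condition
  (\<open>growth_limit\<close>).

  One point needs care: the statistic is \<open>0\<close> when its denominator vanishes. A vanishing variance
  statistic forces the kernel matrix to be additive off the diagonal, \<open>k(W_s, W_t) = r_s + r_t\<close>,
  and for such a matrix the energy statistic is \<open>0\<close> as well
  (\<open>energy_stat_zero_if_variance_stat_zero\<close>). So where the energy statistic is positive, so is the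
  denominator.
\<close>

section \<open>Centred kernel matrices\<close>

lemma sum_remove_diag:
  fixes b :: "nat \<Rightarrow> nat \<Rightarrow> real"
  assumes "s \<in> {1..N}"
  shows "(\<Sum>t\<in>{1..N} - {s}. b s t) = (\<Sum>t\<in>{1..N}. b s t) - b s s"
  using assms by (subst sum.remove[of "{1..N}" s]) auto

text \<open>
  Centring with the factors \<open>N - 2\<close> is designed for matrices with zero diagonal: it then kills
  constants. A diagonal entry \<open>d\<close> leaks a constant \<open>- d / (N - 1)\<close> into every other entry, and this is
  the leak that the correction term of the variance statistic removes.
\<close>
lemma modified_centering_shift:
  fixes a b :: "nat \<Rightarrow> nat \<Rightarrow> real"
  assumes N: "3 \<le> N" and st: "s \<in> {1..N}" "t \<in> {1..N}" "s \<noteq> t"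
    and off: "\<And>i j. i \<in> {1..N} \<Longrightarrow> j \<in> {1..N} \<Longrightarrow> i \<noteq> j \<Longrightarrow> a i j = b i j + c"
    and diag: "\<And>i. i \<in> {1..N} \<Longrightarrow> a i i = d \<and> b i i = 0"
  shows "modified_centering N a s t = modified_centering N b s t - d / (real N - 1)"
proof -
  have a: "a i j = b i j + c + (if i = j then d - c else 0)" if "i \<in> {1..N}" "j \<in> {1..N}" for i j
    using off[OF that] diag[OF that(1)] by auto
  define K where "K = real N * c + (d - c)"
  have col: "(\<Sum>i\<in>{1..N}. a i t) = (\<Sum>i\<in>{1..N}. b i t) + K"
    using st by (simp add: a sum.distrib K_def)
  have row: "(\<Sum>j\<in>{1..N}. a i j) = (\<Sum>j\<in>{1..N}. b i j) + K" if "i \<in> {1..N}" for i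
    using that by (simp add: a sum.distrib K_def)
  have tot: "(\<Sum>i\<in>{1..N}. \<Sum>j\<in>{1..N}. a i j) = (\<Sum>i\<in>{1..N}. \<Sum>j\<in>{1..N}. b i j) + real N * K"
    by (simp add: row sum.distrib del: One_nat_def)
  have "c - K / (real N - 2) - K / (real N - 2) + real N * K / ((real N - 1) * (real N - 2))
      = - d / (real N - 1)"
    unfolding K_def using N by (simp add: divide_simps) (simp add: algebra_simps)
  then show ?thesis
    unfolding modified_centering_def col row[OF st(1)] tot a[OF st(1,2)] using st(3)
    by (simp add: add_divide_distrib)
qed

lemma modified_centering_row_sum:
  fixes b :: "nat \<Rightarrow> nat \<Rightarrow> real"
  assumes N: "3 \<le> N" and s: "s \<in> {1..N}"
    and sym: "\<And>i j. i \<in> {1..N} \<Longrightarrow> j \<in> {1..N} \<Longrightarrow> b i j = b j i"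
    and diag: "\<And>i. i \<in> {1..N} \<Longrightarrow> b i i = 0"
  shows "(\<Sum>t\<in>{1..N} - {s}. modified_centering N b s t) = 0"
proof -
  define R where "R i = (\<Sum>j\<in>{1..N}. b i j)" for i
  define T where "T = (\<Sum>i\<in>{1..N}. R i)"
  have col: "(\<Sum>i\<in>{1..N}. b i t) = R t" if "t \<in> {1..N}" for t
    unfolding R_def using that by (intro sum.cong) (auto intro: sym)
  have "(\<Sum>t\<in>{1..N} - {s}. modified_centering N b s t)
      = (\<Sum>t\<in>{1..N} - {s}. b s t - R t / (real N - 2) - R s / (real N - 2)
            + T / ((real N - 1) * (real N - 2)))"
  proof (intro sum.cong refl)
    fix t assume "t \<in> {1..N} - {s}"
    then have t: "t \<in> {1..N}" by simp
    show "modified_centering N b s t = b s t - R t / (real N - 2) - R s / (real N - 2)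
            + T / ((real N - 1) * (real N - 2))"
      unfolding modified_centering_def col[OF t] R_def T_def ..
  qed
  also have "\<dots> = R s - (T - R s) / (real N - 2) - (real N - 1) * (R s / (real N - 2))
       + (real N - 1) * (T / ((real N - 1) * (real N - 2)))"
  proof -
    have "(\<Sum>t\<in>{1..N} - {s}. b s t) = R s" "(\<Sum>t\<in>{1..N} - {s}. R t) = T - R s"
      using s sum_remove_diag[OF s, of b] sum_remove_diag[OF s, of "\<lambda>_. R"] diag
      by (auto simp: R_def T_def)
    moreover have "real (card ({1..N} - {s})) = real N - 1"
      using s N by (simp add: of_nat_diff)
    ultimately show ?thesis
      by (simp only: sum.distrib sum_subtractf sum_divide_distrib[symmetric] sum_constant
          times_divide_eq_right)
  qed
  also have "\<dots> = 0"
    using N by (simp add: divide_simps) (simp add: algebra_simps)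
  finally show ?thesis .
qed

lemma modified_centering_sym:
  fixes b :: "nat \<Rightarrow> nat \<Rightarrow> real"
  assumes "\<And>i j. i \<in> {1..N} \<Longrightarrow> j \<in> {1..N} \<Longrightarrow> b i j = b j i" "s \<in> {1..N}" "t \<in> {1..N}"
  shows "modified_centering N b s t = modified_centering N b t s"
proof -
  have "(\<Sum>i\<in>{1..N}. b i u) = (\<Sum>i\<in>{1..N}. b u i)" if "u \<in> {1..N}" for u
    using that by (intro sum.cong) (auto intro: assms(1))
  then show ?thesis
    using assms unfolding modified_centering_def by simp
qed

lemma sum_offdiag_swap:
  fixes h :: "nat \<Rightarrow> nat \<Rightarrow> real"
  shows "(\<Sum>s\<in>{1..N}. \<Sum>t\<in>{1..N} - {s}. h s t) = (\<Sum>s\<in>{1..N}. \<Sum>t\<in>{1..N} - {s}. h t s)"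
proof -
  have *: "(\<Sum>s\<in>{1..N}. \<Sum>t\<in>{1..N} - {s}. g s t)
      = (\<Sum>s\<in>{1..N}. \<Sum>t\<in>{1..N}. if s = t then 0 else g s t)" for g :: "nat \<Rightarrow> nat \<Rightarrow> real"
    by (intro sum.cong refl sum.mono_neutral_cong_left) auto
  show ?thesis
    unfolding * by (subst sum.swap) (intro sum.cong refl, auto)
qed

text \<open>
  On symmetric matrices with zero diagonal, centring subtracts an additive matrix \<open>r s + r t\<close> and
  leaves a matrix with vanishing row sums. It is therefore the orthogonal projection along the
  additive matrices and cannot increase the sum of squares.
\<close>
lemma modified_centering_contracts:
  fixes b :: "nat \<Rightarrow> nat \<Rightarrow> real"
  assumes N: "3 \<le> N"
    and sym: "\<And>i j. i \<in> {1..N} \<Longrightarrow> j \<in> {1..N} \<Longrightarrow> b i j = b j i"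
    and diag: "\<And>i. i \<in> {1..N} \<Longrightarrow> b i i = 0"
  shows "(\<Sum>s\<in>{1..N}. \<Sum>t\<in>{1..N} - {s}. (modified_centering N b s t)\<^sup>2)
         \<le> (\<Sum>s\<in>{1..N}. \<Sum>t\<in>{1..N} - {s}. (b s t)\<^sup>2)"
proof -
  let ?B = "modified_centering N b"
  let ?S = "\<lambda>g. \<Sum>s\<in>{1..N}. \<Sum>t\<in>{1..N} - {s}. (g s t :: real)"
  define r where "r i = (\<Sum>j\<in>{1..N}. b i j) / (real N - 2)
      - (\<Sum>i\<in>{1..N}. \<Sum>j\<in>{1..N}. b i j) / (2 * ((real N - 1) * (real N - 2)))" for i
  have col: "(\<Sum>i\<in>{1..N}. b i t) = (\<Sum>j\<in>{1..N}. b t j)" if "t \<in> {1..N}" for t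
    using that by (intro sum.cong) (auto intro: sym)
  have b: "b s t = ?B s t + (r s + r t)" if "s \<in> {1..N}" "t \<in> {1..N}" for s t
    unfolding modified_centering_def r_def col[OF that(2)] by simp
  \<comment> \<open>the rows of the centred matrix sum to zero, so it is orthogonal to every additive matrix\<close>
  have 1: "?S (\<lambda>s t. ?B s t * r s) = 0"
  proof (rule sum.neutral, rule ballI)
    fix s assume s: "s \<in> {1..N}"
    show "(\<Sum>t\<in>{1..N} - {s}. ?B s t * r s) = 0"
      unfolding sum_distrib_right[symmetric]
      by (simp only: modified_centering_row_sum[OF N s sym diag] mult_zero_left)
  qed
  have 2: "?S (\<lambda>s t. ?B s t * r t) = 0"
  proof -
    have "?S (\<lambda>s t. ?B s t * r t) = ?S (\<lambda>s t. ?B t s * r s)"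
      by (rule sum_offdiag_swap)
    also have "\<dots> = ?S (\<lambda>s t. ?B s t * r s)"
      using modified_centering_sym[OF sym] by (intro sum.cong refl) auto
    finally show ?thesis using 1 by simp
  qed
  have "?S (\<lambda>s t. (b s t)\<^sup>2) = ?S (\<lambda>s t. (?B s t)\<^sup>2 + 2 * (?B s t * r s) + 2 * (?B s t * r t) + (r s + r t)\<^sup>2)"
    by (intro sum.cong refl) (auto simp: b power2_eq_square algebra_simps)
  also have "\<dots> = ?S (\<lambda>s t. (?B s t)\<^sup>2) + 2 * ?S (\<lambda>s t. ?B s t * r s)
      + 2 * ?S (\<lambda>s t. ?B s t * r t) + ?S (\<lambda>s t. (r s + r t)\<^sup>2)"
    by (simp only: sum.distrib sum_distrib_left[symmetric])
  also have "\<dots> \<ge> ?S (\<lambda>s t. (?B s t)\<^sup>2)"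
    unfolding 1 2 by (auto intro!: sum_nonneg)
  finally show ?thesis .
qed

lemma sum_upper_triangle_additive:
  fixes u :: "nat \<Rightarrow> real"
  shows "(\<Sum>j\<in>{1..n}. \<Sum>i\<in>{1..<j}. u i + u j) = (real n - 1) * (\<Sum>i\<in>{1..n}. u i)"
proof (induction n)
  case (Suc n)
  have "{1..<Suc n} = {1..n}" by auto
  then show ?case using Suc by (simp add: sum.distrib algebra_simps)
qed simp

lemma real_choose_two: "real (q choose 2) = real q * (real q - 1) / 2"
proof -
  have "even (q * (q - 1))"
    by (cases q) auto
  then have "2 * (q choose 2) = q * (q - 1)"
    unfolding choose_two by (rule dvd_mult_div_cancel)
  then have "2 * real (q choose 2) = real q * real (q - 1)"
    by (metis of_nat_mult of_nat_numeral)
  then show ?thesis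
    by (cases q) (auto simp: algebra_simps)
qed

text \<open>
  The three averages of \<open>u i + u j\<close>, \<open>v i + v j\<close> and \<open>u i + v j\<close> cancel in the energy statistic.
  Kernel matrices of this form are exactly those with vanishing centred matrix.
\<close>
lemma energy_stat_additive:
  assumes n: "2 \<le> n" and m: "2 \<le> m"
    and xx: "\<And>i j. i \<in> {1..n} \<Longrightarrow> j \<in> {1..n} \<Longrightarrow> i \<noteq> j \<Longrightarrow> k (x i) (x j) = u i + u j"
    and yy: "\<And>i j. i \<in> {1..m} \<Longrightarrow> j \<in> {1..m} \<Longrightarrow> i \<noteq> j \<Longrightarrow> k (y i) (y j) = v i + v j"
    and xy: "\<And>i j. i \<in> {1..n} \<Longrightarrow> j \<in> {1..m} \<Longrightarrow> k (x i) (y j) = u i + v j"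
  shows "energy_stat k n m x y = 0"
proof -
  have cc: "real (q choose 2) = real q * (real q - 1) / 2" for q
    by (rule real_choose_two)
  have a: "(\<Sum>j\<in>{1..n}. \<Sum>i\<in>{1..<j}. k (x i) (x j)) = (real n - 1) * (\<Sum>i\<in>{1..n}. u i)"
    unfolding sum_upper_triangle_additive[symmetric] by (intro sum.cong refl) (auto simp: xx)
  have b: "(\<Sum>j\<in>{1..m}. \<Sum>i\<in>{1..<j}. k (y i) (y j)) = (real m - 1) * (\<Sum>i\<in>{1..m}. v i)"
    unfolding sum_upper_triangle_additive[symmetric] by (intro sum.cong refl) (auto simp: yy)
  have c: "(\<Sum>i\<in>{1..n}. \<Sum>j\<in>{1..m}. k (x i) (y j))
       = real m * (\<Sum>i\<in>{1..n}. u i) + real n * (\<Sum>i\<in>{1..m}. v i)"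
    by (simp add: xy sum.distrib sum_distrib_left)
  show ?thesis
    unfolding energy_stat_def a b c cc using n m by (simp add: divide_simps)
qed

text \<open>
  Choosing \<open>c\<close> as the typical value of the kernel turns the variance statistic into a sum of squares
  of small quantities.
\<close>
lemma variance_stat_centered:
  assumes N: "4 \<le> n + m"
    and sym: "\<And>s t. s \<in> {1..n+m} \<Longrightarrow> t \<in> {1..n+m} \<Longrightarrow>
        k (pooled n x y s) (pooled n x y t) = k (pooled n x y t) (pooled n x y s)"
    and diag: "\<And>s. s \<in> {1..n+m} \<Longrightarrow> k (pooled n x y s) (pooled n x y s) = diag_value p k"
  defines "b c s t \<equiv> if s = t then 0 else k (pooled n x y s) (pooled n x y t) - (c::real)"
  shows "variance_stat p k n m x y =
     (\<Sum>s\<in>{1..n+m}. \<Sum>t\<in>{1..n+m} - {s}. (modified_centering (n+m) (b c) s t)\<^sup>2)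
       / (real (n+m) * (real (n+m) - 3))"
proof -
  let ?N = "n + m" and ?B = "modified_centering (n+m) (b c)"
  define a where "a s t = k (pooled n x y s) (pooled n x y t)" for s t
  define e where "e = diag_value p k / (real ?N - 1)"
  have shift: "modified_centering ?N a s t = ?B s t - e"
    if "s \<in> {1..?N}" "t \<in> {1..?N}" "s \<noteq> t" for s t
    unfolding e_def using that N diag
    by (intro modified_centering_shift[where c = c]) (auto simp: a_def b_def)
  have "(\<Sum>s\<in>{1..?N}. \<Sum>t\<in>{1..?N} - {s}. (modified_centering ?N a s t)\<^sup>2)
      = (\<Sum>s\<in>{1..?N}. \<Sum>t\<in>{1..?N} - {s}. (?B s t)\<^sup>2 - 2 * e * ?B s t + e\<^sup>2)"
  proof (intro sum.cong refl)
    fix s t assume st: "s \<in> {1..?N}" "t \<in> {1..?N} - {s}"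
    then have eq: "modified_centering ?N a s t = ?B s t - e"
      by (intro shift) auto
    show "(modified_centering ?N a s t)\<^sup>2 = (?B s t)\<^sup>2 - 2 * e * ?B s t + e\<^sup>2"
      unfolding eq by (simp add: power2_eq_square algebra_simps)
  qed
  also have "\<dots> = (\<Sum>s\<in>{1..?N}. \<Sum>t\<in>{1..?N} - {s}. (?B s t)\<^sup>2)
      - 2 * e * (\<Sum>s\<in>{1..?N}. \<Sum>t\<in>{1..?N} - {s}. ?B s t)
      + (\<Sum>s\<in>{1..?N}. \<Sum>t\<in>{1..?N} - {s}. e\<^sup>2)"
    by (simp only: sum.distrib sum_subtractf sum_distrib_left[symmetric])
  also have "(\<Sum>s\<in>{1..?N}. \<Sum>t\<in>{1..?N} - {s}. ?B s t) = 0"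
    using N sym by (intro sum.neutral ballI modified_centering_row_sum) (auto simp: b_def)
  also have "(\<Sum>s\<in>{1..?N}. \<Sum>t\<in>{1..?N} - {s}. e\<^sup>2) = real ?N * ((real ?N - 1) * e\<^sup>2)"
    using N by (simp add: of_nat_diff)
  finally have sum: "(\<Sum>s\<in>{1..?N}. \<Sum>t\<in>{1..?N} - {s}. (modified_centering ?N a s t)\<^sup>2)
      = (\<Sum>s\<in>{1..?N}. \<Sum>t\<in>{1..?N} - {s}. (?B s t)\<^sup>2) + real ?N * ((real ?N - 1) * e\<^sup>2)"
    by simp
  have "real ?N * ((real ?N - 1) * e\<^sup>2) / (real ?N * (real ?N - 3))
      = (diag_value p k)\<^sup>2 / ((real ?N - 1) * (real ?N - 3))"
    using N by (simp add: e_def power_divide power2_eq_square divide_simps)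
  moreover have "variance_stat p k n m x y =
      (\<Sum>s\<in>{1..?N}. \<Sum>t\<in>{1..?N} - {s}. (modified_centering ?N a s t)\<^sup>2) / (real ?N * (real ?N - 3))
      - (diag_value p k)\<^sup>2 / ((real ?N - 1) * (real ?N - 3))"
    unfolding variance_stat_def Let_def a_def ..
  ultimately show ?thesis
    unfolding sum add_divide_distrib by simp
qed

lemma variance_stat_bounds:
  assumes N: "4 \<le> n + m"
    and sym: "\<And>s t. s \<in> {1..n+m} \<Longrightarrow> t \<in> {1..n+m} \<Longrightarrow>
        k (pooled n x y s) (pooled n x y t) = k (pooled n x y t) (pooled n x y s)"
    and diag: "\<And>s. s \<in> {1..n+m} \<Longrightarrow> k (pooled n x y s) (pooled n x y s) = diag_value p k"
  shows "0 \<le> variance_stat p k n m x y"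
    and "variance_stat p k n m x y \<le>
     (\<Sum>s\<in>{1..n+m}. \<Sum>t\<in>{1..n+m} - {s}. (k (pooled n x y s) (pooled n x y t) - c)\<^sup>2)
       / (real (n+m) * (real (n+m) - 3))"
proof -
  define b where "b s t = (if s = t then 0 else k (pooled n x y s) (pooled n x y t) - c)" for s t
  have eq: "variance_stat p k n m x y =
     (\<Sum>s\<in>{1..n+m}. \<Sum>t\<in>{1..n+m} - {s}. (modified_centering (n+m) b s t)\<^sup>2)
       / (real (n+m) * (real (n+m) - 3))"
    using variance_stat_centered[OF assms, of c] unfolding b_def[abs_def] .
  show "0 \<le> variance_stat p k n m x y"
    unfolding eq using N by (intro divide_nonneg_nonneg sum_nonneg mult_nonneg_nonneg) auto
  have "(\<Sum>s\<in>{1..n+m}. \<Sum>t\<in>{1..n+m} - {s}. (modified_centering (n+m) b s t)\<^sup>2)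
     \<le> (\<Sum>s\<in>{1..n+m}. \<Sum>t\<in>{1..n+m} - {s}. (b s t)\<^sup>2)"
    using N sym by (intro modified_centering_contracts) (auto simp: b_def)
  also have "\<dots> = (\<Sum>s\<in>{1..n+m}. \<Sum>t\<in>{1..n+m} - {s}. (k (pooled n x y s) (pooled n x y t) - c)\<^sup>2)"
    by (intro sum.cong refl) (auto simp: b_def)
  finally show "variance_stat p k n m x y \<le>
     (\<Sum>s\<in>{1..n+m}. \<Sum>t\<in>{1..n+m} - {s}. (k (pooled n x y s) (pooled n x y t) - c)\<^sup>2)
       / (real (n+m) * (real (n+m) - 3))"
    unfolding eq using N by (intro divide_right_mono mult_nonneg_nonneg) auto
qed

lemma energy_stat_zero_if_variance_stat_zero:
  assumes n: "2 \<le> n" and m: "2 \<le> m"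
    and sym: "\<And>s t. s \<in> {1..n+m} \<Longrightarrow> t \<in> {1..n+m} \<Longrightarrow>
        k (pooled n x y s) (pooled n x y t) = k (pooled n x y t) (pooled n x y s)"
    and diag: "\<And>s. s \<in> {1..n+m} \<Longrightarrow> k (pooled n x y s) (pooled n x y s) = diag_value p k"
    and zero: "variance_stat p k n m x y = 0"
  shows "energy_stat k n m x y = 0"
proof -
  let ?N = "n + m"
  define b where "b s t = (if s = t then 0 else k (pooled n x y s) (pooled n x y t) - 0)" for s t
  have N: "4 \<le> ?N" using n m by simp
  have "(\<Sum>s\<in>{1..?N}. \<Sum>t\<in>{1..?N} - {s}. (modified_centering ?N b s t)\<^sup>2) = 0"
    using variance_stat_centered[OF N sym diag, of 0] zero N unfolding b_def[abs_def, symmetric]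
    by simp
  then have B: "modified_centering ?N b s t = 0" if "s \<in> {1..?N}" "t \<in> {1..?N}" "s \<noteq> t" for s t
    using that by (subst (asm) sum_nonneg_eq_0_iff) (auto intro!: sum_nonneg simp: sum_nonneg_eq_0_iff)
  define u where "u i = (\<Sum>j\<in>{1..?N}. b i j) / (real ?N - 2)
      - (\<Sum>i\<in>{1..?N}. \<Sum>j\<in>{1..?N}. b i j) / (2 * ((real ?N - 1) * (real ?N - 2)))" for i
  have col: "(\<Sum>i\<in>{1..?N}. b i t) = (\<Sum>j\<in>{1..?N}. b t j)" if "t \<in> {1..?N}" for t
    using that by (intro sum.cong) (auto simp: b_def sym)
  have add: "k (pooled n x y s) (pooled n x y t) = u s + u t"
    if "s \<in> {1..?N}" "t \<in> {1..?N}" "s \<noteq> t" for s t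
  proof -
    have "b s t = u s + u t"
      using B[OF that] unfolding modified_centering_def col[OF that(2)] u_def by simp
    then show ?thesis using that(3) by (simp add: b_def)
  qed
  show ?thesis
  proof (rule energy_stat_additive[OF n m, where u = u and v = "\<lambda>j. u (n + j)"])
    show "k (x i) (x j) = u i + u j" if "i \<in> {1..n}" "j \<in> {1..n}" "i \<noteq> j" for i j
      using add[of i j] that by (simp add: pooled_def)
    show "k (y i) (y j) = u (n + i) + u (n + j)" if "i \<in> {1..m}" "j \<in> {1..m}" "i \<noteq> j" for i j
      using add[of "n + i" "n + j"] that by (auto simp: pooled_def)
    show "k (x i) (y j) = u i + u (n + j)" if "i \<in> {1..n}" "j \<in> {1..m}" for i j
      using add[of i "n + j"] that by (auto simp: pooled_def)
  qed
qed

section \<open>Second-order expansion of a radial profile\<close>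

text \<open>
  With \<open>x = (s - s0) / s0\<close> one has \<open>u = x (x + 2)\<close> and \<open>x \<ge> -1\<close>, so \<open>|x| \<le> |u|\<close>, and a polynomial in
  \<open>x\<close> can be rewritten in \<open>u\<close>. The seventh-order Taylor formula is only useful for \<open>|x| \<le> 1\<close>; for larger
  \<open>x\<close> the mean value theorem gives a linear bound, which higher powers of \<open>|x|\<close> dominate.
  The remainder is bounded by both \<open>u\<^sup>2\<close> and \<open>|u|\<^sup>3\<close> in order that second moments of \<open>u\<close> suffice
  below, see \<open>min_square_cube_le\<close>.
\<close>
lemma radial_expansion:
  fixes f :: "nat \<Rightarrow> real \<Rightarrow> real"
  assumes D: "convex D" "s \<in> D" "s0 \<in> D" "0 \<le> s" "0 < s0"
    and deriv: "\<And>z. z \<in> D \<Longrightarrow> (f 0 has_real_derivative f 1 z) (at z within D)"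
    and taylor: "\<exists>\<xi>\<in>D. f 0 s = (\<Sum>i=0..6. 1 / fact i * f i s0 * (s - s0) ^ i) + 1 / fact 7 * f 7 \<xi> * (s - s0) ^ 7"
    and bound: "\<And>i z. i \<in> {1..7} \<Longrightarrow> z \<in> D \<Longrightarrow> \<bar>f i z\<bar> * \<bar>s0 ^ i\<bar> \<le> B"
  defines "u \<equiv> (s\<^sup>2 - s0\<^sup>2) / s0\<^sup>2"
    and "c1 \<equiv> 1/2 * f 1 s0 * s0"
    and "c2 \<equiv> - (1/8) * f 1 s0 * s0 + 1/8 * f 2 s0 * s0\<^sup>2"
  shows "\<bar>f 0 s - f 0 s0\<bar> \<le> B * \<bar>u\<bar>"
    and "\<bar>f 0 s - (f 0 s0 + c1 * u + c2 * u\<^sup>2)\<bar> \<le> 4 * B * min (u\<^sup>2) (\<bar>u\<bar> ^ 3)"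
proof -
  define x where "x = (s - s0) / s0"
  have s: "s = s0 * (1 + x)" using D by (simp add: x_def field_simps)
  have x: "-1 \<le> x" using D by (simp add: x_def field_simps)
  have u: "u = x * (x + 2)"
    unfolding u_def s using D by (simp add: field_simps power2_eq_square)
  have xu: "\<bar>x\<bar> \<le> \<bar>u\<bar>"
    unfolding u abs_mult using x by (simp add: mult_le_cancel_left1)
  define d where "d i = f i s0 * s0 ^ i" for i
  have d: "\<bar>d i\<bar> \<le> B" if "i \<in> {1..7}" for i
    using bound[OF that D(3)] by (simp add: d_def abs_mult)
  have B: "0 \<le> B" using d[of 1] by auto
  have first: "\<bar>f 0 s - f 0 s0\<bar> \<le> B * \<bar>x\<bar>"
  proof -
    have "norm (f 0 s - f 0 s0) \<le> (B / s0) * norm (s - s0)"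
    proof (rule field_differentiable_bound[OF D(1) deriv _ D(2) D(3)])
      show "norm (f 1 z) \<le> B / s0" if "z \<in> D" for z
        using bound[of 1 z] that D by (simp add: field_simps)
    qed
    then show ?thesis using D by (simp add: x_def abs_divide)
  qed
  also have "\<dots> \<le> B * \<bar>u\<bar>" using xu B by (rule mult_left_mono)
  finally show "\<bar>f 0 s - f 0 s0\<bar> \<le> B * \<bar>u\<bar>" .
  obtain \<xi> where \<xi>: "\<xi> \<in> D" "f 0 s = (\<Sum>i=0..6. 1 / fact i * f i s0 * (s - s0) ^ i) + 1 / fact 7 * f 7 \<xi> * (s - s0) ^ 7"
    using taylor by blast
  define e where "e = f 7 \<xi> * s0 ^ 7"
  have e: "\<bar>e\<bar> \<le> B" using bound[of 7 \<xi>] \<xi>(1) by (simp add: e_def abs_mult)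
  have sx: "s - s0 = s0 * x" using s by (simp add: algebra_simps)
  have ex: "f 0 s = f 0 s0 + d 1 * x + d 2 * x^2 / 2 + (d 3 * x^3 / 6 + d 4 * x^4 / 24 + d 5 * x^5 / 120
      + d 6 * x^6 / 720 + e * x^7 / 5040)"
    unfolding \<xi>(2) sx
    by (simp add: numeral_eq_Suc atLeast0AtMost atMost_Suc d_def e_def power_mult_distrib)
       (simp add: algebra_simps)
  have mono: "\<bar>a * x ^ i\<bar> \<le> B * \<bar>x\<bar> ^ j" if "\<bar>a\<bar> \<le> B" "\<bar>x\<bar> \<le> 1" "j \<le> i" for a i j
    unfolding abs_mult power_abs using that B by (intro mult_mono power_decreasing) auto
  have tail: "\<bar>f 0 s - (f 0 s0 + d 1 * x + d 2 * x\<^sup>2 / 2)\<bar> \<le> 3 * B * \<bar>x\<bar> ^ 3"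
  proof (cases "\<bar>x\<bar> \<le> 1")
    case True
    note t = mono[OF _ True, of _ 3]
    have "\<bar>d 3 * x^3\<bar> \<le> B * \<bar>x\<bar> ^ 3" "\<bar>d 4 * x^4\<bar> \<le> B * \<bar>x\<bar> ^ 3" "\<bar>d 5 * x^5\<bar> \<le> B * \<bar>x\<bar> ^ 3"
      "\<bar>d 6 * x^6\<bar> \<le> B * \<bar>x\<bar> ^ 3" "\<bar>e * x^7\<bar> \<le> B * \<bar>x\<bar> ^ 3"
      by (auto intro!: t d e)
    then show ?thesis unfolding ex by linarith
  next
    case False
    then have "1 \<le> \<bar>x\<bar>" by simp
    then have p: "\<bar>x\<bar> \<le> \<bar>x\<bar> ^ 3" "x\<^sup>2 \<le> \<bar>x\<bar> ^ 3"
      using power_increasing[of 1 3 "\<bar>x\<bar>"] power_increasing[of 2 3 "\<bar>x\<bar>"] by auto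
    have q: "B * \<bar>x\<bar> \<le> B * \<bar>x\<bar> ^ 3" "B * x\<^sup>2 \<le> B * \<bar>x\<bar> ^ 3"
      using p B by (auto intro: mult_left_mono)
    have "\<bar>d 1 * x\<bar> \<le> B * \<bar>x\<bar>" "\<bar>d 2 * x\<^sup>2\<bar> \<le> B * x\<^sup>2"
      unfolding abs_mult using d B by (auto intro!: mult_right_mono)
    then show ?thesis using first q by linarith
  qed
  have tail2: "\<bar>f 0 s - (f 0 s0 + d 1 * x)\<bar> \<le> 2 * B * x\<^sup>2"
  proof (cases "\<bar>x\<bar> \<le> 1")
    case True
    have t: "\<bar>a * x ^ i\<bar> \<le> B * x\<^sup>2" if "\<bar>a\<bar> \<le> B" "2 \<le> i" for a i
      using mono[OF that(1) True that(2)] by simp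
    have "\<bar>d 2 * x^2\<bar> \<le> B * x\<^sup>2" "\<bar>d 3 * x^3\<bar> \<le> B * x\<^sup>2" "\<bar>d 4 * x^4\<bar> \<le> B * x\<^sup>2"
      "\<bar>d 5 * x^5\<bar> \<le> B * x\<^sup>2" "\<bar>d 6 * x^6\<bar> \<le> B * x\<^sup>2" "\<bar>e * x^7\<bar> \<le> B * x\<^sup>2"
      by (auto intro!: t d e)
    then show ?thesis unfolding ex by linarith
  next
    case False
    then have "1 \<le> \<bar>x\<bar>" by simp
    then have p: "\<bar>x\<bar> \<le> \<bar>x\<bar> ^ 2"
      using power_increasing[of 1 2 "\<bar>x\<bar>"] by auto
    have q: "B * \<bar>x\<bar> \<le> B * x\<^sup>2"
      using p B by (auto intro: mult_left_mono)
    have "\<bar>d 1 * x\<bar> \<le> B * \<bar>x\<bar>"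
      unfolding abs_mult using d[of 1] B by (auto intro!: mult_right_mono)
    then show ?thesis using first q by linarith
  qed
  have c: "c1 = d 1 / 2" "c2 = - d 1 / 8 + d 2 / 8"
    by (simp_all add: c1_def c2_def d_def power2_eq_square)
  have d12: "\<bar>d 1\<bar> \<le> B" "\<bar>d 2\<bar> \<le> B" by (auto intro!: d)
  then have c2: "\<bar>c2\<bar> \<le> B / 4" unfolding c by linarith
  have cube: "\<bar>f 0 s - (f 0 s0 + c1 * u + c2 * u\<^sup>2)\<bar> \<le> 4 * B * \<bar>u\<bar> ^ 3"
  proof -
    \<comment> \<open>\<open>c1\<close> and \<open>c2\<close> are chosen such that the polynomials in \<open>u\<close> and in \<open>x\<close> agree up to order two\<close>
    have id: "f 0 s0 + c1 * u + c2 * u\<^sup>2 = (f 0 s0 + d 1 * x + d 2 * x\<^sup>2 / 2)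
        + (d 2 - d 1) * (x^3 * (x + 4) / 8)"
      unfolding c u by (simp add: field_simps power2_eq_square power3_eq_cube)
    have "\<bar>x^3 * (x + 4)\<bar> \<le> 3 * \<bar>u\<bar> ^ 3"
    proof -
      have "\<bar>x^3 * (x + 4)\<bar> = \<bar>x\<bar>^3 * (x + 4)" using x by (simp add: abs_mult power_abs)
      also have "\<dots> \<le> \<bar>x\<bar>^3 * (3 * (x + 2)^3)"
      proof (rule mult_left_mono)
        have "(x + 2) ^ 1 \<le> (x + 2) ^ 3" using x by (intro power_increasing) auto
        then show "x + 4 \<le> 3 * (x + 2) ^ 3" using x by simp
      qed simp
      also have "\<dots> = 3 * \<bar>u\<bar> ^ 3" unfolding u using x by (simp add: abs_mult power_mult_distrib)
      finally show ?thesis .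
    qed
    moreover have "\<bar>d 2 - d 1\<bar> \<le> 2 * B" using d[of 1] d[of 2] by auto
    ultimately have "\<bar>(d 2 - d 1) * (x^3 * (x + 4))\<bar> \<le> (2 * B) * (3 * \<bar>u\<bar>^3)"
      unfolding abs_mult[of "d 2 - d 1"] using B by (intro mult_mono) auto
    moreover have "3 * B * \<bar>x\<bar> ^ 3 \<le> 3 * B * \<bar>u\<bar> ^ 3"
      using xu B by (intro mult_left_mono power_mono) auto
    moreover have "0 \<le> B * \<bar>u\<bar> ^ 3" using B by simp
    ultimately show ?thesis using tail unfolding id by (auto simp: field_simps)
  qed
  have square: "\<bar>f 0 s - (f 0 s0 + c1 * u + c2 * u\<^sup>2)\<bar> \<le> 4 * B * u\<^sup>2"
  proof -
    have id: "f 0 s0 + c1 * u + c2 * u\<^sup>2 = (f 0 s0 + d 1 * x) + d 1 * x\<^sup>2 / 2 + c2 * u\<^sup>2"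
      unfolding c(1) u by (simp add: field_simps power2_eq_square)
    have "\<bar>c2 * u\<^sup>2\<bar> \<le> B / 4 * u\<^sup>2" using mult_right_mono[OF c2, of "u\<^sup>2"] by (simp add: abs_mult)
    moreover have "\<bar>d 1 * x\<^sup>2\<bar> \<le> B * x\<^sup>2"
      using mult_right_mono[OF d12(1), of "x\<^sup>2"] by (simp add: abs_mult)
    moreover have "x\<^sup>2 \<le> u\<^sup>2" using xu by (simp add: abs_le_square_iff)
    then have "B * x\<^sup>2 \<le> B * u\<^sup>2" using B by (rule mult_left_mono)
    moreover have "0 \<le> B * u\<^sup>2" using B by simp
    ultimately show ?thesis using tail2 unfolding id by (auto simp: field_simps)
  qed
  show "\<bar>f 0 s - (f 0 s0 + c1 * u + c2 * u\<^sup>2)\<bar> \<le> 4 * B * min (u\<^sup>2) (\<bar>u\<bar> ^ 3)"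
    using cube square by (auto simp: min_def)
qed

text \<open>
  For \<open>u = m + w\<close> with \<open>m\<close> deterministic and \<open>w\<close> centred, this bounds the mean remainder by
  \<open>|m|\<^sup>3\<close> and the variance of \<open>w\<close>: the cube is used where \<open>m\<close> dominates, the square where \<open>w\<close> does.
\<close>
lemma min_square_cube_le:
  fixes u m :: real
  shows "min (u\<^sup>2) (\<bar>u\<bar> ^ 3) \<le> 8 * \<bar>m\<bar> ^ 3 + 4 * (u - m)\<^sup>2"
proof (cases "\<bar>u\<bar> \<le> 2 * \<bar>m\<bar>")
  case True
  then have "\<bar>u\<bar> ^ 3 \<le> (2 * \<bar>m\<bar>) ^ 3" by (intro power_mono) auto
  then show ?thesis by (simp add: power_mult_distrib min.coboundedI2 add_increasing2)
next
  case False
  then have "\<bar>u\<bar> \<le> \<bar>2 * (u - m)\<bar>" by auto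
  then have "u\<^sup>2 \<le> (2 * (u - m))\<^sup>2" by (simp only: abs_le_square_iff)
  then have "u\<^sup>2 \<le> 4 * (u - m)\<^sup>2" unfolding power_mult_distrib by simp
  moreover have "min (u\<^sup>2) (\<bar>u\<bar> ^ 3) \<le> u\<^sup>2" "0 \<le> 8 * \<bar>m\<bar> ^ 3" by simp_all
  ultimately show ?thesis by linarith
qed


section \<open>Variances of locally dependent sums\<close>


text \<open>
  Of the covariances only those of the at most \<open>d\<close> neighbours of each index survive, and each is
  at most \<open>K\<close> by the arithmetic-geometric mean inequality. The lemma serves twice: for
  coordinates (neighbours are nearby coordinates) and for pairs of observations (neighbours share an
  observation).
\<close>
lemma (in prob_space) variance_sum_dependency_graph:
  fixes Z :: "'i \<Rightarrow> 'a \<Rightarrow> real"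
  assumes fin: "finite I"
    and meas: "\<And>i. i \<in> I \<Longrightarrow> random_variable borel (Z i)"
    and sq: "\<And>i. i \<in> I \<Longrightarrow> integrable M (\<lambda>\<omega>. (Z i \<omega>)\<^sup>2)"
    and K: "\<And>i. i \<in> I \<Longrightarrow> expectation (\<lambda>\<omega>. (Z i \<omega>)\<^sup>2) \<le> K"
    and deg: "\<And>i. i \<in> I \<Longrightarrow> card {j\<in>I. dep i j} \<le> d"
    and uncor: "\<And>i j. i \<in> I \<Longrightarrow> j \<in> I \<Longrightarrow> \<not> dep i j \<Longrightarrow>
        expectation (\<lambda>\<omega>. Z i \<omega> * Z j \<omega>) = expectation (Z i) * expectation (Z j)"
  shows "integrable M (\<lambda>\<omega>. ((\<Sum>i\<in>I. Z i \<omega>) - (\<Sum>i\<in>I. expectation (Z i)))\<^sup>2)"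
    and "expectation (\<lambda>\<omega>. ((\<Sum>i\<in>I. Z i \<omega>) - (\<Sum>i\<in>I. expectation (Z i)))\<^sup>2) \<le> real (card I) * real d * K"
proof -
  have int: "integrable M (Z i)" if "i \<in> I" for i
    using square_integrable_imp_integrable[OF meas[OF that] sq[OF that]] .
  have prod: "integrable M (\<lambda>\<omega>. X \<omega> * Y \<omega>)"
    if "random_variable borel X" "random_variable borel Y"
      "integrable M (\<lambda>\<omega>. (X \<omega>)\<^sup>2)" "integrable M (\<lambda>\<omega>. (Y \<omega>)\<^sup>2)" for X Y :: "'a \<Rightarrow> real"
  proof (rule Bochner_Integration.integrable_bound[of _ "\<lambda>\<omega>. (X \<omega>)\<^sup>2 + (Y \<omega>)\<^sup>2"])
    show "AE \<omega> in M. norm (X \<omega> * Y \<omega>) \<le> norm ((X \<omega>)\<^sup>2 + (Y \<omega>)\<^sup>2)"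
    proof (intro AE_I2)
      fix \<omega>
      have "2 * (\<bar>X \<omega>\<bar> * \<bar>Y \<omega>\<bar>) \<le> (X \<omega>)\<^sup>2 + (Y \<omega>)\<^sup>2"
        using sum_squares_bound[of "\<bar>X \<omega>\<bar>" "\<bar>Y \<omega>\<bar>"] by (simp add: mult.assoc)
      moreover have "0 \<le> \<bar>X \<omega>\<bar> * \<bar>Y \<omega>\<bar>" by simp
      ultimately show "norm (X \<omega> * Y \<omega>) \<le> norm ((X \<omega>)\<^sup>2 + (Y \<omega>)\<^sup>2)"
        unfolding real_norm_def abs_mult by linarith
    qed
  qed (use that in auto)
  define Y where "Y i \<omega> = Z i \<omega> - expectation (Z i)" for i \<omega>
  have Ym: "random_variable borel (Y i)" if "i \<in> I" for i
    unfolding Y_def[abs_def] using meas[OF that] by simp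
  have Ysq: "integrable M (\<lambda>\<omega>. (Y i \<omega>)\<^sup>2)" if "i \<in> I" for i
    unfolding Y_def power2_diff using sq[OF that] int[OF that] by auto
  have YK: "expectation (\<lambda>\<omega>. (Y i \<omega>)\<^sup>2) \<le> K" if "i \<in> I" for i
  proof -
    have "expectation (\<lambda>\<omega>. (Y i \<omega>)\<^sup>2) = expectation (\<lambda>\<omega>. (Z i \<omega>)\<^sup>2) - (expectation (Z i))\<^sup>2"
      unfolding Y_def using variance_eq[OF int[OF that] sq[OF that]] .
    also have "\<dots> \<le> K" using K[OF that] zero_le_power2[of "expectation (Z i)"] by linarith
    finally show ?thesis .
  qed
  have YY: "integrable M (\<lambda>\<omega>. Y i \<omega> * Y j \<omega>)" if "i \<in> I" "j \<in> I" for i j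
    using that by (intro prod Ym Ysq)
  have cov: "expectation (\<lambda>\<omega>. Y i \<omega> * Y j \<omega>) \<le> (if dep i j then K else 0)" if "i \<in> I" "j \<in> I" for i j
  proof (cases "dep i j")
    case True
    have "expectation (\<lambda>\<omega>. Y i \<omega> * Y j \<omega>) \<le> expectation (\<lambda>\<omega>. ((Y i \<omega>)\<^sup>2 + (Y j \<omega>)\<^sup>2) / 2)"
    proof (rule integral_mono[OF YY[OF that]])
      show "Y i \<omega> * Y j \<omega> \<le> ((Y i \<omega>)\<^sup>2 + (Y j \<omega>)\<^sup>2) / 2" for \<omega>
        using sum_squares_bound[of "Y i \<omega>" "Y j \<omega>"] by simp
    qed (use Ysq that in auto)
    also have "\<dots> = (expectation (\<lambda>\<omega>. (Y i \<omega>)\<^sup>2) + expectation (\<lambda>\<omega>. (Y j \<omega>)\<^sup>2)) / 2"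
      using Ysq that by simp
    also have "\<dots> \<le> K" using YK[OF that(1)] YK[OF that(2)] by simp
    finally show ?thesis using True by simp
  next
    case False
    have ZZ: "integrable M (\<lambda>\<omega>. Z i \<omega> * Z j \<omega>)"
      using that by (intro prod meas sq)
    have "expectation (\<lambda>\<omega>. Y i \<omega> * Y j \<omega>)
        = expectation (\<lambda>\<omega>. Z i \<omega> * Z j \<omega> - expectation (Z j) * Z i \<omega> - expectation (Z i) * Z j \<omega>
            + expectation (Z i) * expectation (Z j))"
      by (intro Bochner_Integration.integral_cong) (auto simp: Y_def algebra_simps)
    also have "\<dots> = expectation (\<lambda>\<omega>. Z i \<omega> * Z j \<omega>) - expectation (Z i) * expectation (Z j)"
      using ZZ int that by (simp add: prob_space)
    also have "\<dots> = 0" using uncor[OF that False] by simp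
    finally show ?thesis using False by simp
  qed
  have expand: "((\<Sum>i\<in>I. Z i \<omega>) - (\<Sum>i\<in>I. expectation (Z i)))\<^sup>2 = (\<Sum>i\<in>I. \<Sum>j\<in>I. Y i \<omega> * Y j \<omega>)" for \<omega>
    unfolding Y_def sum_subtractf[symmetric] power2_eq_square sum_product ..
  show "integrable M (\<lambda>\<omega>. ((\<Sum>i\<in>I. Z i \<omega>) - (\<Sum>i\<in>I. expectation (Z i)))\<^sup>2)"
    unfolding expand by (intro Bochner_Integration.integrable_sum YY)
  have "expectation (\<lambda>\<omega>. ((\<Sum>i\<in>I. Z i \<omega>) - (\<Sum>i\<in>I. expectation (Z i)))\<^sup>2)
      = (\<Sum>i\<in>I. \<Sum>j\<in>I. expectation (\<lambda>\<omega>. Y i \<omega> * Y j \<omega>))"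
    unfolding expand by (subst Bochner_Integration.integral_sum, (auto intro!: YY)[1])
      (intro sum.cong refl Bochner_Integration.integral_sum YY, auto)
  also have "\<dots> \<le> (\<Sum>i\<in>I. \<Sum>j\<in>I. if dep i j then K else 0)"
    by (intro sum_mono cov)
  also have "\<dots> = (\<Sum>i\<in>I. real (card {j\<in>I. dep i j}) * K)"
    using fin by (intro sum.cong refl) (simp add: sum.If_cases Int_def)
  also have "\<dots> \<le> (\<Sum>i\<in>I. real d * K)"
  proof (intro sum_mono mult_right_mono)
    fix i assume i: "i \<in> I"
    show "real (card {j\<in>I. dep i j}) \<le> real d" using deg[OF i] by simp
    have "0 \<le> expectation (\<lambda>\<omega>. (Z i \<omega>)\<^sup>2)" by simp
    also have "\<dots> \<le> K" using K[OF i] .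
    finally show "0 \<le> K" .
  qed
  finally show "expectation (\<lambda>\<omega>. ((\<Sum>i\<in>I. Z i \<omega>) - (\<Sum>i\<in>I. expectation (Z i)))\<^sup>2)
      \<le> real (card I) * real d * K" by simp
qed

section \<open>Squared distances between vectors with banded dependence\<close>

text \<open>
  Dependence assumptions speak of random vectors, whereas the moment computations are carried out
  under their laws.
\<close>
lemma (in prob_space) indep_var_distr:
  assumes U: "U \<in> measurable M N" and f: "f \<in> measurable N S" and g: "g \<in> measurable N T"
    and ind: "indep_var S (\<lambda>\<omega>. f (U \<omega>)) T (\<lambda>\<omega>. g (U \<omega>))"
  shows "prob_space.indep_var (distr M N U) S f T g"
proof -
  interpret D: prob_space "distr M N U" by (rule prob_space_distr[OF U])
  have "distr M S (\<lambda>\<omega>. f (U \<omega>)) \<Otimes>\<^sub>M distr M T (\<lambda>\<omega>. g (U \<omega>))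
      = distr M (S \<Otimes>\<^sub>M T) (\<lambda>\<omega>. (f (U \<omega>), g (U \<omega>)))"
    using ind unfolding indep_var_distribution_eq by simp
  then show ?thesis
    unfolding D.indep_var_distribution_eq using U f g
    by (simp add: distr_distr comp_def)
qed

definition coord_mean :: "rvec measure \<Rightarrow> nat \<Rightarrow> real" where
  "coord_mean P j = (\<integral>x. x j \<partial>P)"

definition total_variance :: "nat \<Rightarrow> rvec measure \<Rightarrow> real" where
  "total_variance p P = (\<Sum>j\<in>{1..p}. \<integral>x. (x j - coord_mean P j)\<^sup>2 \<partial>P)"

lemma edist_sq: "(edist p x y)\<^sup>2 = (\<Sum>j\<in>{1..p}. (x j - y j)\<^sup>2)"
  unfolding edist_def enorm_def L2_set_def by (simp add: sum_nonneg)

lemma power4_sum_le: "(x - y) ^ 4 \<le> 8 * (x ^ 4 + y ^ 4)" for x y :: real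
proof -
  have 1: "(x - y)\<^sup>2 \<le> 2 * (x\<^sup>2 + y\<^sup>2)"
    using zero_le_power2[of "x + y"] by (simp add: power2_eq_square algebra_simps)
  have 2: "(x\<^sup>2 + y\<^sup>2)\<^sup>2 \<le> 2 * (x ^ 4 + y ^ 4)"
    using zero_le_power2[of "x\<^sup>2 - y\<^sup>2"] by (simp add: eval_nat_numeral algebra_simps)
  have "(x - y) ^ 4 = ((x - y)\<^sup>2)\<^sup>2" by (simp flip: power_mult)
  also have "\<dots> \<le> (2 * (x\<^sup>2 + y\<^sup>2))\<^sup>2" using 1 by (rule power_mono) simp
  also have "\<dots> = 4 * (x\<^sup>2 + y\<^sup>2)\<^sup>2" unfolding power_mult_distrib by simp
  also have "\<dots> \<le> 8 * (x ^ 4 + y ^ 4)" using 2 by simp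
  finally show ?thesis .
qed

text \<open>
  The law of a random vector in dimension \<open>p\<close> whose coordinates are independent at distance more than
  \<open>a\<close> and whose fourth moments are bounded by \<open>b\<close>. The dependence is stated for pairs of
  coordinates because variances of sums over coordinates are sums over such pairs.
\<close>
locale banded_law = prob_space P for P :: "rvec measure" +
  fixes p a :: nat and b :: real
  assumes sets_law: "sets P = sets (rspace p)"
    and fourth: "\<And>j. j \<in> {1..p} \<Longrightarrow> integrable P (\<lambda>x. x j ^ 4)"
    and fourth_le: "\<And>j. j \<in> {1..p} \<Longrightarrow> (\<integral>x. x j ^ 4 \<partial>P) \<le> b"
    and banded: "\<And>i j. i \<in> {1..p} \<Longrightarrow> j \<in> {1..p} \<Longrightarrow> i + a < j \<Longrightarrow>
        indep_var borel (\<lambda>x. x i) borel (\<lambda>x. x j)"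
begin

lemma space_law: "space P = space (rspace p)"
  using sets_eq_imp_space_eq[OF sets_law] .

lemma coord_measurable: "j \<in> {1..p} \<Longrightarrow> (\<lambda>x. x j) \<in> borel_measurable P"
  unfolding measurable_cong_sets[OF sets_law refl] rspace_def
  by (rule measurable_component_singleton)

lemma coord_integrable:
  assumes "j \<in> {1..p}" "r \<le> 4"
  shows "integrable P (\<lambda>x. x j ^ r)"
proof (rule Bochner_Integration.integrable_bound[of _ "\<lambda>x. 1 + x j ^ 4"])
  show "AE x in P. norm (x j ^ r) \<le> norm (1 + x j ^ 4)"
  proof (intro AE_I2)
    fix x :: rvec
    have "\<bar>x j\<bar> ^ r \<le> 1 + \<bar>x j\<bar> ^ 4"
    proof (cases "\<bar>x j\<bar> \<le> 1")
      case True
      then show ?thesis using power_le_one[of "\<bar>x j\<bar>" r] zero_le_power[of "\<bar>x j\<bar>" 4] by linarith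
    next
      case False
      then show ?thesis using power_increasing[OF assms(2), of "\<bar>x j\<bar>"] by linarith
    qed
    then show "norm (x j ^ r) \<le> norm (1 + x j ^ 4)" by (simp add: power_abs)
  qed
qed (use assms fourth[OF assms(1)] coord_measurable[OF assms(1)] in auto)

lemma coord_integrable1: "j \<in> {1..p} \<Longrightarrow> integrable P (\<lambda>x. x j)"
  using coord_integrable[of j 1] by simp

lemma coord_variance:
  assumes "j \<in> {1..p}"
  shows "(\<integral>x. (x j - coord_mean P j)\<^sup>2 \<partial>P) = (\<integral>x. (x j)\<^sup>2 \<partial>P) - (coord_mean P j)\<^sup>2"
  unfolding coord_mean_def
  using variance_eq[OF coord_integrable1[OF assms] coord_integrable[OF assms, of 2]] by simp

lemma banded_product:
  assumes ij: "i \<in> {1..p}" "j \<in> {1..p}" "i + a < j \<or> j + a < i"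
    and "f \<in> borel_measurable borel" "g \<in> borel_measurable borel"
    and "integrable P (\<lambda>x. f (x i))" "integrable P (\<lambda>x. g (x j))"
  shows "(\<integral>x. f (x i) * g (x j) \<partial>P) = (\<integral>x. f (x i) \<partial>P) * (\<integral>x. (g (x j) :: real) \<partial>P)"
  using ij(3)
proof
  assume "i + a < j"
  from indep_var_compose[OF banded[OF ij(1,2) this] assms(4,5)] show ?thesis
    unfolding comp_def by (rule indep_var_lebesgue_integral[OF _ assms(6,7)])
next
  assume "j + a < i"
  from indep_var_compose[OF banded[OF ij(2,1) this] assms(5,4)]
  have "(\<integral>x. g (x j) * f (x i) \<partial>P) = (\<integral>x. g (x j) \<partial>P) * (\<integral>x. f (x i) \<partial>P)"
    unfolding comp_def by (rule indep_var_lebesgue_integral[OF _ assms(7,6)])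
  then show ?thesis by (simp add: mult.commute)
qed

end

locale banded_law_pair = L: banded_law P p a b + R: banded_law Q p a b
  for P Q :: "rvec measure" and p a b
begin

sublocale pair_prob_space P Q ..

lemma integrable_of_fst:
  assumes "integrable P (f :: rvec \<Rightarrow> real)"
  shows "integrable (P \<Otimes>\<^sub>M Q) (\<lambda>z. f (fst z))"
proof -
  have "distr (P \<Otimes>\<^sub>M Q) P fst = P"
    by (rule R.distr_pair_fst)
  then show ?thesis
    using assms integrable_distr[OF measurable_fst, of P Q f] by simp
qed

lemma integrable_of_snd:
  assumes "integrable Q (f :: rvec \<Rightarrow> real)"
  shows "integrable (P \<Otimes>\<^sub>M Q) (\<lambda>z. f (snd z))"
proof -
  interpret QP: pair_prob_space Q P ..
  have "integrable (Q \<Otimes>\<^sub>M P) (\<lambda>z. f (fst z))"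
    using L.distr_pair_fst[of Q] assms integrable_distr[OF measurable_fst, of Q P f] by simp
  then show ?thesis
    using QP.integrable_product_swap[of "\<lambda>z. f (fst z)"] by (simp add: case_prod_beta')
qed

lemma coord_measurable_pair [measurable]:
  assumes "j \<in> {1..p}"
  shows "(\<lambda>z. fst z j) \<in> borel_measurable (P \<Otimes>\<^sub>M Q)" "(\<lambda>z. snd z j) \<in> borel_measurable (P \<Otimes>\<^sub>M Q)"
  using measurable_compose[OF measurable_fst L.coord_measurable[OF assms]]
    measurable_compose[OF measurable_snd R.coord_measurable[OF assms]] by auto

text \<open>
  \<open>\<xi> j\<close> is the contribution of coordinate \<open>j\<close> to the squared distance, and \<open>\<phi> j c\<close> is its mean over the
  second vector when the first has \<open>j\<close>-th coordinate \<open>c\<close>.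
\<close>
definition \<xi> :: "nat \<Rightarrow> rvec \<times> rvec \<Rightarrow> real" where
  "\<xi> j z = (fst z j - snd z j)\<^sup>2"

definition \<phi> :: "nat \<Rightarrow> real \<Rightarrow> real" where
  "\<phi> j c = c\<^sup>2 - 2 * coord_mean Q j * c + (\<integral>y. (y j)\<^sup>2 \<partial>Q)"

lemma \<xi>_measurable: "j \<in> {1..p} \<Longrightarrow> \<xi> j \<in> borel_measurable (P \<Otimes>\<^sub>M Q)"
  unfolding \<xi>_def[abs_def] by measurable

lemma \<xi>_sq:
  assumes j: "j \<in> {1..p}"
  shows "integrable (P \<Otimes>\<^sub>M Q) (\<lambda>z. (\<xi> j z)\<^sup>2)" and "expectation (\<lambda>z. (\<xi> j z)\<^sup>2) \<le> 16 * b"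
proof -
  have d: "integrable (P \<Otimes>\<^sub>M Q) (\<lambda>z. 8 * (fst z j ^ 4 + snd z j ^ 4))"
    using integrable_of_fst[OF L.fourth[OF j]] integrable_of_snd[OF R.fourth[OF j]] by simp
  have le: "(\<xi> j z)\<^sup>2 \<le> 8 * (fst z j ^ 4 + snd z j ^ 4)" for z
    using power4_sum_le[of "fst z j" "snd z j"] unfolding \<xi>_def by (simp flip: power_mult)
  show i: "integrable (P \<Otimes>\<^sub>M Q) (\<lambda>z. (\<xi> j z)\<^sup>2)"
    by (rule Bochner_Integration.integrable_bound[OF d])
      (use \<xi>_measurable[OF j] order_trans[OF le abs_ge_self] in auto)
  have "expectation (\<lambda>z. (\<xi> j z)\<^sup>2) \<le> expectation (\<lambda>z. 8 * (fst z j ^ 4 + snd z j ^ 4))"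
    using i d le by (rule integral_mono)
  also have "\<dots> = 8 * ((\<integral>x. x j ^ 4 \<partial>P) + (\<integral>y. y j ^ 4 \<partial>Q))"
  proof -
    have "expectation (\<lambda>z. fst z j ^ 4) = (\<integral>x. x j ^ 4 \<partial>P)"
      using integral_fst'[OF integrable_of_fst[OF L.fourth[OF j]]] by (simp add: R.prob_space)
    moreover have "expectation (\<lambda>z. snd z j ^ 4) = (\<integral>y. y j ^ 4 \<partial>Q)"
      using integral_fst'[OF integrable_of_snd[OF R.fourth[OF j]]] by (simp add: L.prob_space)
    ultimately show ?thesis
      using integrable_of_fst[OF L.fourth[OF j]] integrable_of_snd[OF R.fourth[OF j]] by simp
  qed
  also have "\<dots> \<le> 16 * b" using L.fourth_le[OF j] R.fourth_le[OF j] by simp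
  finally show "expectation (\<lambda>z. (\<xi> j z)\<^sup>2) \<le> 16 * b" .
qed

lemma \<xi>_integrable: "j \<in> {1..p} \<Longrightarrow> integrable (P \<Otimes>\<^sub>M Q) (\<xi> j)"
  using square_integrable_imp_integrable[OF \<xi>_measurable \<xi>_sq(1)] .

lemma inner_integrable:
  assumes "j \<in> {1..p}"
  shows "integrable Q (\<lambda>y. (c - y j)\<^sup>2)" "(\<integral>y. (c - y j)\<^sup>2 \<partial>Q) = \<phi> j c"
  unfolding power2_diff \<phi>_def
  using R.coord_integrable[OF assms, of 2] R.coord_integrable1[OF assms]
  by (auto simp: coord_mean_def R.prob_space)

lemma \<phi>_integrable:
  assumes "j \<in> {1..p}"
  shows "integrable P (\<lambda>x. \<phi> j (x j))"
    "(\<integral>x. \<phi> j (x j) \<partial>P) = (\<integral>x. (x j)\<^sup>2 \<partial>P) - 2 * coord_mean Q j * coord_mean P j + (\<integral>y. (y j)\<^sup>2 \<partial>Q)"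
  unfolding \<phi>_def using L.coord_integrable[OF assms, of 2] L.coord_integrable1[OF assms]
  by (auto simp: coord_mean_def L.prob_space)

lemma \<xi>_mean:
  assumes "j \<in> {1..p}"
  shows "expectation (\<xi> j) = (\<integral>x. \<phi> j (x j) \<partial>P)"
  using integral_fst'[OF \<xi>_integrable[OF assms]] inner_integrable(2)[OF assms] by (simp add: \<xi>_def)

text \<open>
  Integrating out the second vector first turns the product into \<open>\<phi> i (x i) * \<phi> j (x j)\<close>, by
  independence of distant coordinates of the second vector; their independence for the first vector
  then splits the remaining integral.
\<close>
lemma \<xi>_uncorrelated:
  assumes i: "i \<in> {1..p}" and j: "j \<in> {1..p}" and far: "i + a < j \<or> j + a < i"
  shows "expectation (\<lambda>z. \<xi> i z * \<xi> j z) = expectation (\<xi> i) * expectation (\<xi> j)"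
proof -
  have int: "integrable (P \<Otimes>\<^sub>M Q) (\<lambda>z. \<xi> i z * \<xi> j z)"
  proof (rule Bochner_Integration.integrable_bound[of _ "\<lambda>z. (\<xi> i z)\<^sup>2 + (\<xi> j z)\<^sup>2"])
    show "AE z in P \<Otimes>\<^sub>M Q. norm (\<xi> i z * \<xi> j z) \<le> norm ((\<xi> i z)\<^sup>2 + (\<xi> j z)\<^sup>2)"
    proof (intro AE_I2)
      fix z
      have "0 \<le> \<xi> i z * \<xi> j z" by (simp add: \<xi>_def)
      moreover have "2 * (\<xi> i z * \<xi> j z) \<le> (\<xi> i z)\<^sup>2 + (\<xi> j z)\<^sup>2"
        using sum_squares_bound[of "\<xi> i z" "\<xi> j z"] by (simp add: mult.assoc)
      ultimately show "norm (\<xi> i z * \<xi> j z) \<le> norm ((\<xi> i z)\<^sup>2 + (\<xi> j z)\<^sup>2)"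
        unfolding real_norm_def by linarith
    qed
  qed (use \<xi>_sq(1)[OF i] \<xi>_sq(1)[OF j] \<xi>_measurable[OF i] \<xi>_measurable[OF j] in auto)
  have inner: "(\<integral>y. \<xi> i (x, y) * \<xi> j (x, y) \<partial>Q) = \<phi> i (x i) * \<phi> j (x j)" for x
    using R.banded_product[OF i j far, of "\<lambda>t. (x i - t)\<^sup>2" "\<lambda>t. (x j - t)\<^sup>2"]
      inner_integrable[OF i] inner_integrable[OF j] by (simp add: \<xi>_def)
  have "expectation (\<lambda>z. \<xi> i z * \<xi> j z) = (\<integral>x. \<phi> i (x i) * \<phi> j (x j) \<partial>P)"
    using integral_fst'[OF int] unfolding inner by simp
  also have "\<dots> = (\<integral>x. \<phi> i (x i) \<partial>P) * (\<integral>x. \<phi> j (x j) \<partial>P)"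
  proof (rule L.banded_product[OF i j far])
    show "\<phi> i \<in> borel_measurable borel" "\<phi> j \<in> borel_measurable borel"
      unfolding \<phi>_def[abs_def] by measurable
  qed (use \<phi>_integrable(1) i j in auto)
  finally show ?thesis using \<xi>_mean i j by simp
qed

lemma sq_dist_eq: "(edist p (fst z) (snd z))\<^sup>2 = (\<Sum>j\<in>{1..p}. \<xi> j z)"
  unfolding edist_sq \<xi>_def ..

lemma sq_dist_mean:
  "expectation (\<lambda>z. (edist p (fst z) (snd z))\<^sup>2)
     = total_variance p P + total_variance p Q + (\<Sum>j\<in>{1..p}. (coord_mean P j - coord_mean Q j)\<^sup>2)"
proof -
  have "expectation (\<lambda>z. (edist p (fst z) (snd z))\<^sup>2) = (\<Sum>j\<in>{1..p}. expectation (\<xi> j))"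
    unfolding sq_dist_eq by (intro Bochner_Integration.integral_sum \<xi>_integrable)
  also have "\<dots> = (\<Sum>j\<in>{1..p}. (\<integral>x. (x j - coord_mean P j)\<^sup>2 \<partial>P) + (\<integral>x. (x j - coord_mean Q j)\<^sup>2 \<partial>Q)
      + (coord_mean P j - coord_mean Q j)\<^sup>2)"
  proof (intro sum.cong refl)
    fix j assume j: "j \<in> {1..p}"
    show "expectation (\<xi> j) = (\<integral>x. (x j - coord_mean P j)\<^sup>2 \<partial>P)
        + (\<integral>x. (x j - coord_mean Q j)\<^sup>2 \<partial>Q) + (coord_mean P j - coord_mean Q j)\<^sup>2"
      unfolding \<xi>_mean[OF j] \<phi>_integrable(2)[OF j] L.coord_variance[OF j] R.coord_variance[OF j]
      by (simp add: power2_diff)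
  qed
  finally show ?thesis
    by (simp add: total_variance_def sum.distrib)
qed

lemma sq_dist_variance:
  defines "e \<equiv> expectation (\<lambda>z. (edist p (fst z) (snd z))\<^sup>2)"
  shows "integrable (P \<Otimes>\<^sub>M Q) (\<lambda>z. (edist p (fst z) (snd z))\<^sup>2)"
    and "integrable (P \<Otimes>\<^sub>M Q) (\<lambda>z. ((edist p (fst z) (snd z))\<^sup>2 - e)\<^sup>2)"
    and "expectation (\<lambda>z. ((edist p (fst z) (snd z))\<^sup>2 - e)\<^sup>2) \<le> real p * real (2 * a + 1) * (16 * b)"
proof -
  show "integrable (P \<Otimes>\<^sub>M Q) (\<lambda>z. (edist p (fst z) (snd z))\<^sup>2)"
    unfolding sq_dist_eq by (intro Bochner_Integration.integrable_sum \<xi>_integrable)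
  have e: "e = (\<Sum>j\<in>{1..p}. expectation (\<xi> j))"
    unfolding e_def sq_dist_eq by (intro Bochner_Integration.integral_sum \<xi>_integrable)
  have deg: "card {j\<in>{1..p}. \<not> (i + a < j \<or> j + a < i)} \<le> 2 * a + 1" for i
  proof -
    have "card {j\<in>{1..p}. \<not> (i + a < j \<or> j + a < i)} \<le> card {i - a..i + a}"
      by (intro card_mono) auto
    then show ?thesis by simp
  qed
  note v = variance_sum_dependency_graph[of "{1..p}" \<xi> "16 * b"
      "\<lambda>i j. \<not> (i + a < j \<or> j + a < i)" "2 * a + 1"]
  show "integrable (P \<Otimes>\<^sub>M Q) (\<lambda>z. ((edist p (fst z) (snd z))\<^sup>2 - e)\<^sup>2)"
    unfolding e sq_dist_eq using \<xi>_measurable \<xi>_sq deg \<xi>_uncorrelated by (intro v) auto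
  have "expectation (\<lambda>z. ((edist p (fst z) (snd z))\<^sup>2 - e)\<^sup>2)
      \<le> real (card {1..p}) * real (2 * a + 1) * (16 * b)"
    unfolding e sq_dist_eq using \<xi>_measurable \<xi>_sq deg \<xi>_uncorrelated by (intro v) auto
  then show "expectation (\<lambda>z. ((edist p (fst z) (snd z))\<^sup>2 - e)\<^sup>2) \<le> real p * real (2 * a + 1) * (16 * b)"
    by simp
qed

end

section \<open>Kernel moments and the energy distance\<close>

lemma edist_commute: "edist p x y = edist p y x"
  unfolding edist_def enorm_def L2_set_def by (simp add: power2_commute)

lemma edist_measurable:
  "(\<lambda>(x, y). edist p x y) \<in> borel_measurable (rspace p \<Otimes>\<^sub>M rspace p)"
proof -
  have [measurable]: "(\<lambda>z. fst z j) \<in> borel_measurable (rspace p \<Otimes>\<^sub>M rspace p)"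
    "(\<lambda>z. snd z j) \<in> borel_measurable (rspace p \<Otimes>\<^sub>M rspace p)" if "j \<in> {1..p}" for j
    using that unfolding rspace_def
    by (auto intro: measurable_compose[OF measurable_fst measurable_component_singleton]
        measurable_compose[OF measurable_snd measurable_component_singleton])
  show ?thesis
    unfolding edist_def enorm_def L2_set_def case_prod_beta' by measurable
qed

text \<open>
  The profile is differentiable on its domain, hence continuous on \<open>[0, \<infinity>)\<close>; this yields
  measurability of the kernel.
\<close>
lemma radial_kernel_properties:
  assumes rep: "radial_representation p k D f"
  shows "case_prod k \<in> borel_measurable (rspace p \<Otimes>\<^sub>M rspace p)"
    and "\<And>x y. x \<in> space (rspace p) \<Longrightarrow> y \<in> space (rspace p) \<Longrightarrow> k x y = k y x"
    and "\<And>x. x \<in> space (rspace p) \<Longrightarrow> k x x = diag_value p k"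
proof -
  have k: "k x y = f 0 (edist p x y)" if "x \<in> space (rspace p)" "y \<in> space (rspace p)" for x y
    using rep that unfolding radial_representation_def by blast
  show "k x y = k y x" if "x \<in> space (rspace p)" "y \<in> space (rspace p)" for x y
    using k[OF that] k[OF that(2,1)] by (simp add: edist_commute)
  have "(\<lambda>i\<in>{1..p}. 0) \<in> space (rspace p)" by (simp add: rspace_def space_PiM)
  then show "k x x = diag_value p k" if "x \<in> space (rspace p)" for x
    using k[OF that that] k unfolding diag_value_def by (simp add: edist_def enorm_def L2_set_def)
  have "continuous_on D (f 0)"
    unfolding continuous_on_eq_continuous_within
    using rep DERIV_continuous[of "f 0" "f (Suc 0) s" s D for s] unfolding radial_representation_def by auto
  then have "continuous_on {0..} (f 0)"
    using rep continuous_on_subset unfolding radial_representation_def by blast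
  then have "continuous_on UNIV (\<lambda>s. f 0 (max 0 s))"
    by (rule continuous_on_compose2) (auto intro!: continuous_intros)
  then have "(\<lambda>s. f 0 (max 0 s)) \<in> borel_measurable borel"
    by (rule borel_measurable_continuous_onI)
  from measurable_compose[OF edist_measurable this]
  have "(\<lambda>z. f 0 (max 0 (case z of (x, y) \<Rightarrow> edist p x y))) \<in> borel_measurable (rspace p \<Otimes>\<^sub>M rspace p)" .
  then show "case_prod k \<in> borel_measurable (rspace p \<Otimes>\<^sub>M rspace p)"
    by (subst measurable_cong)
      (auto simp: space_pair_measure k max_def edist_def enorm_def not_le dest: order.strict_trans2[of _ 0 "L2_set _ _"])
qed

lemma radial_kernel_expansion:
  fixes f :: "nat \<Rightarrow> real \<Rightarrow> real"
  assumes rep: "radial_representation p k D f"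
    and s0: "s0 \<in> D" "0 < s0"
    and taylor: "\<And>s. s \<in> D \<Longrightarrow> \<exists>\<xi>\<in>closed_segment s s0.
          f 0 s = (\<Sum>i=0..6. 1 / fact i * f i s0 * (s - s0) ^ i) + 1 / fact 7 * f 7 \<xi> * (s - s0) ^ 7"
    and bound: "\<And>i z. i \<in> {1..7} \<Longrightarrow> z \<in> D \<Longrightarrow> \<bar>f i z\<bar> * \<bar>s0 ^ i\<bar> \<le> B"
    and xy: "x \<in> space (rspace p)" "y \<in> space (rspace p)"
  defines "u \<equiv> ((edist p x y)\<^sup>2 - s0\<^sup>2) / s0\<^sup>2"
    and "c1 \<equiv> 1/2 * f 1 s0 * s0"
    and "c2 \<equiv> - (1/8) * f 1 s0 * s0 + 1/8 * f 2 s0 * s0\<^sup>2"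
  shows "\<bar>k x y - f 0 s0\<bar> \<le> B * \<bar>u\<bar>"
    and "\<bar>k x y - (f 0 s0 + c1 * u + c2 * u\<^sup>2)\<bar> \<le> 4 * B * min (u\<^sup>2) (\<bar>u\<bar> ^ 3)"
proof -
  have D: "convex D" "{0..} \<subseteq> D"
    using rep is_interval_convex unfolding radial_representation_def by auto
  have k: "k x y = f 0 (edist p x y)"
    using rep xy unfolding radial_representation_def by blast
  have e0: "0 \<le> edist p x y" by (simp add: edist_def enorm_def)
  then have e: "edist p x y \<in> D" using D by auto
  have deriv: "(f 0 has_real_derivative f 1 z) (at z within D)" if "z \<in> D" for z
    using rep that unfolding radial_representation_def by force
  have tay: "\<exists>\<xi>\<in>D. f 0 (edist p x y) = (\<Sum>i=0..6. 1 / fact i * f i s0 * (edist p x y - s0) ^ i)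
      + 1 / fact 7 * f 7 \<xi> * (edist p x y - s0) ^ 7"
    using taylor[OF e] closed_segment_subset[OF e s0(1) D(1)] by blast
  note ex = radial_expansion[OF D(1) e s0(1) e0 s0(2) deriv tay bound]
  show "\<bar>k x y - f 0 s0\<bar> \<le> B * \<bar>u\<bar>" unfolding k u_def by (rule ex(1))
  show "\<bar>k x y - (f 0 s0 + c1 * u + c2 * u\<^sup>2)\<bar> \<le> 4 * B * min (u\<^sup>2) (\<bar>u\<bar> ^ 3)"
    unfolding k u_def c1_def c2_def by (rule ex(2))
qed

text \<open>
  Here \<open>m\<close> is the mean of \<open>u\<close> and \<open>v\<close> its variance, so that \<open>E u = m\<close> and \<open>E u\<^sup>2 = m\<^sup>2 + v\<close> are
  inserted into the expansion of the kernel.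
\<close>
lemma (in banded_law_pair) kernel_moments:
  fixes k :: "rvec \<Rightarrow> rvec \<Rightarrow> real" and A B c0 c1 c2 :: real
  assumes A: "0 < A" and B: "0 \<le> B"
    and meas: "case_prod k \<in> borel_measurable (rspace p \<Otimes>\<^sub>M rspace p)"
    and first: "\<And>x y. x \<in> space (rspace p) \<Longrightarrow> y \<in> space (rspace p) \<Longrightarrow>
        \<bar>k x y - c0\<bar> \<le> B * \<bar>((edist p x y)\<^sup>2 - A) / A\<bar>"
    and second: "\<And>x y. x \<in> space (rspace p) \<Longrightarrow> y \<in> space (rspace p) \<Longrightarrow>
        \<bar>k x y - (c0 + c1 * (((edist p x y)\<^sup>2 - A) / A) + c2 * (((edist p x y)\<^sup>2 - A) / A)\<^sup>2)\<bar>
          \<le> 4 * B * min ((((edist p x y)\<^sup>2 - A) / A)\<^sup>2) (\<bar>((edist p x y)\<^sup>2 - A) / A\<bar> ^ 3)"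
  defines "e \<equiv> expectation (\<lambda>z. (edist p (fst z) (snd z))\<^sup>2)"
  defines "m \<equiv> (e - A) / A"
    and "v \<equiv> expectation (\<lambda>z. ((edist p (fst z) (snd z))\<^sup>2 - e)\<^sup>2) / A\<^sup>2"
  shows "integrable (P \<Otimes>\<^sub>M Q) (\<lambda>(x, y). k x y)"
    and "integrable (P \<Otimes>\<^sub>M Q) (\<lambda>(x, y). (k x y - c0)\<^sup>2)"
    and "(\<integral>(x, y). (k x y - c0)\<^sup>2 \<partial>(P \<Otimes>\<^sub>M Q)) \<le> B\<^sup>2 * (m\<^sup>2 + v)"
    and "\<bar>(\<integral>(x, y). k x y \<partial>(P \<Otimes>\<^sub>M Q)) - (c0 + c1 * m + c2 * (m\<^sup>2 + v))\<bar> \<le> 4 * B * (8 * \<bar>m\<bar> ^ 3 + 4 * v)"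
proof -
  let ?M = "P \<Otimes>\<^sub>M Q"
  define u where "u z = ((edist p (fst z) (snd z))\<^sup>2 - A) / A" for z
  define w where "w z = u z - m" for z
  define g where "g z = k (fst z) (snd z)" for z
  have w_eq: "w z = ((edist p (fst z) (snd z))\<^sup>2 - e) / A" for z
    unfolding w_def u_def m_def using A by (simp add: field_simps)
  have w_int: "integrable ?M w" "expectation w = 0"
    unfolding w_eq[abs_def] using sq_dist_variance(1) by (simp_all add: e_def prob_space)
  have w2: "integrable ?M (\<lambda>z. (w z)\<^sup>2)" "expectation (\<lambda>z. (w z)\<^sup>2) = v"
    unfolding w_eq[abs_def] power_divide v_def using sq_dist_variance(2) by (simp_all add: e_def)
  have u: "u z = w z + m" for z by (simp add: w_def)
  have u_int: "integrable ?M u" "expectation u = m"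
    unfolding u[abs_def] using w_int by (simp_all add: prob_space)
  have u2: "integrable ?M (\<lambda>z. (u z)\<^sup>2)" "expectation (\<lambda>z. (u z)\<^sup>2) = m\<^sup>2 + v"
    unfolding u power2_sum using w_int w2 by (simp_all add: prob_space)
  have sets: "sets ?M = sets (rspace p \<Otimes>\<^sub>M rspace p)"
    by (intro sets_pair_measure_cong L.sets_law R.sets_law)
  have g_meas [measurable]: "g \<in> borel_measurable ?M"
    unfolding measurable_cong_sets[OF sets refl] g_def[abs_def] using meas by (simp add: case_prod_beta')
  have in_space: "fst z \<in> space (rspace p)" "snd z \<in> space (rspace p)" if "z \<in> space ?M" for z
    using that L.space_law R.space_law by (auto simp: space_pair_measure)
  have first': "\<bar>g z - c0\<bar> \<le> B * \<bar>u z\<bar>" if "z \<in> space ?M" for z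
    unfolding g_def u_def by (rule first[OF in_space[OF that]])
  have sq: "(g z - c0)\<^sup>2 \<le> B\<^sup>2 * (u z)\<^sup>2" if "z \<in> space ?M" for z
  proof -
    have "\<bar>g z - c0\<bar>\<^sup>2 \<le> (B * \<bar>u z\<bar>)\<^sup>2" using first'[OF that] by (rule power_mono) simp
    then show ?thesis by (simp add: power_mult_distrib)
  qed
  have g_int: "integrable ?M g"
  proof (rule Bochner_Integration.integrable_bound[of _ "\<lambda>z. \<bar>c0\<bar> + B * \<bar>u z\<bar>"])
    show "AE z in ?M. norm (g z) \<le> norm (\<bar>c0\<bar> + B * \<bar>u z\<bar>)"
    proof (intro AE_I2)
      fix z assume "z \<in> space ?M"
      from first'[OF this] show "norm (g z) \<le> norm (\<bar>c0\<bar> + B * \<bar>u z\<bar>)" by simp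
    qed
  qed (use u_int in auto)
  then show "integrable ?M (\<lambda>(x, y). k x y)"
    by (simp add: g_def[abs_def] case_prod_beta')
  have g2_int: "integrable ?M (\<lambda>z. (g z - c0)\<^sup>2)"
  proof (rule Bochner_Integration.integrable_bound[of _ "\<lambda>z. B\<^sup>2 * (u z)\<^sup>2"])
    show "AE z in ?M. norm ((g z - c0)\<^sup>2) \<le> norm (B\<^sup>2 * (u z)\<^sup>2)"
      using sq by (intro AE_I2) simp
  qed (use u2 in auto)
  then show "integrable ?M (\<lambda>(x, y). (k x y - c0)\<^sup>2)"
    by (simp add: g_def[abs_def] case_prod_beta')
  have "expectation (\<lambda>z. (g z - c0)\<^sup>2) \<le> expectation (\<lambda>z. B\<^sup>2 * (u z)\<^sup>2)"
    using g2_int u2 sq by (intro integral_mono) auto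
  also have "\<dots> = B\<^sup>2 * (m\<^sup>2 + v)" using u2 by simp
  finally show "(\<integral>(x, y). (k x y - c0)\<^sup>2 \<partial>?M) \<le> B\<^sup>2 * (m\<^sup>2 + v)"
    by (simp add: g_def[abs_def] case_prod_beta')
  define q where "q z = c0 + c1 * u z + c2 * (u z)\<^sup>2" for z
  have q: "integrable ?M q" "expectation q = c0 + c1 * m + c2 * (m\<^sup>2 + v)"
    unfolding q_def[abs_def] using u_int u2 by (simp_all add: prob_space)
  have rem: "\<bar>g z - q z\<bar> \<le> 4 * B * (8 * \<bar>m\<bar> ^ 3 + 4 * (w z)\<^sup>2)" if "z \<in> space ?M" for z
  proof -
    have "\<bar>g z - q z\<bar> \<le> 4 * B * min ((u z)\<^sup>2) (\<bar>u z\<bar> ^ 3)"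
      unfolding g_def q_def u_def by (rule second[OF in_space[OF that]])
    also have "\<dots> \<le> 4 * B * (8 * \<bar>m\<bar> ^ 3 + 4 * (w z)\<^sup>2)"
      using min_square_cube_le[of "u z" m] B by (intro mult_left_mono) (auto simp: w_def)
    finally show ?thesis .
  qed
  have "\<bar>expectation g - expectation q\<bar> = \<bar>expectation (\<lambda>z. g z - q z)\<bar>"
    using g_int q by simp
  also have "\<dots> \<le> expectation (\<lambda>z. \<bar>g z - q z\<bar>)"
    by (rule integral_abs_bound)
  also have "\<dots> \<le> expectation (\<lambda>z. 4 * B * (8 * \<bar>m\<bar> ^ 3 + 4 * (w z)\<^sup>2))"
    using g_int q w2 rem by (intro integral_mono) auto
  also have "\<dots> = 4 * B * (8 * \<bar>m\<bar> ^ 3 + 4 * v)"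
    using w2 by (simp add: prob_space)
  finally show "\<bar>(\<integral>(x, y). k x y \<partial>?M) - (c0 + c1 * m + c2 * (m\<^sup>2 + v))\<bar> \<le> 4 * B * (8 * \<bar>m\<bar> ^ 3 + 4 * v)"
    unfolding q(2) by (simp add: g_def[abs_def] case_prod_beta')
qed

definition energy_distance :: "(rvec \<Rightarrow> rvec \<Rightarrow> real) \<Rightarrow> rvec measure \<Rightarrow> rvec measure \<Rightarrow> real" where
  "energy_distance k P Q = 2 * (\<integral>(x, y). k x y \<partial>(P \<Otimes>\<^sub>M Q))
     - (\<integral>(x, y). k x y \<partial>(P \<Otimes>\<^sub>M P)) - (\<integral>(x, y). k x y \<partial>(Q \<Otimes>\<^sub>M Q))"

text \<open>
  For kernels of strong negative type this is the definition, once a point \<open>z0\<close> with integrable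
  sections has been found by Fubini's theorem. If \<open>- k\<close> is a reproducing kernel, the energy distance is the
  squared norm of the difference of the mean embeddings of \<open>P\<close> and \<open>Q\<close>, which are distinct because
  the kernel is characteristic.
\<close>
lemma energy_distance_pos:
  assumes kernel: "is_kernel p k"
    and PQ: "P \<in> borel_probs p" "Q \<in> borel_probs p" "P \<noteq> Q"
    and meas: "case_prod k \<in> borel_measurable (rspace p \<Otimes>\<^sub>M rspace p)"
    and int: "integrable (P \<Otimes>\<^sub>M Q) (\<lambda>(x, y). k x y)" "integrable (P \<Otimes>\<^sub>M P) (\<lambda>(x, y). k x y)"
      "integrable (Q \<Otimes>\<^sub>M Q) (\<lambda>(x, y). k x y)"
  shows "0 < energy_distance k P Q"
proof -
  let ?S = "space (rspace p)"
  have P: "prob_space P" "sets P = sets (rspace p)" and Q: "prob_space Q" "sets Q = sets (rspace p)"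
    using PQ by (auto simp: borel_probs_def)
  interpret L: prob_space P by fact
  interpret R: prob_space Q by fact
  interpret PQ: pair_prob_space P Q ..
  interpret QP: pair_prob_space Q P ..
  interpret PP: pair_prob_space P P ..
  interpret QQ: pair_prob_space Q Q ..
  have sp: "space P = ?S" "space Q = ?S"
    using sets_eq_imp_space_eq[OF P(2)] sets_eq_imp_space_eq[OF Q(2)] by auto
  have sym: "k x y = k y x" if "x \<in> ?S" "y \<in> ?S" for x y
    using kernel that unfolding is_kernel_def by blast
  have m: "case_prod k \<in> borel_measurable (P \<Otimes>\<^sub>M Q)"
    using meas by (subst measurable_cong_sets[OF sets_pair_measure_cong[OF P(2) Q(2)] refl])
  have swap: "integrable (Q \<Otimes>\<^sub>M P) (\<lambda>(x, y). k x y)"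
    "(\<integral>(x, y). k x y \<partial>(Q \<Otimes>\<^sub>M P)) = (\<integral>(x, y). k x y \<partial>(P \<Otimes>\<^sub>M Q))"
  proof -
    have eq: "(case z of (x, y) \<Rightarrow> k x y) = (case z of (x, y) \<Rightarrow> case_prod k (y, x))"
      if "z \<in> space (Q \<Otimes>\<^sub>M P)" for z
      using that sp sym by (auto simp: space_pair_measure)
    show "integrable (Q \<Otimes>\<^sub>M P) (\<lambda>(x, y). k x y)"
      using PQ.integrable_product_swap[OF int(1)] by (subst Bochner_Integration.integrable_cong[OF refl eq])
    show "(\<integral>(x, y). k x y \<partial>(Q \<Otimes>\<^sub>M P)) = (\<integral>(x, y). k x y \<partial>(P \<Otimes>\<^sub>M Q))"
      using PQ.integral_product_swap[OF m] by (subst Bochner_Integration.integral_cong[OF refl eq])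
  qed
  from kernel consider (neg) "strong_negative_type_kernel p k"
    | (rkhs) H ip where "reproducing_kernel ?S (\<lambda>x y. - k x y) H ip" "characteristic p H ip"
    unfolding is_kernel_def by blast
  then show ?thesis
  proof cases
    case neg
    have "AE z in P. integrable P (\<lambda>x. k x z)" "AE z in P. integrable Q (\<lambda>x. k x z)"
      using PP.AE_integrable_snd[OF int(2)] QP.AE_integrable_snd[OF swap(1)] by auto
    then have "AE z in P. z \<in> ?S \<and> integrable P (\<lambda>x. k x z) \<and> integrable Q (\<lambda>x. k x z)"
      using AE_space unfolding sp[symmetric] by eventually_elim auto
    then have "\<exists>z0\<in>?S. integrable P (\<lambda>z. k z z0) \<and> integrable Q (\<lambda>z. k z z0)"
      using L.AE_contr[of "\<lambda>z. z \<in> ?S \<and> integrable P (\<lambda>x. k x z) \<and> integrable Q (\<lambda>x. k x z)"] by blast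
    then have "(\<integral>(x, y). k x y \<partial>(P \<Otimes>\<^sub>M P)) - (\<integral>(x, y). k x y \<partial>(P \<Otimes>\<^sub>M Q))
          - (\<integral>(x, y). k x y \<partial>(Q \<Otimes>\<^sub>M P)) + (\<integral>(x, y). k x y \<partial>(Q \<Otimes>\<^sub>M Q)) < 0"
      using neg PQ unfolding strong_negative_type_kernel_def by blast
    then show ?thesis unfolding energy_distance_def swap(2) by simp
  next
    case rkhs
    define K where "K x y = - k x y" for x y
    have H: "function_hilbert_space ?S H ip"
      and KH: "\<And>x. x \<in> ?S \<Longrightarrow> (\<lambda>y\<in>?S. K y x) \<in> H"
      and rep: "\<And>x h. x \<in> ?S \<Longrightarrow> h \<in> H \<Longrightarrow> ip h (\<lambda>y\<in>?S. K y x) = h x"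
      using rkhs(1) unfolding reproducing_kernel_def K_def by auto
    have ext: "H \<subseteq> extensional ?S"
      and add_mem: "\<And>g h. g \<in> H \<Longrightarrow> h \<in> H \<Longrightarrow> (\<lambda>x\<in>?S. g x + h x) \<in> H"
      and smul_mem: "\<And>c h. h \<in> H \<Longrightarrow> (\<lambda>x\<in>?S. c * h x) \<in> H"
      and ip_sym: "\<And>g h. g \<in> H \<Longrightarrow> h \<in> H \<Longrightarrow> ip g h = ip h g"
      and ip_add: "\<And>g g' h. g \<in> H \<Longrightarrow> g' \<in> H \<Longrightarrow> h \<in> H \<Longrightarrow> ip (\<lambda>x\<in>?S. g x + g' x) h = ip g h + ip g' h"
      and ip_smul: "\<And>c g h. g \<in> H \<Longrightarrow> h \<in> H \<Longrightarrow> ip (\<lambda>x\<in>?S. c * g x) h = c * ip g h"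
      and ip_pos: "\<And>h. h \<in> H \<Longrightarrow> 0 \<le> ip h h \<and> (ip h h = 0 \<longleftrightarrow> h = (\<lambda>x\<in>?S. 0))"
      using H unfolding function_hilbert_space_def by auto
    obtain \<mu> \<nu> where mu: "mean_embedding H ip P \<mu>" and nu: "mean_embedding H ip Q \<nu>"
      using rkhs(2) PQ unfolding characteristic_def by blast
    have ne: "\<mu> \<noteq> \<nu>"
      using rkhs(2) PQ mu nu unfolding characteristic_def by blast
    have muH: "\<mu> \<in> H" and nuH: "\<nu> \<in> H"
      using mu nu unfolding mean_embedding_def by auto
    \<comment> \<open>inner products of mean embeddings are double integrals of the kernel\<close>
    have emb: "ip \<theta> \<eta> = (\<integral>(x, y). K x y \<partial>(A \<Otimes>\<^sub>M B))"
      if A: "mean_embedding H ip A \<theta>" and B: "mean_embedding H ip B \<eta>"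
        and AB: "pair_prob_space A B" "space A = ?S" "space B = ?S"
        and iAB: "integrable (A \<Otimes>\<^sub>M B) (\<lambda>(x, y). k x y)" for A B \<theta> \<eta>
    proof -
      interpret AB: pair_prob_space A B by fact
      have th: "\<theta> \<in> H" using A unfolding mean_embedding_def by auto
      have val: "\<theta> y = (\<integral>x. K x y \<partial>A)" if "y \<in> ?S" for y
      proof -
        have "\<theta> y = ip (\<lambda>x\<in>?S. K x y) \<theta>"
          using rep[OF that th] ip_sym[OF th KH[OF that]] by simp
        also have "\<dots> = (\<integral>x. (\<lambda>x\<in>?S. K x y) x \<partial>A)"
          using A KH[OF that] unfolding mean_embedding_def by blast
        also have "\<dots> = (\<integral>x. K x y \<partial>A)"
          by (intro Bochner_Integration.integral_cong) (auto simp: AB(2))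
        finally show ?thesis .
      qed
      have iK: "integrable (A \<Otimes>\<^sub>M B) (\<lambda>(x, y). K x y)"
        using Bochner_Integration.integrable_minus[OF iAB] by (simp add: K_def case_prod_beta')
      have "ip \<theta> \<eta> = (\<integral>y. \<theta> y \<partial>B)"
        using B th unfolding mean_embedding_def by auto
      also have "\<dots> = (\<integral>y. (\<integral>x. K x y \<partial>A) \<partial>B)"
        by (intro Bochner_Integration.integral_cong) (auto simp: AB(3) val)
      also have "\<dots> = (\<integral>(x, y). K x y \<partial>(A \<Otimes>\<^sub>M B))"
        by (rule AB.integral_snd[OF iK])
      finally show ?thesis .
    qed
    define w where "w = (\<lambda>x\<in>?S. \<mu> x + (\<lambda>x\<in>?S. (-1) * \<nu> x) x)"
    have wH: "w \<in> H" unfolding w_def by (intro add_mem smul_mem muH nuH)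
    have w_ip: "ip w h = ip \<mu> h - ip \<nu> h" if "h \<in> H" for h
      unfolding w_def using ip_add[OF muH smul_mem[OF nuH] that, of "-1"] ip_smul[OF nuH that, of "-1"] by simp
    have "ip w w = ip \<mu> w - ip \<nu> w" by (rule w_ip[OF wH])
    also have "\<dots> = ip w \<mu> - ip w \<nu>" using ip_sym wH muH nuH by simp
    also have "\<dots> = ip \<mu> \<mu> - ip \<nu> \<mu> - (ip \<mu> \<nu> - ip \<nu> \<nu>)" using w_ip muH nuH by simp
    also have "\<dots> = ip \<mu> \<mu> + ip \<nu> \<nu> - 2 * ip \<mu> \<nu>" using ip_sym[OF muH nuH] by simp
    also have "\<dots> = energy_distance k P Q"
      unfolding energy_distance_def
        emb[OF mu mu PP.pair_prob_space_axioms sp(1) sp(1) int(2)]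
        emb[OF nu nu QQ.pair_prob_space_axioms sp(2) sp(2) int(3)]
        emb[OF mu nu PQ.pair_prob_space_axioms sp int(1)]
      by (simp add: K_def case_prod_beta')
    finally have eq: "energy_distance k P Q = ip w w" ..
    have "w \<noteq> (\<lambda>x\<in>?S. 0)"
    proof
      assume w0: "w = (\<lambda>x\<in>?S. 0)"
      have "\<mu> x = \<nu> x" if "x \<in> ?S" for x
        using fun_cong[OF w0, of x] that by (simp add: w_def)
      moreover have "\<mu> \<in> extensional ?S" "\<nu> \<in> extensional ?S" using ext muH nuH by auto
      ultimately have "\<mu> = \<nu>" by (intro extensionalityI)
      then show False using ne by simp
    qed
    then show ?thesis unfolding eq using ip_pos[OF wH] by linarith
  qed
qed
text \<open>
  The means of \<open>u\<close> for the pairs \<open>(X, Y)\<close>, \<open>(X, X')\<close>, \<open>(Y, Y')\<close> are \<open>0\<close>, \<open>(\<tau> - q) / A\<close> and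
  \<open>(- \<tau> - q) / A\<close>. In the energy distance \<open>\<tau>\<close> therefore cancels to first order and survives to second
  order, whereas \<open>q = |\<Delta>|\<^sup>2\<close> survives to first order.
\<close>
lemma energy_distance_expansion:
  fixes k :: "rvec \<Rightarrow> rvec \<Rightarrow> real" and B c0 c1 c2 \<beta> :: real
  assumes laws: "banded_law P p a b" "banded_law Q p a b"
  defines "A \<equiv> \<integral>z. (edist p (fst z) (snd z))\<^sup>2 \<partial>(P \<Otimes>\<^sub>M Q)"
    and "\<tau> \<equiv> total_variance p P - total_variance p Q"
    and "q \<equiv> \<Sum>j\<in>{1..p}. (coord_mean P j - coord_mean Q j)\<^sup>2"
  defines "\<mu> \<equiv> (\<bar>\<tau>\<bar> + q) / A"
  assumes A: "0 < A" and B: "0 \<le> B" and c2: "\<bar>c2\<bar> \<le> B / 4"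
    and meas: "case_prod k \<in> borel_measurable (rspace p \<Otimes>\<^sub>M rspace p)"
    and first: "\<And>x y. x \<in> space (rspace p) \<Longrightarrow> y \<in> space (rspace p) \<Longrightarrow>
        \<bar>k x y - c0\<bar> \<le> B * \<bar>((edist p x y)\<^sup>2 - A) / A\<bar>"
    and second: "\<And>x y. x \<in> space (rspace p) \<Longrightarrow> y \<in> space (rspace p) \<Longrightarrow>
        \<bar>k x y - (c0 + c1 * (((edist p x y)\<^sup>2 - A) / A) + c2 * (((edist p x y)\<^sup>2 - A) / A)\<^sup>2)\<bar>
          \<le> 4 * B * min ((((edist p x y)\<^sup>2 - A) / A)\<^sup>2) (\<bar>((edist p x y)\<^sup>2 - A) / A\<bar> ^ 3)"
    and \<beta>: "real p * real (2 * a + 1) * (16 * b) / A\<^sup>2 \<le> \<beta>"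
  shows "\<And>R S. R \<in> {P, Q} \<Longrightarrow> S \<in> {P, Q} \<Longrightarrow> integrable (R \<Otimes>\<^sub>M S) (\<lambda>(x, y). k x y)"
    and "\<And>R S. R \<in> {P, Q} \<Longrightarrow> S \<in> {P, Q} \<Longrightarrow> integrable (R \<Otimes>\<^sub>M S) (\<lambda>(x, y). (k x y - c0)\<^sup>2)"
    and "\<And>R S. R \<in> {P, Q} \<Longrightarrow> S \<in> {P, Q} \<Longrightarrow>
          (\<integral>(x, y). (k x y - c0)\<^sup>2 \<partial>(R \<Otimes>\<^sub>M S)) \<le> B\<^sup>2 * (\<mu>\<^sup>2 + \<beta>)"
    and "\<bar>energy_distance k P Q - (2 * c1 * q / A - 2 * c2 * \<tau>\<^sup>2 / A\<^sup>2)\<bar>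
          \<le> B * (q\<^sup>2 / A\<^sup>2 + 65 * \<beta> + 64 * \<mu> ^ 3)"
proof -
  define e where "e R S = (\<integral>z. (edist p (fst z) (snd z))\<^sup>2 \<partial>(R \<Otimes>\<^sub>M S))" for R S
  define mm where "mm R S = (e R S - A) / A" for R S
  define v where "v R S = (\<integral>z. ((edist p (fst z) (snd z))\<^sup>2 - e R S)\<^sup>2 \<partial>(R \<Otimes>\<^sub>M S)) / A\<^sup>2" for R S
  have pair: "banded_law_pair R S p a b" if "R \<in> {P, Q}" "S \<in> {P, Q}" for R S
    unfolding banded_law_pair_def using that laws by auto
  have km: "integrable (R \<Otimes>\<^sub>M S) (\<lambda>(x, y). k x y)"
    "integrable (R \<Otimes>\<^sub>M S) (\<lambda>(x, y). (k x y - c0)\<^sup>2)"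
    "(\<integral>(x, y). (k x y - c0)\<^sup>2 \<partial>(R \<Otimes>\<^sub>M S)) \<le> B\<^sup>2 * ((mm R S)\<^sup>2 + v R S)"
    "\<bar>(\<integral>(x, y). k x y \<partial>(R \<Otimes>\<^sub>M S)) - (c0 + c1 * mm R S + c2 * ((mm R S)\<^sup>2 + v R S))\<bar>
        \<le> 4 * B * (8 * \<bar>mm R S\<bar> ^ 3 + 4 * v R S)"
    if "R \<in> {P, Q}" "S \<in> {P, Q}" for R S
    using banded_law_pair.kernel_moments[OF pair[OF that] A B meas first second]
    unfolding mm_def v_def e_def by auto
  have v: "0 \<le> v R S" "v R S \<le> \<beta>" if "R \<in> {P, Q}" "S \<in> {P, Q}" for R S
  proof -
    show "0 \<le> v R S" by (simp add: v_def)
    have "v R S \<le> real p * real (2 * a + 1) * (16 * b) / A\<^sup>2"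
      unfolding v_def e_def
      using banded_law_pair.sq_dist_variance(3)[OF pair[OF that]] by (intro divide_right_mono) auto
    then show "v R S \<le> \<beta>" using \<beta> by linarith
  qed
  have em: "e R S = total_variance p R + total_variance p S
      + (\<Sum>j\<in>{1..p}. (coord_mean R j - coord_mean S j)\<^sup>2)" if "R \<in> {P, Q}" "S \<in> {P, Q}" for R S
    unfolding e_def by (rule banded_law_pair.sq_dist_mean[OF pair[OF that]])
  have A_eq: "A = total_variance p P + total_variance p Q + q"
    using em[of P Q] by (simp add: e_def A_def q_def)
  have q0: "0 \<le> q" by (simp add: q_def sum_nonneg)
  have mPQ: "mm P Q = 0" by (simp add: mm_def e_def A_def)
  have mQP: "mm Q P = 0"
    using em[of Q P] A_eq by (simp add: mm_def q_def power2_commute)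
  have mPP: "mm P P = (\<tau> - q) / A"
    using em[of P P] A_eq by (simp add: mm_def \<tau>_def)
  have mQQ: "mm Q Q = (- \<tau> - q) / A"
    using em[of Q Q] A_eq by (simp add: mm_def \<tau>_def)
  have \<mu>0: "0 \<le> \<mu>" unfolding \<mu>_def using A q0 by simp
  have m\<mu>: "\<bar>mm R S\<bar> \<le> \<mu>" if "R \<in> {P, Q}" "S \<in> {P, Q}" for R S
  proof -
    have "\<bar>mm P P\<bar> \<le> \<mu>" "\<bar>mm Q Q\<bar> \<le> \<mu>"
      unfolding mPP mQQ \<mu>_def abs_divide using A q0 by (auto intro!: divide_right_mono)
    then show ?thesis using that mPQ mQP \<mu>0 by auto
  qed
  show "integrable (R \<Otimes>\<^sub>M S) (\<lambda>(x, y). k x y)"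
    "integrable (R \<Otimes>\<^sub>M S) (\<lambda>(x, y). (k x y - c0)\<^sup>2)" if "R \<in> {P, Q}" "S \<in> {P, Q}" for R S
    using km[OF that] by auto
  show "(\<integral>(x, y). (k x y - c0)\<^sup>2 \<partial>(R \<Otimes>\<^sub>M S)) \<le> B\<^sup>2 * (\<mu>\<^sup>2 + \<beta>)" if "R \<in> {P, Q}" "S \<in> {P, Q}" for R S
  proof -
    have "(mm R S)\<^sup>2 \<le> \<mu>\<^sup>2" using m\<mu>[OF that] \<mu>0 by (simp add: abs_le_square_iff[symmetric])
    then have "B\<^sup>2 * ((mm R S)\<^sup>2 + v R S) \<le> B\<^sup>2 * (\<mu>\<^sup>2 + \<beta>)"
      using v(2)[OF that] by (intro mult_left_mono) auto
    then show ?thesis using km(3)[OF that] by linarith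
  qed
  define I where "I R S = (\<integral>(x, y). k x y \<partial>(R \<Otimes>\<^sub>M S))" for R S
  define J where "J R S = c0 + c1 * mm R S + c2 * ((mm R S)\<^sup>2 + v R S)" for R S
  have IJ: "\<bar>I R S - J R S\<bar> \<le> B * (32 * \<mu> ^ 3 + 16 * \<beta>)" if "R \<in> {P, Q}" "S \<in> {P, Q}" for R S
  proof -
    have "\<bar>mm R S\<bar> ^ 3 \<le> \<mu> ^ 3" using m\<mu>[OF that] by (intro power_mono) auto
    then have "4 * B * (8 * \<bar>mm R S\<bar> ^ 3 + 4 * v R S) \<le> 4 * B * (8 * \<mu> ^ 3 + 4 * \<beta>)"
      using v(2)[OF that] B by (intro mult_left_mono) auto
    then show ?thesis using km(4)[OF that] unfolding I_def J_def by (simp add: algebra_simps)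
  qed
  have IJ0: "\<bar>I P Q - J P Q\<bar> \<le> B * (16 * \<beta>)"
  proof -
    have "4 * B * (8 * \<bar>mm P Q\<bar> ^ 3 + 4 * v P Q) \<le> 4 * B * (4 * \<beta>)"
      using v(2)[of P Q] B mPQ by (intro mult_left_mono) auto
    then show ?thesis using km(4)[of P Q] unfolding I_def J_def by (simp add: algebra_simps)
  qed
  have main: "2 * J P Q - J P P - J Q Q = (2 * c1 * q / A - 2 * c2 * \<tau>\<^sup>2 / A\<^sup>2)
      + c2 * (2 * v P Q - v P P - v Q Q - 2 * (q\<^sup>2 / A\<^sup>2))"
    unfolding J_def mPQ mPP mQQ using A
    by (simp add: field_simps power2_eq_square)
  have rem: "\<bar>c2 * (2 * v P Q - v P P - v Q Q - 2 * (q\<^sup>2 / A\<^sup>2))\<bar> \<le> B / 4 * (2 * \<beta> + 2 * (q\<^sup>2 / A\<^sup>2))"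
  proof (unfold abs_mult, rule mult_mono)
    have "0 \<le> q\<^sup>2 / A\<^sup>2" by simp
    then show "\<bar>2 * v P Q - v P P - v Q Q - 2 * (q\<^sup>2 / A\<^sup>2)\<bar> \<le> 2 * \<beta> + 2 * (q\<^sup>2 / A\<^sup>2)"
      using v(1,2)[of P Q, simplified] v(1,2)[of P P, simplified] v(1,2)[of Q Q, simplified] by linarith
  qed (use c2 B in auto)
  have ed: "energy_distance k P Q = 2 * I P Q - I P P - I Q Q"
    by (simp add: energy_distance_def I_def)
  have combine: "\<bar>2 * i0 - i1 - i2 - s\<bar> \<le> z + 2 * x + 2 * y"
    if "\<bar>i0 - j0\<bar> \<le> x" "\<bar>i1 - j1\<bar> \<le> y" "\<bar>i2 - j2\<bar> \<le> y" "2 * j0 - j1 - j2 = s + r" "\<bar>r\<bar> \<le> z"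
    for i0 i1 i2 j0 j1 j2 x y z s r :: real
    using that by linarith
  have "\<bar>energy_distance k P Q - (2 * c1 * q / A - 2 * c2 * \<tau>\<^sup>2 / A\<^sup>2)\<bar>
      \<le> B / 4 * (2 * \<beta> + 2 * (q\<^sup>2 / A\<^sup>2)) + 2 * (B * (16 * \<beta>)) + 2 * (B * (32 * \<mu> ^ 3 + 16 * \<beta>))"
    unfolding ed by (rule combine[OF IJ0 IJ IJ main rem]) auto
  also have "\<dots> \<le> B * (q\<^sup>2 / A\<^sup>2 + 65 * \<beta> + 64 * \<mu> ^ 3)"
  proof -
    have "0 \<le> \<beta>" using v[of P Q] by auto
    then have "0 \<le> B * \<beta>" "0 \<le> B * (q\<^sup>2 / A\<^sup>2)" using B by auto
    then show ?thesis by (simp add: algebra_simps)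
  qed
  finally show "\<bar>energy_distance k P Q - (2 * c1 * q / A - 2 * c2 * \<tau>\<^sup>2 / A\<^sup>2)\<bar>
      \<le> B * (q\<^sup>2 / A\<^sup>2 + 65 * \<beta> + 64 * \<mu> ^ 3)" .
qed


section \<open>Fluctuations of the two-sample statistics\<close>

text \<open>
  Two pairs without common index are independent, and at most \<open>4 * card J\<close> pairs meet a given pair.
\<close>
lemma (in prob_space) pair_sum_variance:
  fixes W :: "'i \<Rightarrow> 'a \<Rightarrow> 'b" and h :: "'b \<Rightarrow> 'b \<Rightarrow> real"
  assumes ind: "indep_vars (\<lambda>_. N) W I"
    and J: "finite J" "J \<subseteq> I" and E: "E \<subseteq> J \<times> J"
    and off: "\<And>a b. (a, b) \<in> E \<Longrightarrow> a \<noteq> b"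
    and meas: "case_prod h \<in> borel_measurable (N \<Otimes>\<^sub>M N)"
    and sq: "\<And>a b. (a, b) \<in> E \<Longrightarrow> integrable M (\<lambda>\<omega>. (h (W a \<omega>) (W b \<omega>))\<^sup>2)"
    and K: "\<And>a b. (a, b) \<in> E \<Longrightarrow> expectation (\<lambda>\<omega>. (h (W a \<omega>) (W b \<omega>))\<^sup>2) \<le> K"
  defines "S \<equiv> \<lambda>\<omega>. (\<Sum>(a, b)\<in>E. h (W a \<omega>) (W b \<omega>)) - (\<Sum>(a, b)\<in>E. expectation (\<lambda>\<omega>. h (W a \<omega>) (W b \<omega>)))"
  shows "integrable M (\<lambda>\<omega>. (S \<omega>)\<^sup>2)"
    and "expectation (\<lambda>\<omega>. (S \<omega>)\<^sup>2) \<le> real (card E) * real (4 * card J) * K"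
proof -
  define Z where "Z e \<omega> = h (W (fst e) \<omega>) (W (snd e) \<omega>)" for e \<omega>
  define dep where "dep e e' \<longleftrightarrow> {fst e, snd e} \<inter> {fst e', snd e'} \<noteq> {}" for e e' :: "'i \<times> 'i"
  have finE: "finite E" using E J by (meson finite_SigmaI finite_subset)
  have EI: "fst e \<in> I \<and> snd e \<in> I" if "e \<in> E" for e
    using subsetD[OF E that] J(2) by (cases e) auto
  have W: "W a \<in> measurable M N" if "a \<in> I" for a
    using ind that unfolding indep_vars_def by auto
  have Zm: "random_variable borel (Z e)" if "e \<in> E" for e
    using measurable_compose[OF measurable_Pair[OF W[of "fst e"] W[of "snd e"]] meas] EI[OF that]
    by (simp add: Z_def[abs_def])
  have Zsq: "integrable M (\<lambda>\<omega>. (Z e \<omega>)\<^sup>2)" "expectation (\<lambda>\<omega>. (Z e \<omega>)\<^sup>2) \<le> K" if "e \<in> E" for e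
    using sq[of "fst e" "snd e"] K[of "fst e" "snd e"] that by (simp_all add: Z_def)
  have deg: "card {e'\<in>E. dep e e'} \<le> 4 * card J" for e
  proof -
    let ?p = "{fst e, snd e}"
    have "{e'\<in>E. dep e e'} \<subseteq> ?p \<times> J \<union> J \<times> ?p" using E by (auto simp: dep_def)
    then have "card {e'\<in>E. dep e e'} \<le> card (?p \<times> J \<union> J \<times> ?p)"
      using J by (intro card_mono) auto
    also have "\<dots> \<le> card (?p \<times> J) + card (J \<times> ?p)" by (rule card_Un_le)
    also have "\<dots> = 2 * (card ?p * card J)" by (simp add: card_cartesian_product)
    also have "\<dots> \<le> 2 * (2 * card J)"
      by (intro mult_le_mono order_refl) (simp add: card_insert_if)
    finally show ?thesis by simp
  qed
  have uncor: "expectation (\<lambda>\<omega>. Z e \<omega> * Z e' \<omega>) = expectation (Z e) * expectation (Z e')"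
    if e: "e \<in> E" "e' \<in> E" "\<not> dep e e'" for e e'
  proof -
    have r: "(\<lambda>g. h (g (fst e)) (g (snd e))) \<in> borel_measurable (PiM {fst e, snd e} (\<lambda>_. N))" for e :: "'i \<times> 'i"
    proof -
      have "(\<lambda>g. (g (fst e), g (snd e))) \<in> measurable (PiM {fst e, snd e} (\<lambda>_. N)) (N \<Otimes>\<^sub>M N)"
        by (intro measurable_Pair measurable_component_singleton) auto
      from measurable_compose[OF this meas] show ?thesis by simp
    qed
    have "indep_var borel ((\<lambda>g. h (g (fst e)) (g (snd e))) \<circ> (\<lambda>\<omega>. restrict (\<lambda>i. W i \<omega>) {fst e, snd e}))
        borel ((\<lambda>g. h (g (fst e')) (g (snd e'))) \<circ> (\<lambda>\<omega>. restrict (\<lambda>i. W i \<omega>) {fst e', snd e'}))"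
      using EI[OF e(1)] EI[OF e(2)] e(3) unfolding dep_def
      by (intro indep_var_compose[OF indep_var_restrict[OF ind] r r]) auto
    then have "indep_var borel (Z e) borel (Z e')"
      by (simp add: comp_def Z_def[abs_def])
    then show ?thesis
      using square_integrable_imp_integrable[OF Zm Zsq(1)] e by (intro indep_var_lebesgue_integral) auto
  qed
  have S: "S = (\<lambda>\<omega>. (\<Sum>e\<in>E. Z e \<omega>) - (\<Sum>e\<in>E. expectation (Z e)))"
    by (simp add: S_def Z_def[abs_def] case_prod_beta')
  show "integrable M (\<lambda>\<omega>. (S \<omega>)\<^sup>2)" "expectation (\<lambda>\<omega>. (S \<omega>)\<^sup>2) \<le> real (card E) * real (4 * card J) * K"
    unfolding S using variance_sum_dependency_graph[OF finE Zm Zsq deg uncor] by auto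
qed

text \<open>
  Observations are indexed by a sum type: \<open>Inl i\<close> stands for the \<open>i\<close>-th observation of the first
  sample and \<open>Inr j\<close> for the \<open>j\<close>-th of the second. The three kinds of pairs can then be treated alike.
\<close>
locale two_sample = prob_space M for M :: "'a measure" +
  fixes p :: nat and Xs Ys :: "nat \<Rightarrow> 'a \<Rightarrow> rvec" and P Q :: "rvec measure"
  assumes indep: "indep_vars (\<lambda>_. rspace p)
      (\<lambda>s. case s of Inl i \<Rightarrow> Xs i | Inr j \<Rightarrow> Ys j) ({1..} <+> {1..})"
    and law_X: "\<And>i. 1 \<le> i \<Longrightarrow> distr M (rspace p) (Xs i) = P"
    and law_Y: "\<And>j. 1 \<le> j \<Longrightarrow> distr M (rspace p) (Ys j) = Q"
begin

definition W :: "nat + nat \<Rightarrow> 'a \<Rightarrow> rvec" where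
  "W s = (case s of Inl i \<Rightarrow> Xs i | Inr j \<Rightarrow> Ys j)"

definition law :: "nat + nat \<Rightarrow> rvec measure" where
  "law s = (case s of Inl _ \<Rightarrow> P | Inr _ \<Rightarrow> Q)"

lemma indep_W: "indep_vars (\<lambda>_. rspace p) W ({1..} <+> {1..})"
  using indep unfolding W_def[abs_def] .

lemma W_measurable: "s \<in> {1..} <+> {1..} \<Longrightarrow> W s \<in> measurable M (rspace p)"
  using indep_W unfolding indep_vars_def by auto

lemma law_W: "s \<in> {1..} <+> {1..} \<Longrightarrow> distr M (rspace p) (W s) = law s"
  by (auto simp: W_def law_def law_X law_Y)

lemma pair_law:
  assumes "s \<in> {1..} <+> {1..}" "t \<in> {1..} <+> {1..}" "s \<noteq> t"
  shows "distr M (rspace p \<Otimes>\<^sub>M rspace p) (\<lambda>\<omega>. (W s \<omega>, W t \<omega>)) = law s \<Otimes>\<^sub>M law t"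
proof -
  have "indep_var (rspace p) ((\<lambda>g. g s) \<circ> (\<lambda>\<omega>. restrict (\<lambda>i. W i \<omega>) {s}))
      (rspace p) ((\<lambda>g. g t) \<circ> (\<lambda>\<omega>. restrict (\<lambda>i. W i \<omega>) {t}))"
    using assms
    by (intro indep_var_compose[OF indep_var_restrict[OF indep_W]] measurable_component_singleton) auto
  then have "indep_var (rspace p) (W s) (rspace p) (W t)"
    by (simp add: comp_def)
  then show ?thesis
    using law_W assms unfolding indep_var_distribution_eq by simp
qed

lemma pair_measurable:
  assumes "s \<in> {1..} <+> {1..}" "t \<in> {1..} <+> {1..}"
    and "case_prod h \<in> borel_measurable (rspace p \<Otimes>\<^sub>M rspace p)"
  shows "(\<lambda>\<omega>. h (W s \<omega>) (W t \<omega>) :: real) \<in> borel_measurable M"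
  using measurable_compose[OF measurable_Pair[OF W_measurable W_measurable] assms(3)] assms(1,2) by simp

lemma pair_expectation:
  fixes h :: "rvec \<Rightarrow> rvec \<Rightarrow> real"
  assumes st: "s \<in> {1..} <+> {1..}" "t \<in> {1..} <+> {1..}" "s \<noteq> t"
    and h: "case_prod h \<in> borel_measurable (rspace p \<Otimes>\<^sub>M rspace p)"
  shows "integrable M (\<lambda>\<omega>. h (W s \<omega>) (W t \<omega>)) \<longleftrightarrow> integrable (law s \<Otimes>\<^sub>M law t) (\<lambda>(x, y). h x y)"
    and "expectation (\<lambda>\<omega>. h (W s \<omega>) (W t \<omega>)) = (\<integral>(x, y). h x y \<partial>(law s \<Otimes>\<^sub>M law t))"
proof -
  have m: "(\<lambda>\<omega>. (W s \<omega>, W t \<omega>)) \<in> measurable M (rspace p \<Otimes>\<^sub>M rspace p)"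
    using st by (intro measurable_Pair W_measurable)
  show "integrable M (\<lambda>\<omega>. h (W s \<omega>) (W t \<omega>)) \<longleftrightarrow> integrable (law s \<Otimes>\<^sub>M law t) (\<lambda>(x, y). h x y)"
    unfolding pair_law[OF st, symmetric] integrable_distr_eq[OF m h] by simp
  show "expectation (\<lambda>\<omega>. h (W s \<omega>) (W t \<omega>)) = (\<integral>(x, y). h x y \<partial>(law s \<Otimes>\<^sub>M law t))"
    unfolding pair_law[OF st, symmetric] integral_distr[OF m h] by simp
qed

end

text \<open>
  The constant \<open>c\<close> is a typical value of the kernel, \<open>K\<close> a bound for the mean squared deviation
  from it.
\<close>
locale two_sample_kernel = two_sample M p Xs Ys P Q
  for M :: "'a measure" and p Xs Ys P Q +
  fixes k :: "rvec \<Rightarrow> rvec \<Rightarrow> real" and c K :: real and n m :: nat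
  assumes kernel_measurable: "case_prod k \<in> borel_measurable (rspace p \<Otimes>\<^sub>M rspace p)"
    and kernel_sym: "\<And>x y. x \<in> space (rspace p) \<Longrightarrow> y \<in> space (rspace p) \<Longrightarrow> k x y = k y x"
    and kernel_diag: "\<And>x. x \<in> space (rspace p) \<Longrightarrow> k x x = diag_value p k"
    and int: "\<And>A B. A \<in> {P, Q} \<Longrightarrow> B \<in> {P, Q} \<Longrightarrow> integrable (A \<Otimes>\<^sub>M B) (\<lambda>(x, y). (k x y - c)\<^sup>2)"
    and K: "\<And>A B. A \<in> {P, Q} \<Longrightarrow> B \<in> {P, Q} \<Longrightarrow> (\<integral>(x, y). (k x y - c)\<^sup>2 \<partial>(A \<Otimes>\<^sub>M B)) \<le> K"
    and n: "2 \<le> n" and m: "2 \<le> m"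
begin

abbreviation "J \<equiv> ({1..n} <+> {1..m} :: (nat + nat) set)"

lemma J: "finite J" "J \<subseteq> {1..} <+> {1..}" "card J = n + m"
  by (auto simp: card_Plus)

lemma law_cases: "law s \<in> {P, Q}"
  by (auto simp: law_def split: sum.split)

lemma pair_sq:
  assumes "s \<in> J" "t \<in> J" "s \<noteq> t"
  shows "integrable M (\<lambda>\<omega>. (k (W s \<omega>) (W t \<omega>) - c)\<^sup>2)"
    and "expectation (\<lambda>\<omega>. (k (W s \<omega>) (W t \<omega>) - c)\<^sup>2) \<le> K"
proof -
  have h: "case_prod (\<lambda>x y. (k x y - c)\<^sup>2) \<in> borel_measurable (rspace p \<Otimes>\<^sub>M rspace p)"
    using kernel_measurable by (simp add: case_prod_beta')
  show "integrable M (\<lambda>\<omega>. (k (W s \<omega>) (W t \<omega>) - c)\<^sup>2)" "expectation (\<lambda>\<omega>. (k (W s \<omega>) (W t \<omega>) - c)\<^sup>2) \<le> K"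
    using pair_expectation[OF subsetD[OF J(2) assms(1)] subsetD[OF J(2) assms(2)] assms(3) h]
      int[OF law_cases law_cases] K[OF law_cases law_cases] by simp_all
qed

lemma K_nonneg: "0 \<le> K"
proof -
  have "0 \<le> expectation (\<lambda>\<omega>. (k (W (Inl 1) \<omega>) (W (Inl 2) \<omega>) - c)\<^sup>2)" by simp
  also have "\<dots> \<le> K" using n by (intro pair_sq(2)) auto
  finally show ?thesis .
qed

lemma average_variance:
  assumes E: "E \<subseteq> J \<times> J" "E \<noteq> {}"
    and off: "\<And>s t. (s, t) \<in> E \<Longrightarrow> s \<noteq> t \<and> law s = A \<and> law t = B"
  defines "U \<equiv> \<lambda>\<omega>. (\<Sum>(s, t)\<in>E. k (W s \<omega>) (W t \<omega>)) / real (card E) - (\<integral>(x, y). k x y \<partial>(A \<Otimes>\<^sub>M B))"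
  shows "integrable M (\<lambda>\<omega>. (U \<omega>)\<^sup>2)"
    and "expectation (\<lambda>\<omega>. (U \<omega>)\<^sup>2) \<le> real (4 * (n + m)) * K / real (card E)"
proof -
  define h where "h x y = k x y - c" for x y
  have hm: "case_prod h \<in> borel_measurable (rspace p \<Otimes>\<^sub>M rspace p)"
    using kernel_measurable by (simp add: h_def case_prod_beta')
  have fin: "finite E" using E J(1) by (meson finite_SigmaI finite_subset)
  have card: "0 < real (card E)" using fin E(2) by (simp add: card_gt_0_iff)
  have mem: "s \<in> J" "t \<in> J" "s \<noteq> t" "s \<in> {1..} <+> {1..}" "t \<in> {1..} <+> {1..}" if "(s, t) \<in> E" for s t
    using that E(1) off[OF that] J(2) by auto
  have hI: "integrable M (\<lambda>\<omega>. h (W s \<omega>) (W t \<omega>))" if "(s, t) \<in> E" for s t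
    using square_integrable_imp_integrable[OF pair_measurable[OF mem(4,5)[OF that] hm]]
      pair_sq(1)[OF mem(1-3)[OF that]] by (simp add: h_def)
  have mean: "expectation (\<lambda>\<omega>. h (W s \<omega>) (W t \<omega>)) = (\<integral>(x, y). k x y \<partial>(A \<Otimes>\<^sub>M B)) - c"
    if st: "(s, t) \<in> E" for s t
  proof -
    have "integrable M (\<lambda>\<omega>. h (W s \<omega>) (W t \<omega>) + c)"
      using hI[OF st] by simp
    then have "integrable M (\<lambda>\<omega>. k (W s \<omega>) (W t \<omega>))" by (simp add: h_def)
    then have "expectation (\<lambda>\<omega>. h (W s \<omega>) (W t \<omega>)) = expectation (\<lambda>\<omega>. k (W s \<omega>) (W t \<omega>)) - c"
      by (simp add: h_def prob_space)
    also have "expectation (\<lambda>\<omega>. k (W s \<omega>) (W t \<omega>)) = (\<integral>(x, y). k x y \<partial>(A \<Otimes>\<^sub>M B))"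
      using pair_expectation(2)[OF mem(4,5,3)[OF st] kernel_measurable] off[OF st] by simp
    finally show ?thesis .
  qed
  define S where "S \<omega> = (\<Sum>(s, t)\<in>E. h (W s \<omega>) (W t \<omega>))
      - (\<Sum>(s, t)\<in>E. expectation (\<lambda>\<omega>. h (W s \<omega>) (W t \<omega>)))" for \<omega>
  have S: "integrable M (\<lambda>\<omega>. (S \<omega>)\<^sup>2)"
    "expectation (\<lambda>\<omega>. (S \<omega>)\<^sup>2) \<le> real (card E) * real (4 * card J) * K"
    unfolding S_def using pair_sum_variance[OF indep_W J(1,2) E(1) mem(3) hm, of K] pair_sq[OF mem(1-3)]
    by (simp_all add: h_def)
  have U: "U \<omega> = S \<omega> / real (card E)" for \<omega>
  proof -
    have "(\<Sum>(s, t)\<in>E. expectation (\<lambda>\<omega>. h (W s \<omega>) (W t \<omega>)))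
        = (\<Sum>(s, t)\<in>E. (\<integral>(x, y). k x y \<partial>(A \<Otimes>\<^sub>M B)) - c)"
      using mean by (intro sum.cong) auto
    then show ?thesis
      unfolding U_def S_def h_def using card by (simp add: case_prod_beta' sum_subtractf field_simps)
  qed
  show "integrable M (\<lambda>\<omega>. (U \<omega>)\<^sup>2)" unfolding U power_divide using S by simp
  have "expectation (\<lambda>\<omega>. (U \<omega>)\<^sup>2) = expectation (\<lambda>\<omega>. (S \<omega>)\<^sup>2) / (real (card E))\<^sup>2"
    unfolding U power_divide by simp
  also have "\<dots> \<le> real (card E) * real (4 * card J) * K / (real (card E))\<^sup>2"
    using S by (intro divide_right_mono) auto
  also have "\<dots> = real (4 * (n + m)) * K / real (card E)"
    using card J(3) by (simp add: power2_eq_square)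
  finally show "expectation (\<lambda>\<omega>. (U \<omega>)\<^sup>2) \<le> real (4 * (n + m)) * K / real (card E)" .
qed

lemma card_upper_triangle: "real (card (SIGMA j:{1..q}. {1..<j})) = real (q choose 2)" for q :: nat
proof -
  have "real (card (SIGMA j:{1..q}. {1..<j})) = (\<Sum>j\<in>{1..q}. \<Sum>i\<in>{1..<j}. 1/2 + 1/2)"
    by simp
  also have "\<dots> = (real q - 1) * (\<Sum>i\<in>{1..q}. 1/2)"
    by (rule sum_upper_triangle_additive)
  also have "\<dots> = real (q choose 2)" by (simp add: real_choose_two)
  finally show ?thesis .
qed

lemma triangle_pairs:
  fixes F :: "nat \<Rightarrow> nat + nat" and q :: nat
  assumes "inj F"
  defines "E \<equiv> (\<lambda>(j, i). (F i, F j)) ` (SIGMA j:{1..q}. {1..<j})"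
  shows "(\<Sum>(s, t)\<in>E. g s t) = (\<Sum>j\<in>{1..q}. \<Sum>i\<in>{1..<j}. g (F i) (F j :: nat + nat) :: real)"
    and "real (card E) = real (q choose 2)"
proof -
  have inj: "inj_on (\<lambda>(j, i). (F i, F j)) (SIGMA j:{1..q}. {1..<j})"
    using assms(1) by (auto simp: inj_on_def)
  show "(\<Sum>(s, t)\<in>E. g s t) = (\<Sum>j\<in>{1..q}. \<Sum>i\<in>{1..<j}. g (F i) (F j))"
    unfolding E_def sum.reindex[OF inj] by (subst sum.Sigma) (auto simp: case_prod_beta')
  show "real (card E) = real (q choose 2)"
    unfolding E_def card_image[OF inj] by (rule card_upper_triangle)
qed

text \<open>
  The energy statistic minus its mean is \<open>2 U1 - U2 - U3\<close> for the centred averages over the three kinds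
  of pairs. The reciprocals of the numbers of pairs, weighted with the squares of these coefficients,
  add up to \<open>c_coeff\<close>.
\<close>
lemma energy_stat_variance:
  defines "V \<equiv> \<lambda>\<omega>. energy_stat k n m (\<lambda>i. Xs i \<omega>) (\<lambda>j. Ys j \<omega>) - energy_distance k P Q"
  shows "integrable M (\<lambda>\<omega>. (V \<omega>)\<^sup>2)"
    and "expectation (\<lambda>\<omega>. (V \<omega>)\<^sup>2) \<le> 12 * real (n + m) * c_coeff n m * K"
proof -
  define E1 where "E1 = (Inl ` {1..n} :: (nat + nat) set) \<times> (Inr ` {1..m} :: (nat + nat) set)"
  define E2 where "E2 = (\<lambda>(j, i). (Inl i :: nat + nat, Inl j :: nat + nat)) ` (SIGMA j:{1..n}. {1..<j})"
  define E3 where "E3 = (\<lambda>(j, i). (Inr i :: nat + nat, Inr j :: nat + nat)) ` (SIGMA j:{1..m}. {1..<j})"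
  define U where "U E A B \<omega> = (\<Sum>(s, t)\<in>E. k (W s \<omega>) (W t \<omega>)) / real (card E)
      - (\<integral>(x, y). k x y \<partial>(A \<Otimes>\<^sub>M B))" for E A B \<omega>
  have ch: "0 < real (n choose 2)" "0 < real (m choose 2)" using n m by (auto simp: real_choose_two)
  have c2: "real (card E2) = real (n choose 2)"
    unfolding E2_def by (rule triangle_pairs(2)) simp
  have c3: "real (card E3) = real (m choose 2)"
    unfolding E3_def by (rule triangle_pairs(2)) simp
  have c1: "real (card E1) = real n * real m"
    unfolding E1_def by (simp add: card_cartesian_product card_image)
  have 1: "integrable M (\<lambda>\<omega>. (U E1 P Q \<omega>)\<^sup>2)"
    "expectation (\<lambda>\<omega>. (U E1 P Q \<omega>)\<^sup>2) \<le> real (4 * (n + m)) * K / (real n * real m)"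
    unfolding U_def c1[symmetric] using n m
    by (intro average_variance; auto simp: E1_def law_def)+
  have ne: "E2 \<noteq> {}" "E3 \<noteq> {}" using c2 c3 ch by auto
  have 2: "integrable M (\<lambda>\<omega>. (U E2 P P \<omega>)\<^sup>2)"
    "expectation (\<lambda>\<omega>. (U E2 P P \<omega>)\<^sup>2) \<le> real (4 * (n + m)) * K / real (n choose 2)"
    unfolding U_def c2[symmetric] using ne
    by (intro average_variance; auto simp: E2_def law_def)+
  have 3: "integrable M (\<lambda>\<omega>. (U E3 Q Q \<omega>)\<^sup>2)"
    "expectation (\<lambda>\<omega>. (U E3 Q Q \<omega>)\<^sup>2) \<le> real (4 * (n + m)) * K / real (m choose 2)"
    unfolding U_def c3[symmetric] using ne
    by (intro average_variance; auto simp: E3_def law_def)+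
  have V: "V \<omega> = 2 * U E1 P Q \<omega> - U E2 P P \<omega> - U E3 Q Q \<omega>" for \<omega>
  proof -
    have s1: "(\<Sum>(s, t)\<in>E1. k (W s \<omega>) (W t \<omega>)) = (\<Sum>i\<in>{1..n}. \<Sum>j\<in>{1..m}. k (Xs i \<omega>) (Ys j \<omega>))"
      unfolding E1_def by (simp add: sum.cartesian_product[symmetric] sum.reindex W_def)
    have s2: "(\<Sum>(s, t)\<in>E2. k (W s \<omega>) (W t \<omega>)) = (\<Sum>j\<in>{1..n}. \<Sum>i\<in>{1..<j}. k (Xs i \<omega>) (Xs j \<omega>))"
      unfolding E2_def by (subst triangle_pairs(1)) (auto simp: W_def)
    have s3: "(\<Sum>(s, t)\<in>E3. k (W s \<omega>) (W t \<omega>)) = (\<Sum>j\<in>{1..m}. \<Sum>i\<in>{1..<j}. k (Ys i \<omega>) (Ys j \<omega>))"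
      unfolding E3_def by (subst triangle_pairs(1)) (auto simp: W_def)
    show ?thesis
      unfolding V_def U_def energy_stat_def energy_distance_def s1 s2 s3 c1 c2 c3
      by (simp add: field_simps)
  qed
  have le: "(V \<omega>)\<^sup>2 \<le> 12 * (U E1 P Q \<omega>)\<^sup>2 + 3 * (U E2 P P \<omega>)\<^sup>2 + 3 * (U E3 Q Q \<omega>)\<^sup>2" for \<omega>
  proof -
    have "(2 * x - y - z)\<^sup>2 \<le> 12 * x\<^sup>2 + 3 * y\<^sup>2 + 3 * z\<^sup>2" for x y z :: real
    proof -
      have "12 * x\<^sup>2 + 3 * y\<^sup>2 + 3 * z\<^sup>2 - (2 * x - y - z)\<^sup>2 = (2 * x + y)\<^sup>2 + (2 * x + z)\<^sup>2 + (y - z)\<^sup>2"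
        by (simp add: power2_eq_square algebra_simps)
      also have "0 \<le> \<dots>" by simp
      finally show ?thesis by simp
    qed
    then show ?thesis unfolding V .
  qed
  have Um: "U E A B \<in> borel_measurable M" if "E \<subseteq> J \<times> J" for E A B
  proof -
    have "(\<lambda>\<omega>. case e of (s, t) \<Rightarrow> k (W s \<omega>) (W t \<omega>)) \<in> borel_measurable M" if "e \<in> E" for e
    proof -
      have "fst e \<in> J" "snd e \<in> J" using subsetD[OF \<open>E \<subseteq> J \<times> J\<close> that] by (auto simp: mem_Times_iff)
      then show ?thesis
        using pair_measurable[OF subsetD[OF J(2)] subsetD[OF J(2)] kernel_measurable, of "fst e" "snd e"]
        by (simp add: case_prod_beta')
    qed
    then show ?thesis
      unfolding U_def[abs_def] by (intro borel_measurable_diff borel_measurable_divide borel_measurable_sum) auto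
  qed
  have sub: "E1 \<subseteq> J \<times> J" "E2 \<subseteq> J \<times> J" "E3 \<subseteq> J \<times> J"
    by (auto simp: E1_def E2_def E3_def)
  have R: "integrable M (\<lambda>\<omega>. 12 * (U E1 P Q \<omega>)\<^sup>2 + 3 * (U E2 P P \<omega>)\<^sup>2 + 3 * (U E3 Q Q \<omega>)\<^sup>2)"
    using 1 2 3 by simp
  show i: "integrable M (\<lambda>\<omega>. (V \<omega>)\<^sup>2)"
  proof (rule Bochner_Integration.integrable_bound[OF R])
    show "(\<lambda>\<omega>. (V \<omega>)\<^sup>2) \<in> borel_measurable M"
      unfolding V using Um sub by (intro borel_measurable_power borel_measurable_diff borel_measurable_times) auto
    show "AE \<omega> in M. norm ((V \<omega>)\<^sup>2) \<le> norm (12 * (U E1 P Q \<omega>)\<^sup>2 + 3 * (U E2 P P \<omega>)\<^sup>2 + 3 * (U E3 Q Q \<omega>)\<^sup>2)"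
      using order_trans[OF le abs_ge_self] by (intro AE_I2) simp
  qed
  have "expectation (\<lambda>\<omega>. (V \<omega>)\<^sup>2)
      \<le> expectation (\<lambda>\<omega>. 12 * (U E1 P Q \<omega>)\<^sup>2 + 3 * (U E2 P P \<omega>)\<^sup>2 + 3 * (U E3 Q Q \<omega>)\<^sup>2)"
    using i R le by (rule integral_mono)
  also have "\<dots> = 12 * expectation (\<lambda>\<omega>. (U E1 P Q \<omega>)\<^sup>2) + 3 * expectation (\<lambda>\<omega>. (U E2 P P \<omega>)\<^sup>2)
      + 3 * expectation (\<lambda>\<omega>. (U E3 Q Q \<omega>)\<^sup>2)"
    using 1 2 3 by simp
  also have "\<dots> \<le> 12 * (real (4 * (n + m)) * K / (real n * real m))
      + 3 * (real (4 * (n + m)) * K / real (n choose 2)) + 3 * (real (4 * (n + m)) * K / real (m choose 2))"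
    using 1 2 3 by (intro add_mono mult_left_mono) auto
  also have "\<dots> = 12 * real (n + m) * c_coeff n m * K"
  proof -
    have "12 * (x / q) + 3 * (x / (a / 2)) + 3 * (x / (b / 2)) = 3 * x * (2 / a + 4 / q + 2 / b)"
      for x q a b :: real
      by (simp add: algebra_simps)
    then show ?thesis
      unfolding c_coeff_def real_choose_two by simp
  qed
  finally show "expectation (\<lambda>\<omega>. (V \<omega>)\<^sup>2) \<le> 12 * real (n + m) * c_coeff n m * K" .
qed

end

context two_sample_kernel
begin

definition pooled_index :: "nat \<Rightarrow> nat + nat" where
  "pooled_index s = (if s \<le> n then Inl s else Inr (s - n))"

lemma pooled_eq_W: "pooled n (\<lambda>i. Xs i \<omega>) (\<lambda>j. Ys j \<omega>) s = W (pooled_index s) \<omega>"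
  by (simp add: pooled_def W_def pooled_index_def)

lemma pooled_index_mem: "s \<in> {1..n+m} \<Longrightarrow> pooled_index s \<in> J"
  by (auto simp: pooled_index_def)

lemma pooled_index_inj: "s \<noteq> t \<Longrightarrow> pooled_index s \<noteq> pooled_index t"
  by (auto simp: pooled_index_def)

lemma W_space: "s \<in> J \<Longrightarrow> \<omega> \<in> space M \<Longrightarrow> W s \<omega> \<in> space (rspace p)"
  using measurable_space[OF W_measurable[OF subsetD[OF J(2)]]] .

abbreviation (input) "energy \<omega> \<equiv> energy_stat k n m (\<lambda>i. Xs i \<omega>) (\<lambda>j. Ys j \<omega>)"
abbreviation (input) "vstat \<omega> \<equiv> variance_stat p k n m (\<lambda>i. Xs i \<omega>) (\<lambda>j. Ys j \<omega>)"

lemma pooled_sym: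
  assumes "\<omega> \<in> space M" "s \<in> {1..n+m}" "t \<in> {1..n+m}"
  shows "k (pooled n (\<lambda>i. Xs i \<omega>) (\<lambda>j. Ys j \<omega>) s) (pooled n (\<lambda>i. Xs i \<omega>) (\<lambda>j. Ys j \<omega>) t)
    = k (pooled n (\<lambda>i. Xs i \<omega>) (\<lambda>j. Ys j \<omega>) t) (pooled n (\<lambda>i. Xs i \<omega>) (\<lambda>j. Ys j \<omega>) s)"
  unfolding pooled_eq_W using assms by (intro kernel_sym W_space pooled_index_mem)

lemma pooled_diag:
  assumes "\<omega> \<in> space M" "s \<in> {1..n+m}"
  shows "k (pooled n (\<lambda>i. Xs i \<omega>) (\<lambda>j. Ys j \<omega>) s) (pooled n (\<lambda>i. Xs i \<omega>) (\<lambda>j. Ys j \<omega>) s) = diag_value p k"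
  unfolding pooled_eq_W using assms by (intro kernel_diag W_space pooled_index_mem)

text \<open>
  What the variance statistic becomes if the recentred kernel matrix is not projected.
\<close>
definition variance_bound :: "'a \<Rightarrow> real" where
  "variance_bound \<omega> = (\<Sum>s\<in>{1..n+m}. \<Sum>t\<in>{1..n+m} - {s}. (k (W (pooled_index s) \<omega>) (W (pooled_index t) \<omega>) - c)\<^sup>2)
       / (real (n+m) * (real (n+m) - 3))"

lemma vstat_bounds:
  assumes "\<omega> \<in> space M"
  shows "0 \<le> vstat \<omega>" "vstat \<omega> \<le> variance_bound \<omega>" "vstat \<omega> = 0 \<Longrightarrow> energy \<omega> = 0"
proof -
  have N: "4 \<le> n + m" using n m by simp
  note b = N pooled_sym[OF assms] pooled_diag[OF assms]
  show "0 \<le> vstat \<omega>" by (rule variance_stat_bounds(1)[OF b])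
  show "vstat \<omega> \<le> variance_bound \<omega>"
    using variance_stat_bounds(2)[OF b, of c] unfolding variance_bound_def pooled_eq_W .
  show "energy \<omega> = 0" if "vstat \<omega> = 0"
    using energy_stat_zero_if_variance_stat_zero[OF n m pooled_sym[OF assms] pooled_diag[OF assms] that] .
qed

lemma variance_bound_expectation:
  shows "integrable M variance_bound" and "expectation variance_bound \<le> 3 * K" and "0 \<le> variance_bound \<omega>"
proof -
  let ?N = "n + m"
  have N: "4 \<le> ?N" using n m by simp
  have pos: "0 < real ?N * (real ?N - 3)" using N by (intro mult_pos_pos) auto
  have sq: "integrable M (\<lambda>\<omega>. (k (W (pooled_index s) \<omega>) (W (pooled_index t) \<omega>) - c)\<^sup>2)"
    "expectation (\<lambda>\<omega>. (k (W (pooled_index s) \<omega>) (W (pooled_index t) \<omega>) - c)\<^sup>2) \<le> K"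
    if "s \<in> {1..?N}" "t \<in> {1..?N} - {s}" for s t
    using that by (auto intro!: pair_sq pooled_index_mem pooled_index_inj)
  show "integrable M variance_bound"
    unfolding variance_bound_def[abs_def] by (intro integrable_divide Bochner_Integration.integrable_sum sq)
  have "expectation (\<lambda>\<omega>. \<Sum>s\<in>{1..?N}. \<Sum>t\<in>{1..?N} - {s}. (k (W (pooled_index s) \<omega>) (W (pooled_index t) \<omega>) - c)\<^sup>2)
      = (\<Sum>s\<in>{1..?N}. \<Sum>t\<in>{1..?N} - {s}. expectation (\<lambda>\<omega>. (k (W (pooled_index s) \<omega>) (W (pooled_index t) \<omega>) - c)\<^sup>2))"
    by (subst Bochner_Integration.integral_sum, intro Bochner_Integration.integrable_sum sq)
      (auto intro!: sum.cong Bochner_Integration.integral_sum sq)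
  also have "\<dots> \<le> (\<Sum>s\<in>{1..?N}. \<Sum>t\<in>{1..?N} - {s}. K)"
    by (intro sum_mono sq)
  also have "\<dots> = real ?N * ((real ?N - 1) * K)" using N by (simp add: of_nat_diff)
  finally have "expectation (\<lambda>\<omega>. \<Sum>s\<in>{1..?N}. \<Sum>t\<in>{1..?N} - {s}. (k (W (pooled_index s) \<omega>) (W (pooled_index t) \<omega>) - c)\<^sup>2)
      / (real ?N * (real ?N - 3)) \<le> real ?N * ((real ?N - 1) * K) / (real ?N * (real ?N - 3))"
    using pos by (intro divide_right_mono) auto
  then have "expectation variance_bound \<le> real ?N * ((real ?N - 1) * K) / (real ?N * (real ?N - 3))"
    unfolding variance_bound_def by simp
  also have "\<dots> = (real ?N - 1) / (real ?N - 3) * K" using N by (simp add: divide_simps)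
  also have "\<dots> \<le> 3 * K"
    using N K_nonneg by (intro mult_right_mono) (auto simp: divide_le_eq)
  finally show "expectation variance_bound \<le> 3 * K" .
  show "0 \<le> variance_bound \<omega>"
    unfolding variance_bound_def using pos by (intro divide_nonneg_pos sum_nonneg) auto
qed

lemma test_stat_measurable:
  "(\<lambda>\<omega>. test_stat p k n m (\<lambda>i. Xs i \<omega>) (\<lambda>j. Ys j \<omega>)) \<in> borel_measurable M"
proof -
  have pm: "(\<lambda>\<omega>. k (W s \<omega>) (W t \<omega>)) \<in> borel_measurable M" if "s \<in> J" "t \<in> J" for s t
    using pair_measurable[OF subsetD[OF J(2) that(1)] subsetD[OF J(2) that(2)] kernel_measurable] .
  have xy: "(\<lambda>\<omega>. k (Xs i \<omega>) (Ys j \<omega>)) \<in> borel_measurable M" if "i \<in> {1..n}" "j \<in> {1..m}" for i j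
    using pm[OF InlI[of i] InrI[of j]] that by (simp add: W_def)
  have xx: "(\<lambda>\<omega>. k (Xs i \<omega>) (Xs j \<omega>)) \<in> borel_measurable M" if "j \<in> {1..n}" "i \<in> {1..<j}" for i j
    using pm[OF InlI[of i] InlI[of j]] that by (simp add: W_def)
  have yy: "(\<lambda>\<omega>. k (Ys i \<omega>) (Ys j \<omega>)) \<in> borel_measurable M" if "j \<in> {1..m}" "i \<in> {1..<j}" for i j
    using pm[OF InrI[of i] InrI[of j]] that by (simp add: W_def)
  have pp: "(\<lambda>\<omega>. k (W (pooled_index s) \<omega>) (W (pooled_index t) \<omega>)) \<in> borel_measurable M"
    if "s \<in> {1..n+m}" "t \<in> {1..n+m}" for s t
    using pm[OF pooled_index_mem pooled_index_mem] that .
  have e: "(\<lambda>\<omega>. energy \<omega>) \<in> borel_measurable M"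
    unfolding energy_stat_def
    by (intro borel_measurable_diff borel_measurable_times borel_measurable_const borel_measurable_sum xy xx yy)
  have mc: "(\<lambda>\<omega>. modified_centering (n+m) (\<lambda>s t. k (W (pooled_index s) \<omega>) (W (pooled_index t) \<omega>)) s t) \<in> borel_measurable M"
    if "s \<in> {1..n+m}" "t \<in> {1..n+m}" for s t
    unfolding modified_centering_def
    by (intro borel_measurable_add borel_measurable_diff borel_measurable_divide borel_measurable_const
        borel_measurable_sum pp that)
  have v: "(\<lambda>\<omega>. vstat \<omega>) \<in> borel_measurable M"
    unfolding variance_stat_def Let_def pooled_eq_W
    by (intro borel_measurable_diff borel_measurable_divide borel_measurable_const borel_measurable_sum
        borel_measurable_power mc) auto
  show ?thesis unfolding test_stat_def using e v by measurable
qed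

text \<open>
  Outside two exceptional events the energy statistic exceeds half of the energy distance \<open>D\<close>, and
  the denominator is less than \<open>D / (2 C)\<close>; the quotient is then larger than \<open>C\<close>.
\<close>
lemma test_stat_power:
  assumes D: "0 < energy_distance k P Q" and C: "0 < C"
  shows "1 - (48 * real (n + m) + 12 * C\<^sup>2) * c_coeff n m * K / (energy_distance k P Q)\<^sup>2
    \<le> prob {\<omega> \<in> space M. C < test_stat p k n m (\<lambda>i. Xs i \<omega>) (\<lambda>j. Ys j \<omega>)}"
proof -
  let ?D = "energy_distance k P Q" and ?c = "c_coeff n m"
  let ?T = "{\<omega> \<in> space M. C < test_stat p k n m (\<lambda>i. Xs i \<omega>) (\<lambda>j. Ys j \<omega>)}"
  have c: "0 < ?c"
    unfolding c_coeff_def using n m by (intro add_pos_pos divide_pos_pos mult_pos_pos) auto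
  define A1 where "A1 = {\<omega> \<in> space M. (energy \<omega> - ?D)\<^sup>2 \<ge> (?D / 2)\<^sup>2}"
  define A2 where "A2 = {\<omega> \<in> space M. variance_bound \<omega> \<ge> (?D / (2 * C))\<^sup>2 / ?c}"
  note ev = energy_stat_variance
  have A1: "A1 \<in> events" "prob A1 \<le> 12 * real (n + m) * ?c * K / (?D / 2)\<^sup>2"
  proof -
    have [measurable]: "(\<lambda>\<omega>. (energy \<omega> - ?D)\<^sup>2) \<in> borel_measurable M" using ev(1) by auto
    show "A1 \<in> events" unfolding A1_def by measurable
    have "prob A1 \<le> expectation (\<lambda>\<omega>. (energy \<omega> - ?D)\<^sup>2) / (?D / 2)\<^sup>2"
      unfolding A1_def using D ev(1) by (intro integral_Markov_inequality_measure[where A = "{}"]) auto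
    also have "\<dots> \<le> 12 * real (n + m) * ?c * K / (?D / 2)\<^sup>2"
      using ev(2) by (intro divide_right_mono) auto
    finally show "prob A1 \<le> 12 * real (n + m) * ?c * K / (?D / 2)\<^sup>2" .
  qed
  have A2: "A2 \<in> events" "prob A2 \<le> 3 * K / ((?D / (2 * C))\<^sup>2 / ?c)"
  proof -
    have [measurable]: "variance_bound \<in> borel_measurable M" using variance_bound_expectation(1) by auto
    show "A2 \<in> events" unfolding A2_def by measurable
    have "prob A2 \<le> expectation variance_bound / ((?D / (2 * C))\<^sup>2 / ?c)"
      unfolding A2_def using D C c variance_bound_expectation(1,3)
      by (intro integral_Markov_inequality_measure[where A = "{}"]) auto
    also have "\<dots> \<le> 3 * K / ((?D / (2 * C))\<^sup>2 / ?c)"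
      using variance_bound_expectation(2) c by (intro divide_right_mono) auto
    finally show "prob A2 \<le> 3 * K / ((?D / (2 * C))\<^sup>2 / ?c)" .
  qed
  have T: "?T \<in> events" using test_stat_measurable by measurable
  have "space M \<subseteq> A1 \<union> A2 \<union> ?T"
  proof
    fix \<omega> assume \<omega>: "\<omega> \<in> space M"
    show "\<omega> \<in> A1 \<union> A2 \<union> ?T"
    proof (rule ccontr)
      assume not: "\<omega> \<notin> A1 \<union> A2 \<union> ?T"
      then have "(energy \<omega> - ?D)\<^sup>2 < (?D / 2)\<^sup>2" using \<omega> by (auto simp: A1_def)
      then have "\<bar>energy \<omega> - ?D\<bar> < ?D / 2" using D power2_less_imp_less[of "\<bar>energy \<omega> - ?D\<bar>" "?D / 2"] by simp
      then have e: "?D / 2 < energy \<omega>" by linarith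
      have "variance_bound \<omega> < (?D / (2 * C))\<^sup>2 / ?c" using not \<omega> by (auto simp: A2_def)
      then have "vstat \<omega> < (?D / (2 * C))\<^sup>2 / ?c" using vstat_bounds(2)[OF \<omega>] by linarith
      then have v: "?c * vstat \<omega> < (?D / (2 * C))\<^sup>2" using c by (simp add: pos_less_divide_eq mult.commute)
      \<comment> \<open>a vanishing denominator would make the energy statistic vanish, too\<close>
      have "vstat \<omega> \<noteq> 0" using vstat_bounds(3)[OF \<omega>] e D by auto
      then have vpos: "0 < ?c * vstat \<omega>" using vstat_bounds(1)[OF \<omega>] c by simp
      have "sqrt (?c * vstat \<omega>) < sqrt ((?D / (2 * C))\<^sup>2)" using v by (rule real_sqrt_less_mono)
      also have "\<dots> = ?D / (2 * C)" using D C by simp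
      finally have "C * sqrt (?c * vstat \<omega>) < ?D / 2" using C by (simp add: field_simps)
      then have "C < energy \<omega> / sqrt (?c * vstat \<omega>)"
        using e vpos by (simp add: pos_less_divide_eq)
      then show False using not \<omega> by (simp add: test_stat_def)
    qed
  qed
  then have "prob (space M) \<le> prob (A1 \<union> A2 \<union> ?T)"
    using A1 A2 T by (intro finite_measure_mono) auto
  also have "\<dots> \<le> prob (A1 \<union> A2) + prob ?T"
    using A1 A2 T by (intro measure_Un_le) auto
  also have "\<dots> \<le> prob A1 + prob A2 + prob ?T"
    using A1 A2 by (intro add_right_mono measure_Un_le) auto
  also have "\<dots> \<le> 12 * real (n + m) * ?c * K / (?D / 2)\<^sup>2 + 3 * K / ((?D / (2 * C))\<^sup>2 / ?c) + prob ?T"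
    using A1(2) A2(2) by (intro add_mono) auto
  also have "12 * real (n + m) * ?c * K / (?D / 2)\<^sup>2 + 3 * K / ((?D / (2 * C))\<^sup>2 / ?c)
      = (48 * real (n + m) + 12 * C\<^sup>2) * ?c * K / ?D\<^sup>2"
    using C D by (simp add: power_divide power_mult_distrib field_simps)
  finally show ?thesis by (simp add: prob_space)
qed

end

section \<open>Asymptotic size of signal and noise\<close>

lemma powr_tendsto_0:
  assumes "e < 0"
  shows "(\<lambda>p. real p powr e) \<longlonglongrightarrow> 0"
  using tendsto_neg_powr[OF assms filterlim_real_sequentially] .

lemma dominant_term_bound:
  fixes D x y :: real
  assumes "\<bar>D - (x - y)\<bar> \<le> e" "e \<le> b" "a + b \<le> K"
    and "2 * K \<le> \<bar>x\<bar> \<and> \<bar>y\<bar> \<le> a \<or> 2 * K \<le> \<bar>y\<bar> \<and> \<bar>x\<bar> \<le> a"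
  shows "K \<le> \<bar>D\<bar>"
  using assms by linarith

text \<open>
  The error terms, divided by \<open>F p powr (\<delta> - 1)\<close>, form the null sequence \<open>R\<close>: all exponents in \<open>R\<close> are
  negative because \<open>\<delta>1\<close>, \<open>\<delta>2 \<le> \<delta> < 1\<close> and \<open>\<delta> > 0\<close>. Of the two main terms the one with the larger exponent
  dominates the other for the same reason, and bounds of the form \<open>F \<le> M2 |c_i|\<close> keep it of order
  \<open>F p powr (\<delta> - 1)\<close>. The constant \<open>\<kappa>\<close> is half of the lower bound for the main term, which leaves
  room for the others.
\<close>
lemma signal_lower_bound:
  fixes L0 L2 U2 M1 M2 \<beta> \<delta>1 \<delta>2 :: real
  assumes pos: "0 < L0" "0 < U0" "0 < L2" "0 < U2" "0 \<le> M1" "0 < M2" "0 \<le> \<beta>"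
    and ex: "0 \<le> \<delta>1" "\<delta>1 < 1" "-1 \<le> \<delta>2" "\<delta>2 < 1" "\<delta>1 \<noteq> \<delta>2" "0 < max \<delta>1 \<delta>2"
  defines "\<delta> \<equiv> max \<delta>1 \<delta>2"
  shows "\<exists>\<kappa>>0. \<forall>\<^sub>F p in sequentially. \<forall>F A q \<tau> c1 c2 D. 0 < F \<longrightarrow>
      L0 * real p \<le> A \<longrightarrow> A \<le> U0 * real p \<longrightarrow>
      L2 * real p powr \<delta>1 \<le> q \<longrightarrow> q \<le> U2 * real p powr \<delta>1 \<longrightarrow>
      L2 * real p powr ((1 + \<delta>2) / 2) \<le> \<bar>\<tau>\<bar> \<longrightarrow> \<bar>\<tau>\<bar> \<le> U2 * real p powr ((1 + \<delta>2) / 2) \<longrightarrow>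
      \<bar>c1\<bar> \<le> M1 * F \<longrightarrow> \<bar>c2\<bar> \<le> M1 * F \<longrightarrow> F \<le> M2 * \<bar>c1\<bar> \<longrightarrow> F \<le> M2 * \<bar>c2\<bar> \<longrightarrow>
      \<bar>D - (2 * c1 * q / A - 2 * c2 * \<tau>\<^sup>2 / A\<^sup>2)\<bar>
        \<le> M1 * F * (q\<^sup>2 / A\<^sup>2 + 65 * (\<beta> / real p) + 64 * ((\<bar>\<tau>\<bar> + q) / A) ^ 3) \<longrightarrow>
      \<kappa> * F * real p powr (\<delta> - 1) \<le> \<bar>D\<bar>"
proof -
  define u l where "u = U2 / L0" and "l = L2 / U0"
  have ul: "0 < u" "0 < l" using pos by (auto simp: u_def l_def)
  define R where "R p = u\<^sup>2 * real p powr (2 * \<delta>1 - 1 - \<delta>) + 65 * \<beta> * real p powr (- \<delta>)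
      + 64 * (u * (real p powr ((\<delta>2 - 1) / 2 - (\<delta> - 1) / 3) + real p powr (\<delta>1 - 1 - (\<delta> - 1) / 3))) ^ 3" for p
  have \<delta>: "0 < \<delta>" "\<delta> < 1" "\<delta>1 \<le> \<delta>" "\<delta>2 \<le> \<delta>" using ex by (auto simp: \<delta>_def)
  have "R \<longlonglongrightarrow> u\<^sup>2 * 0 + 65 * \<beta> * 0 + 64 * (u * (0 + 0)) ^ 3"
    unfolding R_def by (intro tendsto_intros powr_tendsto_0) (use \<delta> ex in \<open>auto simp: field_simps\<close>)
  then have R0: "R \<longlonglongrightarrow> 0" by simp
  \<comment> \<open>sizes of the ingredients, with the common factor \<open>p powr (\<delta> - 1)\<close> extracted\<close>
  have sizes: "q / A \<le> u * real p powr (\<delta>1 - 1)" "l * real p powr (\<delta>1 - 1) \<le> q / A" "0 \<le> q / A"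
    "\<bar>\<tau>\<bar> / A \<le> u * real p powr ((\<delta>2 - 1) / 2)" "l * real p powr ((\<delta>2 - 1) / 2) \<le> \<bar>\<tau>\<bar> / A"
    "q\<^sup>2 / A\<^sup>2 + 65 * (\<beta> / real p) + 64 * ((\<bar>\<tau>\<bar> + q) / A) ^ 3 \<le> real p powr (\<delta> - 1) * R p"
    if p: "1 \<le> p" and A: "L0 * real p \<le> A" "A \<le> U0 * real p"
      and q: "L2 * real p powr \<delta>1 \<le> q" "q \<le> U2 * real p powr \<delta>1"
      and \<tau>: "L2 * real p powr ((1 + \<delta>2) / 2) \<le> \<bar>\<tau>\<bar>" "\<bar>\<tau>\<bar> \<le> U2 * real p powr ((1 + \<delta>2) / 2)"
    for p A q \<tau>
  proof -
    have rp: "0 < real p" using p by simp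
    have Apos: "0 < A" using A(1) pos rp by (meson mult_pos_pos order_less_le_trans)
    have q0: "0 \<le> q" using q(1) pos by (meson mult_nonneg_nonneg less_imp_le powr_ge_zero order_trans)
    have div: "real p powr (e - 1) = real p powr e / real p" for e
      using rp by (simp add: powr_diff)
    have up: "x / A \<le> u * real p powr (e - 1)" if "x \<le> U2 * real p powr e" "0 \<le> x" for x e
    proof -
      have "x / A \<le> (U2 * real p powr e) / (L0 * real p)"
        using that A pos rp by (intro frac_le) auto
      then show ?thesis by (simp add: u_def div)
    qed
    have lo: "l * real p powr (e - 1) \<le> x / A" if "L2 * real p powr e \<le> x" for x e
    proof -
      have "(L2 * real p powr e) / (U0 * real p) \<le> x / A"
        using that A pos Apos rp by (intro frac_le) (auto intro: order_trans[of _ "L2 * real p powr e"])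
      then show ?thesis by (simp add: l_def div)
    qed
    show 1: "q / A \<le> u * real p powr (\<delta>1 - 1)" by (rule up[OF q(2) q0])
    show "l * real p powr (\<delta>1 - 1) \<le> q / A" by (rule lo[OF q(1)])
    show nn: "0 \<le> q / A" using q0 Apos by simp
    have h: "(1 + \<delta>2) / 2 - 1 = (\<delta>2 - 1) / 2" by (simp add: field_simps)
    show 2: "\<bar>\<tau>\<bar> / A \<le> u * real p powr ((\<delta>2 - 1) / 2)" using up[OF \<tau>(2)] unfolding h by simp
    show "l * real p powr ((\<delta>2 - 1) / 2) \<le> \<bar>\<tau>\<bar> / A" using lo[OF \<tau>(1)] unfolding h .
    have a: "q\<^sup>2 / A\<^sup>2 \<le> real p powr (\<delta> - 1) * (u\<^sup>2 * real p powr (2 * \<delta>1 - 1 - \<delta>))"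
    proof -
      have "q\<^sup>2 / A\<^sup>2 = (q / A)\<^sup>2" by (simp add: power_divide)
      also have "\<dots> \<le> (u * real p powr (\<delta>1 - 1))\<^sup>2" using 1 nn by (rule power_mono)
      also have "\<dots> = real p powr (\<delta> - 1) * (u\<^sup>2 * real p powr (2 * \<delta>1 - 1 - \<delta>))"
        by (simp add: power_mult_distrib power2_eq_square powr_add[symmetric] field_simps)
      finally show ?thesis .
    qed
    have b: "65 * (\<beta> / real p) = real p powr (\<delta> - 1) * (65 * \<beta> * real p powr (- \<delta>))"
    proof -
      have "real p powr (\<delta> - 1) * real p powr (- \<delta>) = 1 / real p"
        using rp unfolding powr_add[symmetric] by (simp add: powr_minus_divide)
      then have "65 * \<beta> * (real p powr (\<delta> - 1) * real p powr (- \<delta>)) = 65 * \<beta> * (1 / real p)" by simp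
      then show ?thesis by (simp add: mult_ac)
    qed
    let ?s = "u * (real p powr ((\<delta>2 - 1) / 2 - (\<delta> - 1) / 3) + real p powr (\<delta>1 - 1 - (\<delta> - 1) / 3))"
    have c: "((\<bar>\<tau>\<bar> + q) / A) ^ 3 \<le> real p powr (\<delta> - 1) * ?s ^ 3"
    proof -
      have "(\<bar>\<tau>\<bar> + q) / A \<le> u * real p powr ((\<delta>2 - 1) / 2) + u * real p powr (\<delta>1 - 1)"
        using 1 2 by (simp add: add_divide_distrib)
      also have "\<dots> = real p powr ((\<delta> - 1) / 3) * ?s"
      proof -
        have "real p powr ((\<delta> - 1) / 3) * real p powr ((\<delta>2 - 1) / 2 - (\<delta> - 1) / 3) = real p powr ((\<delta>2 - 1) / 2)"
          "real p powr ((\<delta> - 1) / 3) * real p powr (\<delta>1 - 1 - (\<delta> - 1) / 3) = real p powr (\<delta>1 - 1)"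
          by (simp_all add: powr_add[symmetric])
        then show ?thesis by (simp only: distrib_left mult.left_commute[of _ u])
      qed
      finally have "((\<bar>\<tau>\<bar> + q) / A) ^ 3 \<le> (real p powr ((\<delta> - 1) / 3) * ?s) ^ 3"
        using q0 Apos by (intro power_mono) auto
      also have "\<dots> = real p powr (\<delta> - 1) * ?s ^ 3"
      proof -
        have "(real p powr ((\<delta> - 1) / 3)) ^ 3 = real p powr (\<delta> - 1)"
        proof -
          have "x / 3 + x / 3 + x / 3 = x" for x :: real by linarith
          from this[of "\<delta> - 1"] show ?thesis unfolding power3_eq_cube powr_add[symmetric] by (simp only:)
        qed
        then show ?thesis by (simp only: power_mult_distrib)
      qed
      finally show ?thesis .
    qed
    show "q\<^sup>2 / A\<^sup>2 + 65 * (\<beta> / real p) + 64 * ((\<bar>\<tau>\<bar> + q) / A) ^ 3 \<le> real p powr (\<delta> - 1) * R p"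
      unfolding R_def b using a c by (simp add: distrib_left)
  qed
  show ?thesis
  proof (cases "\<delta>2 < \<delta>1")
    case True
    then have d: "\<delta> = \<delta>1" by (simp add: \<delta>_def)
    define \<kappa> where "\<kappa> = l / M2"
    have \<kappa>: "0 < \<kappa>" using ul pos by (simp add: \<kappa>_def)
    have "(\<lambda>p. 2 * M1 * u\<^sup>2 * real p powr (\<delta>2 - \<delta>1) + M1 * R p) \<longlonglongrightarrow> 2 * M1 * u\<^sup>2 * 0 + M1 * 0"
      using True by (intro tendsto_intros powr_tendsto_0 R0) auto
    then have "\<forall>\<^sub>F p in sequentially. 2 * M1 * u\<^sup>2 * real p powr (\<delta>2 - \<delta>1) + M1 * R p < \<kappa>"
      using \<kappa> by (intro order_tendstoD(2)) auto
    then have ev: "\<forall>\<^sub>F p in sequentially. 1 \<le> p \<and> 2 * M1 * u\<^sup>2 * real p powr (\<delta>2 - \<delta>1) + M1 * R p < \<kappa>"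
      using eventually_ge_at_top[of 1] by eventually_elim auto
    show ?thesis
    proof (intro exI[of _ \<kappa>] conjI \<kappa>, rule eventually_mono[OF ev], intro allI impI)
      fix p and F A q \<tau> c1 c2 D :: real
      assume p: "1 \<le> p \<and> 2 * M1 * u\<^sup>2 * real p powr (\<delta>2 - \<delta>1) + M1 * R p < \<kappa>" and F: "0 < F"
        and A: "L0 * real p \<le> A" "A \<le> U0 * real p"
        and q: "L2 * real p powr \<delta>1 \<le> q" "q \<le> U2 * real p powr \<delta>1"
        and \<tau>: "L2 * real p powr ((1 + \<delta>2) / 2) \<le> \<bar>\<tau>\<bar>" "\<bar>\<tau>\<bar> \<le> U2 * real p powr ((1 + \<delta>2) / 2)"
        and c: "\<bar>c1\<bar> \<le> M1 * F" "\<bar>c2\<bar> \<le> M1 * F" "F \<le> M2 * \<bar>c1\<bar>" "F \<le> M2 * \<bar>c2\<bar>"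
        and D: "\<bar>D - (2 * c1 * q / A - 2 * c2 * \<tau>\<^sup>2 / A\<^sup>2)\<bar>
          \<le> M1 * F * (q\<^sup>2 / A\<^sup>2 + 65 * (\<beta> / real p) + 64 * ((\<bar>\<tau>\<bar> + q) / A) ^ 3)"
      let ?P = "real p powr (\<delta> - 1)"
      note s = sizes[OF conjunct1[OF p] A q \<tau>]
      have big: "2 * (\<kappa> * F * ?P) \<le> \<bar>2 * c1 * q / A\<bar>"
      proof -
        have "F / M2 \<le> \<bar>c1\<bar>" using c(3) pos by (simp add: divide_le_eq mult.commute)
        then have "(F / M2) * (l * ?P) \<le> \<bar>c1\<bar> * (q / A)"
          using s(2) F pos ul unfolding d by (intro mult_mono) auto
        moreover have "2 * (\<kappa> * F * ?P) = 2 * ((F / M2) * (l * ?P))" by (simp add: \<kappa>_def)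
        moreover have "\<bar>2 * c1 * q / A\<bar> = 2 * (\<bar>c1\<bar> * \<bar>q / A\<bar>)" by (simp add: abs_mult abs_divide)
        ultimately show ?thesis unfolding abs_of_nonneg[OF s(3)] by linarith
      qed
      have small: "\<bar>2 * c2 * \<tau>\<^sup>2 / A\<^sup>2\<bar> \<le> F * ?P * (2 * M1 * u\<^sup>2 * real p powr (\<delta>2 - \<delta>1))"
      proof -
        have "\<tau>\<^sup>2 / A\<^sup>2 = (\<bar>\<tau>\<bar> / A)\<^sup>2" by (simp add: power_divide)
        also have "\<dots> \<le> (u * real p powr ((\<delta>2 - 1) / 2))\<^sup>2"
          using s(4,5) ul by (intro power_mono) (auto intro: order_trans[rotated])
        also have "\<dots> = ?P * (u\<^sup>2 * real p powr (\<delta>2 - \<delta>1))"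
          unfolding d by (simp add: power_mult_distrib power2_eq_square powr_add[symmetric])
        finally have "2 * \<bar>c2\<bar> * (\<tau>\<^sup>2 / A\<^sup>2) \<le> 2 * (M1 * F) * (?P * (u\<^sup>2 * real p powr (\<delta>2 - \<delta>1)))"
          using c(2) pos F by (intro mult_mono) auto
        then show ?thesis by (simp add: abs_mult abs_divide mult_ac)
      qed
      have rest: "M1 * F * (q\<^sup>2 / A\<^sup>2 + 65 * (\<beta> / real p) + 64 * ((\<bar>\<tau>\<bar> + q) / A) ^ 3) \<le> F * ?P * (M1 * R p)"
        using mult_left_mono[OF s(6), of "M1 * F"] pos F by (simp add: mult_ac)
      have sum: "F * ?P * (2 * M1 * u\<^sup>2 * real p powr (\<delta>2 - \<delta>1)) + F * ?P * (M1 * R p) \<le> \<kappa> * F * ?P"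
        using mult_left_mono[OF less_imp_le[OF conjunct2[OF p]], of "F * ?P"] F by (simp add: algebra_simps)
      show "\<kappa> * F * ?P \<le> \<bar>D\<bar>"
        using big small by (intro dominant_term_bound[OF D rest sum]) blast
    qed
  next
    case False
    then have lt: "\<delta>1 < \<delta>2" using ex by simp
    then have d: "\<delta> = \<delta>2" by (simp add: \<delta>_def)
    define \<kappa> where "\<kappa> = l\<^sup>2 / M2"
    have \<kappa>: "0 < \<kappa>" using ul pos by (simp add: \<kappa>_def)
    have "(\<lambda>p. 2 * M1 * u * real p powr (\<delta>1 - \<delta>2) + M1 * R p) \<longlonglongrightarrow> 2 * M1 * u * 0 + M1 * 0"
      using lt by (intro tendsto_intros powr_tendsto_0 R0) auto
    then have "\<forall>\<^sub>F p in sequentially. 2 * M1 * u * real p powr (\<delta>1 - \<delta>2) + M1 * R p < \<kappa>"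
      using \<kappa> by (intro order_tendstoD(2)) auto
    then have ev: "\<forall>\<^sub>F p in sequentially. 1 \<le> p \<and> 2 * M1 * u * real p powr (\<delta>1 - \<delta>2) + M1 * R p < \<kappa>"
      using eventually_ge_at_top[of 1] by eventually_elim auto
    show ?thesis
    proof (intro exI[of _ \<kappa>] conjI \<kappa>, rule eventually_mono[OF ev], intro allI impI)
      fix p and F A q \<tau> c1 c2 D :: real
      assume p: "1 \<le> p \<and> 2 * M1 * u * real p powr (\<delta>1 - \<delta>2) + M1 * R p < \<kappa>" and F: "0 < F"
        and A: "L0 * real p \<le> A" "A \<le> U0 * real p"
        and q: "L2 * real p powr \<delta>1 \<le> q" "q \<le> U2 * real p powr \<delta>1"
        and \<tau>: "L2 * real p powr ((1 + \<delta>2) / 2) \<le> \<bar>\<tau>\<bar>" "\<bar>\<tau>\<bar> \<le> U2 * real p powr ((1 + \<delta>2) / 2)"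
        and c: "\<bar>c1\<bar> \<le> M1 * F" "\<bar>c2\<bar> \<le> M1 * F" "F \<le> M2 * \<bar>c1\<bar>" "F \<le> M2 * \<bar>c2\<bar>"
        and D: "\<bar>D - (2 * c1 * q / A - 2 * c2 * \<tau>\<^sup>2 / A\<^sup>2)\<bar>
          \<le> M1 * F * (q\<^sup>2 / A\<^sup>2 + 65 * (\<beta> / real p) + 64 * ((\<bar>\<tau>\<bar> + q) / A) ^ 3)"
      let ?P = "real p powr (\<delta> - 1)"
      note s = sizes[OF conjunct1[OF p] A q \<tau>]
      have big: "2 * (\<kappa> * F * ?P) \<le> \<bar>2 * c2 * \<tau>\<^sup>2 / A\<^sup>2\<bar>"
      proof -
        have "l\<^sup>2 * ?P = (l * real p powr ((\<delta>2 - 1) / 2))\<^sup>2"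
          unfolding d by (simp add: power_mult_distrib power2_eq_square powr_add[symmetric])
        also have "\<dots> \<le> (\<bar>\<tau>\<bar> / A)\<^sup>2"
          using s(5) ul by (intro power_mono) auto
        also have "\<dots> = \<tau>\<^sup>2 / A\<^sup>2" by (simp add: power_divide)
        finally have lo: "l\<^sup>2 * ?P \<le> \<tau>\<^sup>2 / A\<^sup>2" .
        have "F / M2 \<le> \<bar>c2\<bar>" using c(4) pos by (simp add: divide_le_eq mult.commute)
        then have "(F / M2) * (l\<^sup>2 * ?P) \<le> \<bar>c2\<bar> * (\<tau>\<^sup>2 / A\<^sup>2)"
          using lo F pos by (intro mult_mono) auto
        moreover have "2 * (\<kappa> * F * ?P) = 2 * ((F / M2) * (l\<^sup>2 * ?P))" by (simp add: \<kappa>_def)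
        moreover have "\<bar>2 * c2 * \<tau>\<^sup>2 / A\<^sup>2\<bar> = 2 * (\<bar>c2\<bar> * (\<tau>\<^sup>2 / A\<^sup>2))" by (simp add: abs_mult abs_divide)
        ultimately show ?thesis by linarith
      qed
      have small: "\<bar>2 * c1 * q / A\<bar> \<le> F * ?P * (2 * M1 * u * real p powr (\<delta>1 - \<delta>2))"
      proof -
        have "real p powr (\<delta>1 - 1) = ?P * real p powr (\<delta>1 - \<delta>2)"
          unfolding d by (simp add: powr_add[symmetric])
        then have "\<bar>q / A\<bar> \<le> u * (?P * real p powr (\<delta>1 - \<delta>2))"
          using s(1,3) by simp
        then have "2 * \<bar>c1\<bar> * \<bar>q / A\<bar> \<le> 2 * (M1 * F) * (u * (?P * real p powr (\<delta>1 - \<delta>2)))"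
          using c(1) pos F by (intro mult_mono) auto
        then show ?thesis by (simp add: abs_mult abs_divide mult_ac)
      qed
      have rest: "M1 * F * (q\<^sup>2 / A\<^sup>2 + 65 * (\<beta> / real p) + 64 * ((\<bar>\<tau>\<bar> + q) / A) ^ 3) \<le> F * ?P * (M1 * R p)"
        using mult_left_mono[OF s(6), of "M1 * F"] pos F by (simp add: mult_ac)
      have sum: "F * ?P * (2 * M1 * u * real p powr (\<delta>1 - \<delta>2)) + F * ?P * (M1 * R p) \<le> \<kappa> * F * ?P"
        using mult_left_mono[OF less_imp_le[OF conjunct2[OF p]], of "F * ?P"] F by (simp add: algebra_simps)
      show "\<kappa> * F * ?P \<le> \<bar>D\<bar>"
        using big small by (intro dominant_term_bound[OF D rest sum]) blast
    qed
  qed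
qed

text \<open>
  Each summand is of smaller or equal order: \<open>2 (\<delta>1 - 1) \<le> \<delta> - 1\<close>, \<open>\<delta>2 - 1 \<le> \<delta> - 1\<close> and \<open>-1 \<le> \<delta> - 1\<close>.
\<close>
lemma noise_upper_bound:
  fixes L0 U2 \<beta> \<delta>1 \<delta>2 :: real
  assumes pos: "0 < L0" "0 < U2" "0 \<le> \<beta>" and ex: "0 \<le> \<delta>1" "\<delta>1 < 1" "\<delta>2 < 1" "0 < max \<delta>1 \<delta>2"
    and p: "1 \<le> p" and A: "L0 * real p \<le> A"
    and q: "0 \<le> q" "q \<le> U2 * real p powr \<delta>1" and \<tau>: "\<bar>\<tau>\<bar> \<le> U2 * real p powr ((1 + \<delta>2) / 2)"
  shows "((\<bar>\<tau>\<bar> + q) / A)\<^sup>2 + \<beta> / real p \<le> (4 * (U2 / L0)\<^sup>2 + \<beta>) * real p powr (max \<delta>1 \<delta>2 - 1)"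
proof -
  let ?\<delta> = "max \<delta>1 \<delta>2" and ?u = "U2 / L0"
  have rp: "1 \<le> real p" using p by simp
  have up: "x / A \<le> ?u * real p powr ((?\<delta> - 1) / 2)"
    if "x \<le> U2 * real p powr e" "0 \<le> x" "e - 1 \<le> (?\<delta> - 1) / 2" for x e
  proof -
    have "x / A \<le> (U2 * real p powr e) / (L0 * real p)"
      using that A pos rp by (intro frac_le) auto
    also have "\<dots> = ?u * real p powr (e - 1)" using rp by (simp add: powr_diff)
    also have "\<dots> \<le> ?u * real p powr ((?\<delta> - 1) / 2)"
      using that(3) rp pos by (intro mult_left_mono powr_mono) auto
    finally show ?thesis .
  qed
  have Apos: "0 < A" using A pos rp by (smt (verit) mult_pos_pos)
  have "q / A \<le> ?u * real p powr ((?\<delta> - 1) / 2)"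
    using q ex by (intro up) (auto simp: max_def field_simps)
  moreover have "\<bar>\<tau>\<bar> / A \<le> ?u * real p powr ((?\<delta> - 1) / 2)"
    using \<tau> by (intro up) (auto simp: field_simps)
  ultimately have "(\<bar>\<tau>\<bar> + q) / A \<le> 2 * ?u * real p powr ((?\<delta> - 1) / 2)"
    by (simp add: add_divide_distrib)
  then have "((\<bar>\<tau>\<bar> + q) / A)\<^sup>2 \<le> (2 * ?u * real p powr ((?\<delta> - 1) / 2))\<^sup>2"
    using q Apos by (intro power_mono) auto
  also have "\<dots> = 4 * ?u\<^sup>2 * real p powr (?\<delta> - 1)"
    by (simp add: power_mult_distrib power_divide) (simp add: power2_eq_square powr_add[symmetric])
  finally have 1: "((\<bar>\<tau>\<bar> + q) / A)\<^sup>2 \<le> 4 * ?u\<^sup>2 * real p powr (?\<delta> - 1)" .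
  have "real p powr (-1) \<le> real p powr (?\<delta> - 1)"
    using rp ex by (intro powr_mono) auto
  then have "1 / real p \<le> real p powr (?\<delta> - 1)" using rp by (simp add: powr_minus_divide)
  then have "\<beta> * (1 / real p) \<le> \<beta> * real p powr (?\<delta> - 1)" using pos(3) by (rule mult_left_mono)
  then show ?thesis using 1 by (simp add: algebra_simps)
qed

text \<open>
  The condition on \<open>p\<close> eventually gives \<open>p powr (1 - \<delta>) \<le> N powr \<theta>\<close> with \<open>\<theta> = 1/2\<close> if \<open>\<delta> \<ge> 1/2\<close> and
  \<open>\<theta> = 1 - \<delta>\<close> otherwise, so \<open>\<theta> < 1\<close> in both cases.
\<close>
lemma growth_limit:
  fixes \<delta> :: real and ps Ns :: "nat \<Rightarrow> nat"
  assumes \<delta>: "0 < \<delta>" "\<delta> < 1"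
    and growth: "(\<lambda>t. real (ps t)) \<in> o(\<lambda>t. real (Ns t) powr (1 / (2 - 2 * max \<delta> (1/2))))"
    and N: "filterlim Ns at_top sequentially"
  shows "(\<lambda>t. real (ps t) powr (1 - \<delta>) / real (Ns t)) \<longlonglongrightarrow> 0"
proof -
  define e where "e = 1 / (2 - 2 * max \<delta> (1/2))"
  define \<theta> where "\<theta> = e * (1 - \<delta>)"
  have \<theta>: "\<theta> < 1"
    unfolding \<theta>_def e_def using \<delta> by (auto simp: max_def field_simps)
  have "\<forall>\<^sub>F t in sequentially. norm (real (ps t)) \<le> 1 * norm (real (Ns t) powr e)"
    using landau_o.smallD[OF growth, of 1] unfolding e_def by simp
  moreover have "\<forall>\<^sub>F t in sequentially. 1 \<le> Ns t"
    using N by (rule filterlim_at_top[THEN iffD1, rule_format])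
  ultimately have le: "\<forall>\<^sub>F t in sequentially. real (ps t) powr (1 - \<delta>) / real (Ns t) \<le> real (Ns t) powr (\<theta> - 1)"
  proof eventually_elim
    case (elim t)
    have "real (ps t) powr (1 - \<delta>) \<le> (real (Ns t) powr e) powr (1 - \<delta>)"
      using elim \<delta> by (intro powr_mono2) auto
    also have "\<dots> = real (Ns t) powr \<theta>" by (simp add: powr_powr \<theta>_def)
    finally have "real (ps t) powr (1 - \<delta>) / real (Ns t) \<le> real (Ns t) powr \<theta> / real (Ns t)"
      by (intro divide_right_mono) auto
    also have "\<dots> = real (Ns t) powr (\<theta> - 1)" using elim by (simp add: powr_diff)
    finally show ?case .
  qed
  have "(\<lambda>t. real (Ns t) powr (\<theta> - 1)) \<longlonglongrightarrow> 0"
    using \<theta> by (intro tendsto_neg_powr filterlim_compose[OF filterlim_real_sequentially N]) auto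
  then show ?thesis
    by (intro tendsto_sandwich[OF _ le tendsto_const]) auto
qed

text \<open>
  The scale \<open>F\<close> of the kernel cancels, which makes the final bound uniform over kernels.
\<close>
lemma noise_signal_ratio:
  fixes F \<kappa> P x H D N :: real
  assumes "0 < F" "0 < \<kappa>" "0 < P" "0 \<le> x" and x: "x \<le> H * P" and D: "\<kappa> * F * P \<le> D"
  shows "((N * F)\<^sup>2 * x) / D\<^sup>2 \<le> N\<^sup>2 * H / \<kappa>\<^sup>2 * (1 / P)"
proof -
  have pos: "0 < \<kappa> * F * P" using assms by simp
  have "((N * F)\<^sup>2 * x) / D\<^sup>2 \<le> ((N * F)\<^sup>2 * (H * P)) / (\<kappa> * F * P)\<^sup>2"
  proof (rule frac_le)
    show "(N * F)\<^sup>2 * x \<le> (N * F)\<^sup>2 * (H * P)" using x by (rule mult_left_mono) simp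
    show "(\<kappa> * F * P)\<^sup>2 \<le> D\<^sup>2" using D pos by (intro power_mono) auto
    show "0 \<le> (N * F)\<^sup>2 * (H * P)" using order_trans[OF assms(4) x] by (rule mult_nonneg_nonneg[OF zero_le_power2])
  qed (use pos in \<open>simp only: zero_less_power\<close>)
  also have "\<dots> = N\<^sup>2 * H / \<kappa>\<^sup>2 * (1 / P)"
    using assms by (simp add: power_mult_distrib power2_eq_square)
  finally show ?thesis .
qed

lemma c_coeff_le:
  fixes n m :: nat and r :: real
  assumes r: "0 < r" and n: "r * real (n + m) \<le> real n" and m: "r * real (n + m) \<le> real m"
    and nm: "2 \<le> n" "2 \<le> m"
  shows "c_coeff n m \<le> 12 / r\<^sup>2 / (real (n + m))\<^sup>2"
proof -
  let ?x = "r * real (n + m)"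
  have x: "0 < ?x" using r nm by (intro mult_pos_pos) auto
  have sq: "?x\<^sup>2 / 2 \<le> real q * (real q - 1)" if "?x \<le> real q" "2 \<le> q" for q
  proof -
    have "?x\<^sup>2 \<le> real q * real q" unfolding power2_eq_square using that x by (intro mult_mono) auto
    also have "\<dots> \<le> real q * (2 * (real q - 1))" using that by (intro mult_left_mono) auto
    finally show ?thesis by (simp add: algebra_simps)
  qed
  have a: "2 / (real n * (real n - 1)) \<le> 2 / (?x\<^sup>2 / 2)"
    using sq[OF n nm(1)] x by (intro divide_left_mono mult_pos_pos) (use nm in auto)
  have b: "2 / (real m * (real m - 1)) \<le> 2 / (?x\<^sup>2 / 2)"
    using sq[OF m nm(2)] x by (intro divide_left_mono mult_pos_pos) (use nm in auto)
  have "?x\<^sup>2 \<le> real n * real m" unfolding power2_eq_square using n m x by (intro mult_mono) auto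
  then have c: "4 / (real n * real m) \<le> 4 / ?x\<^sup>2"
    using x by (intro divide_left_mono mult_pos_pos) (use nm in auto)
  have "c_coeff n m \<le> 12 / ?x\<^sup>2"
    using a b c unfolding c_coeff_def by simp
  then show ?thesis by (simp add: power_mult_distrib)
qed

text \<open>
  Both samples make up a positive fraction of the pooled sample, at least \<open>r\<close> eventually, so
  \<open>c_coeff n m\<close> is \<open>O(1/N\<^sup>2)\<close> and the failure probability is \<open>O(p powr (1 - \<delta>) / N)\<close>.
\<close>
lemma power_tendsto_one:
  fixes \<pi> :: "nat \<Rightarrow> nat \<Rightarrow> nat \<Rightarrow> real" and ps ns ms :: "nat \<Rightarrow> nat" and \<rho> \<delta> C G :: real
  assumes rho: "0 < \<rho>" "\<rho> < 1" and \<delta>: "0 < \<delta>" "\<delta> < 1" and G0: "0 \<le> G"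
    and limits: "filterlim ns at_top sequentially" "filterlim ms at_top sequentially"
          "filterlim ps at_top sequentially"
    and balance: "(\<lambda>t. real (ns t) / real (ns t + ms t) - \<rho>) \<in> O(\<lambda>t. 1 / real (ns t + ms t))"
    and growth: "(\<lambda>t. real (ps t)) \<in> o(\<lambda>t. real (ns t + ms t) powr (1 / (2 - 2 * max \<delta> (1/2))))"
    and lower: "\<forall>\<^sub>F p in sequentially. \<forall>n m. 2 \<le> n \<longrightarrow> 2 \<le> m \<longrightarrow>
      1 - (48 * real (n + m) + 12 * C\<^sup>2) * c_coeff n m * (G * real p powr (1 - \<delta>)) \<le> \<pi> p n m"
    and upper: "\<forall>\<^sub>F p in sequentially. \<forall>n m. \<pi> p n m \<le> 1"
  shows "(\<lambda>t. \<pi> (ps t) (ns t) (ms t)) \<longlonglongrightarrow> 1"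
proof -
  define Ns where "Ns t = ns t + ms t" for t
  have Ns: "filterlim Ns at_top sequentially"
    unfolding Ns_def by (rule filterlim_at_top_mono[OF limits(1)]) simp
  define r where "r = min \<rho> (1 - \<rho>) / 2"
  have r: "0 < r" using rho by (simp add: r_def)
  have "2 * r = min \<rho> (1 - \<rho>)" by (simp add: r_def)
  then have r2: "2 * r \<le> \<rho>" "2 * r \<le> 1 - \<rho>" by (simp_all only: min.cobounded1 min.cobounded2)
  have N2ev: "\<forall>\<^sub>F t in sequentially. 2 \<le> ns t" "\<forall>\<^sub>F t in sequentially. 2 \<le> ms t"
    using limits(1,2) by (auto simp: filterlim_at_top)
  have bal: "\<forall>\<^sub>F t in sequentially. r * real (Ns t) \<le> real (ns t) \<and> r * real (Ns t) \<le> real (ms t)"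
  proof -
    have "(\<lambda>t. real (ns t) / real (Ns t) - \<rho>) \<longlonglongrightarrow> 0"
    proof -
      have "(\<lambda>t. 1 / real (Ns t)) \<longlonglongrightarrow> 0"
        by (rule filterlim_compose[OF lim_inverse_n'[unfolded inverse_eq_divide] Ns])
      then have "(\<lambda>t. 1 / real (Ns t)) \<in> o(\<lambda>_. 1)"
        by (intro smalloI_tendsto) auto
      from landau_o.big_small_trans[OF balance[folded Ns_def] this] show ?thesis
        using smalloD_tendsto by force
    qed
    then have "\<forall>\<^sub>F t in sequentially. \<bar>real (ns t) / real (Ns t) - \<rho>\<bar> < r"
      using r by (auto simp: tendsto_iff dist_real_def)
    then show ?thesis using N2ev
    proof eventually_elim
      case (elim t)
      have N: "0 < real (Ns t)" using elim by (simp add: Ns_def)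
      have "r \<le> real (ns t) / real (Ns t)" "real (ns t) / real (Ns t) \<le> 1 - r"
        using elim(1) r2 r by linarith+
      then have "r * real (Ns t) \<le> real (ns t)" "real (ns t) \<le> (1 - r) * real (Ns t)"
        using N by (simp_all add: field_simps)
      then show ?case by (simp add: Ns_def algebra_simps)
    qed
  qed
  define err where "err t = (48 + 12 * C\<^sup>2) * (12 / r\<^sup>2) * G * (real (ps t) powr (1 - \<delta>) / real (Ns t))" for t
  have err: "err \<longlonglongrightarrow> 0"
    unfolding err_def using growth_limit[OF \<delta> growth[folded Ns_def] Ns]
    by (rule tendsto_mult_right_zero)
  have lo: "\<forall>\<^sub>F t in sequentially. 1 - err t \<le> \<pi> (ps t) (ns t) (ms t)"
    using bal N2ev eventually_compose_filterlim[OF lower limits(3)]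
  proof eventually_elim
    case (elim t)
    let ?N = "real (Ns t)"
    have N: "1 \<le> ?N" using elim(2) by (simp add: Ns_def)
    have c: "c_coeff (ns t) (ms t) \<le> 12 / r\<^sup>2 / ?N\<^sup>2"
      unfolding Ns_def using elim(1-3) r by (intro c_coeff_le) (simp_all add: Ns_def)
    have "(48 * ?N + 12 * C\<^sup>2) * c_coeff (ns t) (ms t) \<le> ((48 + 12 * C\<^sup>2) * ?N) * (12 / r\<^sup>2 / ?N\<^sup>2)"
    proof (rule mult_mono[OF _ c])
      have "12 * C\<^sup>2 * 1 \<le> 12 * C\<^sup>2 * ?N" using N by (intro mult_left_mono) auto
      then show "48 * ?N + 12 * C\<^sup>2 \<le> (48 + 12 * C\<^sup>2) * ?N" by (simp add: distrib_right)
      show "0 \<le> (48 + 12 * C\<^sup>2) * ?N" using N by simp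
      show "0 \<le> c_coeff (ns t) (ms t)" unfolding c_coeff_def using elim(2,3) by simp
    qed
    then have "(48 * ?N + 12 * C\<^sup>2) * c_coeff (ns t) (ms t) * (G * real (ps t) powr (1 - \<delta>))
        \<le> ((48 + 12 * C\<^sup>2) * ?N) * (12 / r\<^sup>2 / ?N\<^sup>2) * (G * real (ps t) powr (1 - \<delta>))"
      using G0 by (intro mult_right_mono) auto
    also have "\<dots> = err t" using N by (simp add: err_def power2_eq_square)
    finally have "1 - err t \<le> 1 - (48 * ?N + 12 * C\<^sup>2) * c_coeff (ns t) (ms t) * (G * real (ps t) powr (1 - \<delta>))"
      by (rule diff_left_mono)
    also have "\<dots> \<le> \<pi> (ps t) (ns t) (ms t)"
      unfolding Ns_def by (rule elim(4)[rule_format, OF elim(2,3)])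
    finally show ?case .
  qed
  have up: "\<forall>\<^sub>F t in sequentially. \<pi> (ps t) (ns t) (ms t) \<le> 1"
    using eventually_compose_filterlim[OF upper limits(3)] by eventually_elim simp
  have lim: "(\<lambda>t. 1 - err t) \<longlonglongrightarrow> 1"
    using tendsto_diff[OF tendsto_const err, of 1] by simp
  show ?thesis
    by (rule tendsto_sandwich[OF lo up lim tendsto_const])
qed

section \<open>Consistency of the test\<close>

lemma banded_law_distr:
  assumes M: "prob_space M" and U: "U \<in> measurable M (rspace p)"
    and lag: "lag_independent p M U a"
    and moment: "\<And>j. j \<in> {1..p} \<Longrightarrow> integrable M (\<lambda>\<omega>. \<bar>U \<omega> j\<bar> ^ 4) \<and> (\<integral>\<omega>. \<bar>U \<omega> j\<bar> ^ 4 \<partial>M) \<le> b"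
  shows "banded_law (distr M (rspace p) U) p a b"
proof -
  interpret prob_space M by fact
  have cm: "(\<lambda>x. x j) \<in> borel_measurable (rspace p)" if "j \<in> {1..p}" for j
    using that unfolding rspace_def by (rule measurable_component_singleton)
  have c4: "(\<lambda>x. x j ^ 4 :: real) \<in> borel_measurable (rspace p)" if "j \<in> {1..p}" for j
    using cm[OF that] by simp
  interpret D: prob_space "distr M (rspace p) U" by (rule prob_space_distr[OF U])
  show ?thesis
  proof
    show "sets (distr M (rspace p) U) = sets (rspace p)" by simp
    fix j assume j: "j \<in> {1..p}"
    show "integrable (distr M (rspace p) U) (\<lambda>x. x j ^ 4)"
      using moment[OF j] by (subst integrable_distr_eq[OF U c4[OF j]]) simp
    show "(\<integral>x. x j ^ 4 \<partial>distr M (rspace p) U) \<le> b"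
      using moment[OF j] by (subst integral_distr[OF U c4[OF j]]) simp
  next
    fix i j assume ij: "i \<in> {1..p}" "j \<in> {1..p}" "i + a < j"
    have "indep_var (Pi\<^sub>M {1..i} (\<lambda>_. borel)) (\<lambda>\<omega>. restrict (U \<omega>) {1..i})
        (Pi\<^sub>M {i + (j - i)..p} (\<lambda>_. borel)) (\<lambda>\<omega>. restrict (U \<omega>) {i + (j - i)..p})"
      using lag[unfolded lag_independent_def, rule_format, of i "j - i"] ij by simp
    then have "indep_var borel ((\<lambda>g. g i) \<circ> (\<lambda>\<omega>. restrict (U \<omega>) {1..i}))
        borel ((\<lambda>g. g j) \<circ> (\<lambda>\<omega>. restrict (U \<omega>) {i + (j - i)..p}))"
      by (rule indep_var_compose) (use ij in \<open>auto intro!: measurable_component_singleton\<close>)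
    then have "indep_var borel (\<lambda>\<omega>. U \<omega> i) borel (\<lambda>\<omega>. U \<omega> j)"
      using ij by (simp add: comp_def)
    then show "D.indep_var borel (\<lambda>x. x i) borel (\<lambda>x. x j)"
      by (rule indep_var_distr[OF U cm[OF ij(1)] cm[OF ij(2)]])
  qed
qed

lemma mean_vec_distr:
  assumes "U \<in> measurable M (rspace p)" "j \<in> {1..p}"
  shows "mean_vec M U j = coord_mean (distr M (rspace p) U) j"
proof -
  have "(\<lambda>x. x j) \<in> borel_measurable (rspace p)"
    using assms(2) unfolding rspace_def by (rule measurable_component_singleton)
  then show ?thesis
    unfolding mean_vec_def coord_mean_def by (subst integral_distr[OF assms(1)]) auto
qed

lemma centered_sq_norm_distr:
  assumes U: "U \<in> measurable M (rspace p)" and law: "banded_law (distr M (rspace p) U) p a b"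
  shows "centered_sq_norm p M U = total_variance p (distr M (rspace p) U)"
proof -
  let ?P = "distr M (rspace p) U"
  interpret banded_law ?P p a b by fact
  have int: "integrable ?P (\<lambda>x. (x j - coord_mean ?P j)\<^sup>2)" if "j \<in> {1..p}" for j
    unfolding power2_diff using coord_integrable[OF that, of 2] coord_integrable1[OF that] by auto
  have "centered_sq_norm p M U = (\<integral>\<omega>. (\<Sum>j\<in>{1..p}. (U \<omega> j - coord_mean ?P j)\<^sup>2) \<partial>M)"
    unfolding centered_sq_norm_def enorm_def L2_set_def
    by (intro Bochner_Integration.integral_cong refl) (auto simp: sum_nonneg mean_vec_distr[OF U] intro!: sum.cong)
  also have "\<dots> = (\<integral>x. (\<Sum>j\<in>{1..p}. (x j - coord_mean ?P j)\<^sup>2) \<partial>?P)"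
  proof (subst integral_distr[OF U])
    have "(\<lambda>x. x j) \<in> borel_measurable (rspace p)" if "j \<in> {1..p}" for j
      using that unfolding rspace_def by (rule measurable_component_singleton)
    then show "(\<lambda>x. \<Sum>j\<in>{1..p}. (x j - coord_mean ?P j)\<^sup>2) \<in> borel_measurable (rspace p)"
      by (intro borel_measurable_sum borel_measurable_power borel_measurable_diff) auto
  qed simp
  also have "\<dots> = total_variance p ?P"
    unfolding total_variance_def by (intro Bochner_Integration.integral_sum int)
  finally show ?thesis .
qed

text \<open>
  This collects all that is needed in a single dimension. Expanding around the mean distance of
  an \<open>X\<close> and a \<open>Y\<close>, rather than that of two copies of \<open>Z\<close>, has the advantage that \<open>u\<close> has mean zero for
  mixed pairs. The second part holds since \<open>B = 0\<close> would make the kernel constant and the energy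
  distance zero, although \<open>\<tau> \<noteq> 0\<close> shows that the two laws differ.
\<close>
lemma fixed_dimension_power:
  fixes M :: "'a measure"
  assumes p: "1 \<le> p"
    and model: "sampling_model p M \<rho> X Y Xs Ys Zs"
    and kernel: "is_kernel p k"
    and rep: "radial_representation p k D f"
    and A_def: "A = mean_sq_dist p M (Xs 1) (Ys 1)" and A: "0 < A"
    and s0: "sqrt A \<in> D"
    and taylor: "\<forall>s\<in>D. \<exists>\<xi>\<in>closed_segment s (sqrt A).
          f 0 s = (\<Sum>i=0..6. 1 / fact i * f i (sqrt A) * (s - sqrt A) ^ i) + 1 / fact 7 * f 7 \<xi> * (s - sqrt A) ^ 7"
    and bound: "\<forall>i\<in>{1..7}. \<forall>z\<in>D. \<bar>f i z\<bar> * \<bar>sqrt A ^ i\<bar> \<le> B"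
    and lag: "lag_independent p M X a" "lag_independent p M Y a"
    and moment: "\<forall>j\<in>{1..p}. \<forall>V\<in>{X, Y}.
        integrable M (\<lambda>\<omega>. \<bar>V \<omega> j\<bar> ^ 4) \<and> (\<integral>\<omega>. \<bar>V \<omega> j\<bar> ^ 4 \<partial>M) \<le> b"
    and \<beta>: "real p * real (2 * a + 1) * (16 * b) / A\<^sup>2 \<le> \<beta>"
    and q_def: "q = (enorm p (\<lambda>i. mean_vec M X i - mean_vec M Y i))\<^sup>2"
    and \<tau>_def: "\<tau> = centered_sq_norm p M (Xs 1) - centered_sq_norm p M (Ys 1)"
    and \<tau>: "\<tau> \<noteq> 0"
    and c1_def: "c1 = 1/2 * f 1 (sqrt A) * sqrt A"
    and c2_def: "c2 = - (1/8) * f 1 (sqrt A) * sqrt A + 1/8 * f 2 (sqrt A) * (sqrt A)\<^sup>2"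
  shows "\<exists>\<D>>0. \<bar>\<D> - (2 * c1 * q / A - 2 * c2 * \<tau>\<^sup>2 / A\<^sup>2)\<bar>
            \<le> B * (q\<^sup>2 / A\<^sup>2 + 65 * \<beta> + 64 * ((\<bar>\<tau>\<bar> + q) / A) ^ 3) \<and>
          (\<forall>n m C. 2 \<le> n \<longrightarrow> 2 \<le> m \<longrightarrow> 0 < C \<longrightarrow>
            1 - (48 * real (n + m) + 12 * C\<^sup>2) * c_coeff n m * (B\<^sup>2 * (((\<bar>\<tau>\<bar> + q) / A)\<^sup>2 + \<beta>)) / \<D>\<^sup>2
            \<le> measure M {\<omega> \<in> space M. C < test_stat p k n m (\<lambda>i. Xs i \<omega>) (\<lambda>j. Ys j \<omega>)})"
    and "B = 0 \<Longrightarrow> False"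
proof -
  let ?P = "distr M (rspace p) X" and ?Q = "distr M (rspace p) Y"
  have M: "prob_space M" and X: "X \<in> measurable M (rspace p)" and Y: "Y \<in> measurable M (rspace p)"
    using model unfolding sampling_model_def by auto
  interpret two_sample M p Xs Ys ?P ?Q
    using model M unfolding sampling_model_def two_sample_def two_sample_axioms_def by auto
  have bP: "banded_law ?P p a b" and bQ: "banded_law ?Q p a b"
    using banded_law_distr[OF M X lag(1)] banded_law_distr[OF M Y lag(2)] moment by auto
  have i1: "Inl 1 \<in> ({1..} <+> {1..} :: (nat + nat) set)" "Inr 1 \<in> ({1..} <+> {1..} :: (nat + nat) set)"
    by auto
  have X1: "Xs 1 \<in> measurable M (rspace p)" and Y1: "Ys 1 \<in> measurable M (rspace p)"
    using W_measurable[OF i1(1)] W_measurable[OF i1(2)] by (simp_all add: W_def)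
  have em: "case_prod (\<lambda>x y. (edist p x y)\<^sup>2) \<in> borel_measurable (rspace p \<Otimes>\<^sub>M rspace p)"
    using borel_measurable_power[OF edist_measurable, of p 2] by (simp add: case_prod_beta')
  have A': "A = (\<integral>z. (edist p (fst z) (snd z))\<^sup>2 \<partial>(?P \<Otimes>\<^sub>M ?Q))"
    unfolding A_def mean_sq_dist_def
    using pair_expectation(2)[OF i1 _ em] by (simp add: W_def law_def case_prod_beta')
  have \<tau>': "\<tau> = total_variance p ?P - total_variance p ?Q"
    unfolding \<tau>_def using centered_sq_norm_distr[OF X1] centered_sq_norm_distr[OF Y1] bP bQ
    by (simp add: law_X law_Y)
  have q': "q = (\<Sum>j\<in>{1..p}. (coord_mean ?P j - coord_mean ?Q j)\<^sup>2)"
    unfolding q_def enorm_def L2_set_def using mean_vec_distr[OF X] mean_vec_distr[OF Y]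
    by (simp add: sum_nonneg)
  have sA: "0 < sqrt A" "(sqrt A)\<^sup>2 = A" using A by auto
  have taylor': "\<exists>\<xi>\<in>closed_segment z (sqrt A). f 0 z = (\<Sum>i=0..6. 1 / fact i * f i (sqrt A) * (z - sqrt A) ^ i)
      + 1 / fact 7 * f 7 \<xi> * (z - sqrt A) ^ 7" if "z \<in> D" for z
    using taylor that by blast
  have bound': "\<bar>f i z\<bar> * \<bar>sqrt A ^ i\<bar> \<le> B" if "i \<in> {1..7}" "z \<in> D" for i z
    using bound that by blast
  have "0 \<le> \<bar>f 1 (sqrt A)\<bar> * \<bar>sqrt A ^ 1\<bar>" by simp
  also have "\<dots> \<le> B" using s0 by (intro bound') auto
  finally have B: "0 \<le> B" .
  have d1: "\<bar>f 1 (sqrt A) * sqrt A\<bar> \<le> B" and d2: "\<bar>f 2 (sqrt A) * (sqrt A)\<^sup>2\<bar> \<le> B"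
    using bound'[of 1 "sqrt A"] bound'[of 2 "sqrt A"] s0 by (auto simp: abs_mult)
  have c2: "\<bar>c2\<bar> \<le> B / 4" using d1 d2 unfolding c2_def by linarith
  note kp = radial_kernel_properties[OF rep]
  have first: "\<bar>k x y - f 0 (sqrt A)\<bar> \<le> B * \<bar>((edist p x y)\<^sup>2 - A) / A\<bar>"
    and second: "\<bar>k x y - (f 0 (sqrt A) + c1 * (((edist p x y)\<^sup>2 - A) / A) + c2 * (((edist p x y)\<^sup>2 - A) / A)\<^sup>2)\<bar>
          \<le> 4 * B * min ((((edist p x y)\<^sup>2 - A) / A)\<^sup>2) (\<bar>((edist p x y)\<^sup>2 - A) / A\<bar> ^ 3)"
    if "x \<in> space (rspace p)" "y \<in> space (rspace p)" for x y
    using radial_kernel_expansion[OF rep s0 sA(1) taylor' bound' that] unfolding c1_def c2_def sA(2) by simp_all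
  note ee = energy_distance_expansion[OF bP bQ, folded A' \<tau>' q', OF A B c2 kp(1) first second \<beta>]
  have PQ: "?P \<in> borel_probs p" "?Q \<in> borel_probs p"
    using X Y by (auto simp: borel_probs_def intro: prob_space_distr)
  have "?P \<noteq> ?Q" using \<tau> \<tau>' by auto
  then have pos: "0 < energy_distance k ?P ?Q"
    using ee(1) by (intro energy_distance_pos[OF kernel PQ _ kp(1)]) auto
  have power: "1 - (48 * real (n + m) + 12 * C\<^sup>2) * c_coeff n m * (B\<^sup>2 * (((\<bar>\<tau>\<bar> + q) / A)\<^sup>2 + \<beta>))
        / (energy_distance k ?P ?Q)\<^sup>2
      \<le> measure M {\<omega> \<in> space M. C < test_stat p k n m (\<lambda>i. Xs i \<omega>) (\<lambda>j. Ys j \<omega>)}"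
    if "2 \<le> n" "2 \<le> m" "0 < C" for n m C
  proof -
    interpret two_sample_kernel M p Xs Ys ?P ?Q k "f 0 (sqrt A)" "B\<^sup>2 * (((\<bar>\<tau>\<bar> + q) / A)\<^sup>2 + \<beta>)" n m
      by unfold_locales (use kp ee that in auto)
    show ?thesis by (rule test_stat_power[OF pos that(3)])
  qed
  show "\<exists>\<D>>0. \<bar>\<D> - (2 * c1 * q / A - 2 * c2 * \<tau>\<^sup>2 / A\<^sup>2)\<bar>
            \<le> B * (q\<^sup>2 / A\<^sup>2 + 65 * \<beta> + 64 * ((\<bar>\<tau>\<bar> + q) / A) ^ 3) \<and>
          (\<forall>n m C. 2 \<le> n \<longrightarrow> 2 \<le> m \<longrightarrow> 0 < C \<longrightarrow>
            1 - (48 * real (n + m) + 12 * C\<^sup>2) * c_coeff n m * (B\<^sup>2 * (((\<bar>\<tau>\<bar> + q) / A)\<^sup>2 + \<beta>)) / \<D>\<^sup>2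
            \<le> measure M {\<omega> \<in> space M. C < test_stat p k n m (\<lambda>i. Xs i \<omega>) (\<lambda>j. Ys j \<omega>)})"
    using pos ee(4) power by blast
  show False if "B = 0"
  proof -
    have "c1 = 0" "c2 = 0" using d1 c2 that by (auto simp: c1_def)
    then have "\<bar>energy_distance k ?P ?Q\<bar> \<le> 0" using ee(4) that by simp
    then show False using pos by simp
  qed
qed
theorem proposition22:
  fixes M :: "nat \<Rightarrow> 'a measure"
    and X Y :: "nat \<Rightarrow> 'a \<Rightarrow> rvec"
    and Xs Ys Zs :: "nat \<Rightarrow> nat \<Rightarrow> 'a \<Rightarrow> rvec"
    and \<C> :: "kernel_seq set"
    and f :: "kernel_seq \<Rightarrow> nat \<Rightarrow> nat \<Rightarrow> real \<Rightarrow> real"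
    and D D0 :: "kernel_seq \<Rightarrow> nat \<Rightarrow> real set"
    and \<alpha> :: "nat \<Rightarrow> nat"
    and \<rho> \<delta>1 \<delta>2 L2 U2 C :: real
    and ns ms ps :: "nat \<Rightarrow> nat"
    and k :: kernel_seq
  assumes rho: "0 < \<rho>" "\<rho> < 1"
    and model: "\<forall>p\<ge>1. sampling_model p (M p) \<rho> (X p) (Y p) (Xs p) (Ys p) (Zs p)"
    and kernels: "\<forall>\<kappa>\<in>\<C>. \<forall>p\<ge>1. is_kernel p (\<kappa> p)"
    and radial: "\<forall>\<kappa>\<in>\<C>. \<forall>p\<ge>1. radial_representation p (\<kappa> p) (D \<kappa> p) (f \<kappa> p)"
    and D0: "\<forall>\<kappa>\<in>\<C>. \<forall>p\<ge>1. D0 \<kappa> p \<subseteq> D \<kappa> p \<and>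
          sqrt (mean_sq_dist p (M p) (Zs p 1) (Zs p 2)) \<in> D0 \<kappa> p \<and>
          sqrt (mean_sq_dist p (M p) (Xs p 1) (Ys p 1)) \<in> D0 \<kappa> p"
    and K1: "\<forall>\<kappa>\<in>\<C>. \<forall>p\<ge>1. \<forall>s\<in>D \<kappa> p. \<forall>s0\<in>D0 \<kappa> p. \<exists>\<xi>\<in>closed_segment s s0.
          f \<kappa> p 0 s = (\<Sum>i=0..6. 1 / fact i * f \<kappa> p i s0 * (s - s0) ^ i)
                      + 1 / fact 7 * f \<kappa> p 7 \<xi> * (s - s0) ^ 7"
    and K2: "\<exists>M1::real. \<forall>\<kappa>\<in>\<C>. \<forall>p\<ge>1. \<forall>s0\<in>D0 \<kappa> p. \<forall>i\<in>{1..7}. \<forall>s\<in>D \<kappa> p.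
          \<bar>f \<kappa> p i s\<bar> * \<bar>s0 ^ i\<bar> \<le> M1 * \<bar>f \<kappa> p 0 s0\<bar>"
    and K3: "\<exists>M2::real. \<forall>\<kappa>\<in>\<C>. \<forall>p\<ge>1. \<forall>s0\<in>D0 \<kappa> p.
          \<bar>f \<kappa> p 0 s0\<bar> \<le> M2 * min \<bar>1/2 * f \<kappa> p 1 s0 * s0\<bar>
                                   \<bar>- (1/8) * f \<kappa> p 1 s0 * s0 + 1/8 * f \<kappa> p 2 s0 * s0\<^sup>2\<bar>"
    and D1: "\<forall>p\<ge>1. 1 \<le> \<alpha> p" "(\<lambda>p. real (\<alpha> p)) \<in> o(\<lambda>p. real p)"
          "\<forall>p\<ge>1. lag_independent p (M p) (X p) (\<alpha> p) \<and> lag_independent p (M p) (Y p) (\<alpha> p)"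
    and D2: "\<exists>U::real. 0 < U \<and> (\<forall>p\<ge>1. \<forall>j\<in>{1..p}. \<forall>r\<in>{1..128::nat}. \<forall>V\<in>{X p, Y p}.
          integrable (M p) (\<lambda>\<omega>. \<bar>V \<omega> j\<bar> ^ r) \<and> (\<integral>\<omega>. \<bar>V \<omega> j\<bar> ^ r \<partial>(M p)) < U)"
    and D3: "\<exists>L0 U0::real. 0 < L0 \<and> 0 < U0 \<and> (\<forall>p\<ge>1.
          \<forall>a\<in>{mean_sq_dist p (M p) (Xs p 1) (Xs p 2), mean_sq_dist p (M p) (Xs p 1) (Ys p 1),
               mean_sq_dist p (M p) (Ys p 1) (Ys p 2)}.
          L0 * real p \<le> a \<and> a \<le> U0 * real p)"
    and D4: "\<exists>L U::real. 0 < L \<and> 0 < U \<and> (\<forall>p\<ge>1.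
          \<forall>a\<in>{(frobenius_norm p (cov_mat (M p) (X p)))\<^sup>2, (frobenius_norm p (cov_mat (M p) (Y p)))\<^sup>2}.
          L * real (\<alpha> p) * real p \<le> a \<and> a \<le> U * real (\<alpha> p) * real p)"
    and alpha_bounded: "(\<lambda>p. real (\<alpha> p)) \<in> O(\<lambda>_. 1)"
    and bounds_pos: "0 < L2" "0 < U2"
    and exponents: "0 \<le> \<delta>1" "\<delta>1 < 1" "-1 \<le> \<delta>2" "\<delta>2 < 1" "\<delta>1 \<noteq> \<delta>2" "0 < max \<delta>1 \<delta>2"
    and mixed_cov: "\<forall>p\<ge>1.
          let a = (frobenius_norm p (\<lambda>i j. \<rho> * cov_mat (M p) (X p) i j
                                          + (1 - \<rho>) * cov_mat (M p) (Y p) i j))\<^sup>2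
          in L2 * real (\<alpha> p) * real p \<le> a \<and> a \<le> U2 * real (\<alpha> p) * real p"
    and mean_diff: "\<forall>p\<ge>1.
          let a = (enorm p (\<lambda>i. mean_vec (M p) (X p) i - mean_vec (M p) (Y p) i))\<^sup>2
          in L2 * real p powr \<delta>1 \<le> a \<and> a \<le> U2 * real p powr \<delta>1"
    and trace_diff: "\<forall>p\<ge>1.
          let a = \<bar>centered_sq_norm p (M p) (Xs p 1) - centered_sq_norm p (M p) (Ys p 1)\<bar>
          in L2 * real p powr ((1 + \<delta>2) / 2) \<le> a \<and> a \<le> U2 * real p powr ((1 + \<delta>2) / 2)"
    and fourth_moment: "\<forall>\<kappa>\<in>\<C>. \<forall>p\<ge>1. integrable (M p) (\<lambda>\<omega>. (\<kappa> p (Zs p 1 \<omega>) (Zs p 2 \<omega>)) ^ 4)"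
    and limits: "filterlim ns at_top sequentially" "filterlim ms at_top sequentially"
          "filterlim ps at_top sequentially"
    and balance: "(\<lambda>t. real (ns t) / real (ns t + ms t) - \<rho>) \<in> O(\<lambda>t. 1 / real (ns t + ms t))"
    and growth: "(\<lambda>t. real (ps t)) \<in>
          o(\<lambda>t. real (ns t + ms t) powr (1 / (2 - 2 * max (max \<delta>1 \<delta>2) (1/2))))"
    and k: "k \<in> \<C>"
    and C: "0 < C"
  shows "(\<lambda>t. measure (M (ps t)) {\<omega> \<in> space (M (ps t)).
            C < test_stat (ps t) (k (ps t)) (ns t) (ms t)
                  (\<lambda>i. Xs (ps t) i \<omega>) (\<lambda>j. Ys (ps t) j \<omega>)}) \<longlonglongrightarrow> 1"
proof -
  obtain M1 where M1: "\<And>\<kappa> p s0 i s. \<kappa> \<in> \<C> \<Longrightarrow> 1 \<le> p \<Longrightarrow> s0 \<in> D0 \<kappa> p \<Longrightarrow> i \<in> {1..7} \<Longrightarrow> s \<in> D \<kappa> p \<Longrightarrow>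
      \<bar>f \<kappa> p i s\<bar> * \<bar>s0 ^ i\<bar> \<le> M1 * \<bar>f \<kappa> p 0 s0\<bar>"
    using K2 by metis
  obtain M2 where M2: "\<And>\<kappa> p s0. \<kappa> \<in> \<C> \<Longrightarrow> 1 \<le> p \<Longrightarrow> s0 \<in> D0 \<kappa> p \<Longrightarrow>
      \<bar>f \<kappa> p 0 s0\<bar> \<le> M2 * min \<bar>1/2 * f \<kappa> p 1 s0 * s0\<bar>
          \<bar>- (1/8) * f \<kappa> p 1 s0 * s0 + 1/8 * f \<kappa> p 2 s0 * s0\<^sup>2\<bar>"
    using K3 by metis
  obtain b where b: "0 < b" "\<And>p j V. 1 \<le> p \<Longrightarrow> j \<in> {1..p} \<Longrightarrow> V \<in> {X p, Y p} \<Longrightarrow>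
      integrable (M p) (\<lambda>\<omega>. \<bar>V \<omega> j\<bar> ^ 4) \<and> (\<integral>\<omega>. \<bar>V \<omega> j\<bar> ^ 4 \<partial>(M p)) \<le> b"
  proof -
    from D2 obtain U :: real where U: "0 < U" and "\<forall>p\<ge>1. \<forall>j\<in>{1..p}. \<forall>r\<in>{1..128::nat}. \<forall>V\<in>{X p, Y p}.
          integrable (M p) (\<lambda>\<omega>. \<bar>V \<omega> j\<bar> ^ r) \<and> (\<integral>\<omega>. \<bar>V \<omega> j\<bar> ^ r \<partial>(M p)) < U"
      by blast
    note r = this(2)[rule_format, of _ _ 4]
    show thesis by (rule that[OF U]) (use r in \<open>force intro: less_imp_le\<close>)
  qed
  obtain L0 U0 where LU: "0 < L0" "0 < U0"
    and AXY: "\<And>p. 1 \<le> p \<Longrightarrow> L0 * real p \<le> mean_sq_dist p (M p) (Xs p 1) (Ys p 1)"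
      "\<And>p. 1 \<le> p \<Longrightarrow> mean_sq_dist p (M p) (Xs p 1) (Ys p 1) \<le> U0 * real p"
    using D3 by (metis insertCI)
  obtain a0 where a0: "\<forall>\<^sub>F p in sequentially. real (\<alpha> p) \<le> a0"
    using alpha_bounded by (auto elim!: landau_o.bigE)
  define \<beta> where "\<beta> = (2 * a0 + 1) * (16 * b) / L0\<^sup>2"
  define \<delta> where "\<delta> = max \<delta>1 \<delta>2"
  have \<delta>: "0 < \<delta>" "\<delta> < 1" using exponents by (auto simp: \<delta>_def)
  have "\<exists>p. 0 \<le> a0" using eventually_happens[OF a0] by (meson of_nat_0_le_iff order_trans sequentially_bot)
  then have a00: "0 \<le> a0" by simp
  have \<beta>0: "0 \<le> \<beta>" using a00 b(1) by (simp add: \<beta>_def)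
  \<comment> \<open>enlarging the constants of (K2) and (K3) makes them positive\<close>
  define N1 where "N1 = max M1 1"
  define N2 where "N2 = max M2 1"
  obtain \<kappa> where \<kappa>: "0 < \<kappa>" and signal: "\<forall>\<^sub>F p in sequentially. \<forall>F A q \<tau> c1 c2 D. 0 < F \<longrightarrow>
      L0 * real p \<le> A \<longrightarrow> A \<le> U0 * real p \<longrightarrow>
      L2 * real p powr \<delta>1 \<le> q \<longrightarrow> q \<le> U2 * real p powr \<delta>1 \<longrightarrow>
      L2 * real p powr ((1 + \<delta>2) / 2) \<le> \<bar>\<tau>\<bar> \<longrightarrow> \<bar>\<tau>\<bar> \<le> U2 * real p powr ((1 + \<delta>2) / 2) \<longrightarrow>
      \<bar>c1\<bar> \<le> N1 * F \<longrightarrow> \<bar>c2\<bar> \<le> N1 * F \<longrightarrow> F \<le> N2 * \<bar>c1\<bar> \<longrightarrow> F \<le> N2 * \<bar>c2\<bar> \<longrightarrow>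
      \<bar>D - (2 * c1 * q / A - 2 * c2 * \<tau>\<^sup>2 / A\<^sup>2)\<bar>
        \<le> N1 * F * (q\<^sup>2 / A\<^sup>2 + 65 * (\<beta> / real p) + 64 * ((\<bar>\<tau>\<bar> + q) / A) ^ 3) \<longrightarrow>
      \<kappa> * F * real p powr (\<delta> - 1) \<le> \<bar>D\<bar>"
  proof -
    have N: "0 \<le> N1" "0 < N2" by (auto simp: N1_def N2_def)
    from signal_lower_bound[OF LU bounds_pos N \<beta>0 exponents, folded \<delta>_def]
    show thesis by (elim exE conjE) (rule that)
  qed
  define G where "G = N1\<^sup>2 * (4 * (U2 / L0)\<^sup>2 + \<beta>) / \<kappa>\<^sup>2"
  have dim: "\<forall>\<^sub>F p in sequentially. \<forall>n m. 2 \<le> n \<longrightarrow> 2 \<le> m \<longrightarrow>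
      1 - (48 * real (n + m) + 12 * C\<^sup>2) * c_coeff n m * (G * real p powr (1 - \<delta>))
        \<le> measure (M p) {\<omega> \<in> space (M p). C < test_stat p (k p) n m (\<lambda>i. Xs p i \<omega>) (\<lambda>j. Ys p j \<omega>)}"
    using signal a0 eventually_ge_at_top[of 1]
  proof eventually_elim
    case (elim p)
    note sig = elim(1)
    have p: "1 \<le> p" and rp: "0 < real p" using elim(3) by auto
    define A where "A = mean_sq_dist p (M p) (Xs p 1) (Ys p 1)"
    define s where "s = sqrt A"
    define c1 where "c1 = 1/2 * f k p 1 s * s"
    define c2 where "c2 = - (1/8) * f k p 1 s * s + 1/8 * f k p 2 s * s\<^sup>2"
    define q where "q = (enorm p (\<lambda>i. mean_vec (M p) (X p) i - mean_vec (M p) (Y p) i))\<^sup>2"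
    define \<tau> where "\<tau> = centered_sq_norm p (M p) (Xs p 1) - centered_sq_norm p (M p) (Ys p 1)"
    define F where "F = \<bar>f k p 0 s\<bar>"
    define B where "B = N1 * F"
    have A: "L0 * real p \<le> A" "A \<le> U0 * real p" unfolding A_def by (rule AXY[OF p])+
    have "0 < L0 * real p" using LU(1) rp by (rule mult_pos_pos)
    then have Apos: "0 < A" using A(1) by linarith
    have s0: "s \<in> D0 k p" "s \<in> D k p" using D0 k p unfolding s_def A_def by auto
    have bound: "\<bar>f k p i z\<bar> * \<bar>s ^ i\<bar> \<le> B" if iz: "i \<in> {1..7}" "z \<in> D k p" for i z
    proof -
      have "M1 * F \<le> N1 * F" by (intro mult_right_mono) (auto simp: N1_def F_def)
      then show ?thesis using M1[OF k p s0(1) iz] unfolding F_def B_def by linarith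
    qed
    have q: "L2 * real p powr \<delta>1 \<le> q" "q \<le> U2 * real p powr \<delta>1"
      unfolding q_def using mean_diff p by (auto simp: Let_def)
    have \<tau>: "L2 * real p powr ((1 + \<delta>2) / 2) \<le> \<bar>\<tau>\<bar>" "\<bar>\<tau>\<bar> \<le> U2 * real p powr ((1 + \<delta>2) / 2)"
      unfolding \<tau>_def using trace_diff p by (auto simp: Let_def)
    have "0 < L2 * real p powr ((1 + \<delta>2) / 2)" using bounds_pos rp by simp
    then have \<tau>0: "\<tau> \<noteq> 0" using \<tau>(1) by auto
    have \<beta>': "real p * real (2 * \<alpha> p + 1) * (16 * b) / A\<^sup>2 \<le> \<beta> / real p"
    proof -
      have "real p * real (2 * \<alpha> p + 1) * (16 * b) / A\<^sup>2
          \<le> real p * (2 * a0 + 1) * (16 * b) / (L0 * real p)\<^sup>2"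
        using A(1) LU rp elim(2) b(1) a00
        by (intro frac_le mult_mono power_mono) auto
      also have "\<dots> = \<beta> / real p" using rp LU by (simp add: \<beta>_def field_simps power2_eq_square)
      finally show ?thesis .
    qed
    have fp_prem: "sampling_model p (M p) \<rho> (X p) (Y p) (Xs p) (Ys p) (Zs p)" "is_kernel p (k p)"
      "radial_representation p (k p) (D k p) (f k p)"
      using model kernels radial k p by auto
    have tay: "\<forall>z\<in>D k p. \<exists>\<xi>\<in>closed_segment z (sqrt A). f k p 0 z
          = (\<Sum>i=0..6. 1 / fact i * f k p i (sqrt A) * (z - sqrt A) ^ i) + 1 / fact 7 * f k p 7 \<xi> * (z - sqrt A) ^ 7"
      using K1 k p s0(1) unfolding s_def by blast
    have bnd: "\<forall>i\<in>{1..7}. \<forall>z\<in>D k p. \<bar>f k p i z\<bar> * \<bar>sqrt A ^ i\<bar> \<le> B"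
      using bound unfolding s_def by blast
    have mom: "\<forall>j\<in>{1..p}. \<forall>V\<in>{X p, Y p}.
        integrable (M p) (\<lambda>\<omega>. \<bar>V \<omega> j\<bar> ^ 4) \<and> (\<integral>\<omega>. \<bar>V \<omega> j\<bar> ^ 4 \<partial>(M p)) \<le> b"
      using b(2)[OF p] by blast
    have lag: "lag_independent p (M p) (X p) (\<alpha> p)" "lag_independent p (M p) (Y p) (\<alpha> p)"
      using D1(3) p by auto
    note fp = fixed_dimension_power[OF p fp_prem A_def Apos s0(2)[unfolded s_def] tay bnd lag mom \<beta>' q_def \<tau>_def \<tau>0
        c1_def[unfolded s_def] c2_def[unfolded s_def]]
    have "B \<noteq> 0" using fp(2) by blast
    then have Fpos: "0 < F" by (simp add: B_def F_def)
    obtain \<D> where \<D>: "0 < \<D>"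
      "\<bar>\<D> - (2 * c1 * q / A - 2 * c2 * \<tau>\<^sup>2 / A\<^sup>2)\<bar>
          \<le> B * (q\<^sup>2 / A\<^sup>2 + 65 * (\<beta> / real p) + 64 * ((\<bar>\<tau>\<bar> + q) / A) ^ 3)"
      and power: "\<forall>n m C. 2 \<le> n \<longrightarrow> 2 \<le> m \<longrightarrow> 0 < C \<longrightarrow>
          1 - (48 * real (n + m) + 12 * C\<^sup>2) * c_coeff n m * (B\<^sup>2 * (((\<bar>\<tau>\<bar> + q) / A)\<^sup>2 + \<beta> / real p)) / \<D>\<^sup>2
          \<le> measure (M p) {\<omega> \<in> space (M p). C < test_stat p (k p) n m (\<lambda>i. Xs p i \<omega>) (\<lambda>j. Ys p j \<omega>)}"
      using fp(1) by (elim exE conjE) (rule that)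
    have d: "\<bar>f k p 1 s * s\<bar> \<le> B" "\<bar>f k p 2 s * s\<^sup>2\<bar> \<le> B"
      using bound[of 1 s] bound[of 2 s] s0(2) by (auto simp: abs_mult)
    have c: "\<bar>c1\<bar> \<le> N1 * F" "\<bar>c2\<bar> \<le> N1 * F"
      using d unfolding B_def[symmetric] c1_def c2_def by linarith+
    have "F \<le> M2 * min \<bar>c1\<bar> \<bar>c2\<bar>"
      unfolding F_def c1_def c2_def by (rule M2[OF k p s0(1)])
    also have "\<dots> \<le> N2 * min \<bar>c1\<bar> \<bar>c2\<bar>"
      by (intro mult_right_mono) (auto simp: N2_def)
    finally have cF: "F \<le> N2 * min \<bar>c1\<bar> \<bar>c2\<bar>" .
    have "0 \<le> N2" by (simp add: N2_def)
    then have c': "F \<le> N2 * \<bar>c1\<bar>" "F \<le> N2 * \<bar>c2\<bar>"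
      using cF mult_left_mono[OF min.cobounded1, of N2 "\<bar>c1\<bar>" "\<bar>c2\<bar>"]
        mult_left_mono[OF min.cobounded2, of N2 "\<bar>c1\<bar>" "\<bar>c2\<bar>"] by linarith+
    have "\<kappa> * F * real p powr (\<delta> - 1) \<le> \<bar>\<D>\<bar>"
      by (rule sig[rule_format, OF Fpos A q \<tau> c c' \<D>(2)[unfolded B_def]])
    then have low: "\<kappa> * F * real p powr (\<delta> - 1) \<le> \<D>"
      using \<D>(1) by simp
    have q0: "0 \<le> q" by (simp add: q_def)
    have noise: "((\<bar>\<tau>\<bar> + q) / A)\<^sup>2 + \<beta> / real p \<le> (4 * (U2 / L0)\<^sup>2 + \<beta>) * real p powr (\<delta> - 1)"
      unfolding \<delta>_def
      by (rule noise_upper_bound[OF LU(1) bounds_pos(2) \<beta>0 exponents(1,2,4,6) p A(1) q0 q(2) \<tau>(2)])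
    have ratio: "(B\<^sup>2 * (((\<bar>\<tau>\<bar> + q) / A)\<^sup>2 + \<beta> / real p)) / \<D>\<^sup>2 \<le> G * real p powr (1 - \<delta>)"
    proof -
      have "0 < real p powr (\<delta> - 1)" "0 \<le> ((\<bar>\<tau>\<bar> + q) / A)\<^sup>2 + \<beta> / real p" using rp \<beta>0 by simp_all
      from noise_signal_ratio[OF Fpos \<kappa> this noise low, of N1]
      have "(B\<^sup>2 * (((\<bar>\<tau>\<bar> + q) / A)\<^sup>2 + \<beta> / real p)) / \<D>\<^sup>2 \<le> G * (1 / real p powr (\<delta> - 1))"
        unfolding G_def B_def .
      also have "1 / real p powr (\<delta> - 1) = real p powr (1 - \<delta>)"
        using powr_minus_divide[of "real p" "\<delta> - 1"] by simp
      finally show ?thesis .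
    qed
    show ?case
    proof (intro allI impI)
      fix n m :: nat assume nm: "2 \<le> n" "2 \<le> m"
      have "0 \<le> c_coeff n m" unfolding c_coeff_def using nm by simp
      then have "(48 * real (n + m) + 12 * C\<^sup>2) * c_coeff n m * ((B\<^sup>2 * (((\<bar>\<tau>\<bar> + q) / A)\<^sup>2 + \<beta> / real p)) / \<D>\<^sup>2)
          \<le> (48 * real (n + m) + 12 * C\<^sup>2) * c_coeff n m * (G * real p powr (1 - \<delta>))"
        using ratio by (intro mult_left_mono) auto
      then show "1 - (48 * real (n + m) + 12 * C\<^sup>2) * c_coeff n m * (G * real p powr (1 - \<delta>))
          \<le> measure (M p) {\<omega> \<in> space (M p). C < test_stat p (k p) n m (\<lambda>i. Xs p i \<omega>) (\<lambda>j. Ys p j \<omega>)}"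
        using power[rule_format, OF nm C] unfolding times_divide_eq_right by linarith
    qed
  qed
  show ?thesis
  proof (rule power_tendsto_one[where C = C and G = G and \<rho> = \<rho> and \<delta> = \<delta> and
        \<pi> = "\<lambda>p n m. measure (M p) {\<omega> \<in> space (M p). C < test_stat p (k p) n m (\<lambda>i. Xs p i \<omega>) (\<lambda>j. Ys p j \<omega>)}",
        OF rho \<delta> _ limits balance growth[folded \<delta>_def] dim])
    show "0 \<le> G" using \<beta>0 by (simp add: G_def)
    show "\<forall>\<^sub>F p in sequentially. \<forall>n m.
        measure (M p) {\<omega> \<in> space (M p). C < test_stat p (k p) n m (\<lambda>i. Xs p i \<omega>) (\<lambda>j. Ys p j \<omega>)} \<le> 1"
      using eventually_ge_at_top[of 1]
    proof eventually_elim
      case (elim p)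
      then have "prob_space (M p)" using model by (simp add: sampling_model_def)
      then show ?case by (simp add: prob_space.prob_le_1)
    qed
  qed
qed

end
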